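(* The isometry group of $\mathscr{W}_2(\mathbb{R})$ is a semidirect product $$\mathrm{Isom}\,\mathscr{W}_2(\mathbb{R})\;\cong\;\mathrm{Isom}\,\mathbb{R}\ltimes \mathrm{Isom}\,\mathbb{R},$$ where the right factor is normal. Both factors decompose as $\mathrm{Isom}\,\mathbb{R}=\mathbb{Z}/2\mathbb{Z}\ltimes\mathbb{R}$, where $\mathbb{Z}/2\mathbb{Z}$ is identified with $\{\pm1\}$ and $(\varepsilon,v)$ denotes the map $x\mapsto \varepsilon x+v$. The action of the left factor on the right factor defining the semidirect product is $$(\varepsilon,v)\cdot(\eta,t)=(\eta,\varepsilon t).$$ More precisely, the left factor is the image of $\#:\mathrm{Isom}\,\mathbb{R}\to\mathrm{Isom}\,\mathscr{W}_2(\mathbb{R})$, and the right factor consists of all isometries of $\mathscr{W}_2(\mathbb{R})$ that fix every Dirac mass $\delta_x$, $x\in\mathbb{R}$. In the decomposition $\mathbb{Z}/2\mathbb{Z}\ltimes\mathbb{R}$ of the right factor, the $\mathbb{Z}/2\mathbb{Z}$ factor is generated by a non-trivial involution that preserves shapes, while the $\mathbb{R}$ factor is a flow (one-parameter group) of isometries whose elements other than the identity are exotic.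
   Context: For a Polish geodesic metric space $X$, $\mathscr{W}_2(X)$ is the set of Borel probability measures $\mu$ on $X$ with $\int_X d^2(x_0,x)\,\mu(dx)<\infty$ for some (hence every) $x_0\in X$, endowed with the quadratic Wasserstein distance $d_{\mathscr W}^2(\mu_0,\mu_1)=\inf_\Pi\int_{X\times X}d^2(x,y)\,\Pi(dx\,dy)$, the infimum being over all couplings $\Pi$ of $\mu_0,\mu_1$ (probability measures on $X\times X$ with marginals $\mu_0,\mu_1$). $\mathrm{Isom}\,Y$ denotes the group of (bijective) isometries of a metric space $Y$. For $\varphi\in\mathrm{Isom}\,X$, $\#(\varphi)=\varphi_\#\in\mathrm{Isom}\,\mathscr{W}_2(X)$ is the push-forward map $\varphi_\#(\mu)(A)=\mu(\varphi^{-1}(A))$; the homomorphism $\#$ is injective, and isometries of $\mathscr{W}_2(X)$ in its image are called trivial. A self-map $\Phi$ of $\mathscr{W}_2(X)$ preserves shapes if for every $\mu\in\mathscr{W}_2(X)$ there is an isometry $\varphi$ of $X$ (depending on $\mu$) such that $\Phi(\mu)=\varphi_\#(\mu)$. An isometry of $\mathscr{W}_2(X)$ that does not preserve shapes is called exotic. *)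

theory Defs
  imports "HOL-Probability.Probability" "HOL-Algebra.Bij" "HOL-Algebra.Generated_Groups"
begin

section \<open>The quadratic Wasserstein space\<close>

definition W2 :: "'a::polish_space measure set" where
  "W2 = {\<mu>. prob_space \<mu> \<and> sets \<mu> = sets borel \<and>
             (\<exists>x0. (\<integral>\<^sup>+x. ennreal ((dist x0 x)\<^sup>2) \<partial>\<mu>) < \<infinity>)}"

definition couplings :: "'a::polish_space measure \<Rightarrow> 'a measure \<Rightarrow> ('a \<times> 'a) measure set" where
  "couplings \<mu> \<nu> = {\<gamma>. prob_space \<gamma> \<and> sets \<gamma> = sets borel \<and>
                        distr \<gamma> borel fst = \<mu> \<and> distr \<gamma> borel snd = \<nu>}"

text \<open>The infimum is taken in the extended nonnegative reals; it is finite for \<open>\<mu>, \<nu> \<in> W2\<close>, so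
  that passing to the reals loses nothing there.\<close>

definition dW2 :: "'a::polish_space measure \<Rightarrow> 'a measure \<Rightarrow> real" where
  "dW2 \<mu> \<nu> =
     sqrt (enn2real (INF \<gamma>\<in>couplings \<mu> \<nu>. \<integral>\<^sup>+(x, y). ennreal ((dist x y)\<^sup>2) \<partial>\<gamma>))"

section \<open>Isometry groups\<close>

text \<open>As in \<^const>\<open>Bij\<close>, isometries of a carrier set \<open>S\<close> are extensional (\<open>undefined\<close> outside \<open>S\<close>), so that
  equality of functions is equality on \<open>S\<close>. No metric axioms for \<open>d\<close> are needed to
  obtain a group.\<close>

definition isom_group :: "'a set \<Rightarrow> ('a \<Rightarrow> 'a \<Rightarrow> real) \<Rightarrow> ('a \<Rightarrow> 'a) monoid" where
  "isom_group S d =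
     (BijGroup S)\<lparr>carrier := {f \<in> Bij S. \<forall>x\<in>S. \<forall>y\<in>S. d (f x) (f y) = d x y}\<rparr>"

abbreviation Isom :: "('a::polish_space \<Rightarrow> 'a) monoid" where
  "Isom \<equiv> isom_group UNIV dist"

abbreviation IsomW2 :: "('a::polish_space measure \<Rightarrow> 'a measure) monoid" where
  "IsomW2 \<equiv> isom_group W2 dW2"

definition push :: "('a::polish_space \<Rightarrow> 'a) \<Rightarrow> 'a measure \<Rightarrow> 'a measure" where
  "push \<phi> = (\<lambda>\<mu>\<in>W2. distr \<mu> borel \<phi>)"

definition trivial_isometries :: "('a::polish_space measure \<Rightarrow> 'a measure) set" where
  "trivial_isometries = push ` carrier Isom"

definition dirac_fixing_isometries :: "('a::polish_space measure \<Rightarrow> 'a measure) set" where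
  "dirac_fixing_isometries =
     {\<Phi> \<in> carrier IsomW2. \<forall>x. \<Phi> (return borel x) = return borel x}"

definition preserves_shapes :: "('a::polish_space measure \<Rightarrow> 'a measure) \<Rightarrow> bool" where
  "preserves_shapes \<Phi> \<longleftrightarrow> (\<forall>\<mu>\<in>W2. \<exists>\<phi>\<in>carrier Isom. \<Phi> \<mu> = push \<phi> \<mu>)"

definition exotic :: "('a::polish_space measure \<Rightarrow> 'a measure) \<Rightarrow> bool" where
  "exotic \<Phi> \<longleftrightarrow> \<Phi> \<in> carrier IsomW2 \<and> \<not> preserves_shapes \<Phi>"

section \<open>Semidirect products and one-parameter groups\<close>

text \<open>\<open>H \<ltimes> N\<close> with \<open>N\<close> normal and \<open>H\<close> acting on \<open>N\<close> by \<open>\<alpha>\<close>. The pair \<open>(h, n)\<close> stands for the product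
  \<open>n h\<close>, so that \<open>\<alpha> h n = h n h\<^sup>-\<^sup>1\<close>; this is the order in which \<open>(\<epsilon>, v)\<close> is the map
  \<open>x \<mapsto> \<epsilon> x + v\<close>, i.e. first \<open>\<epsilon>\<close>, then the translation.\<close>

definition semidirect_product ::
    "('a, 'c) monoid_scheme \<Rightarrow> ('b, 'd) monoid_scheme \<Rightarrow> ('a \<Rightarrow> 'b \<Rightarrow> 'b) \<Rightarrow> ('a \<times> 'b) monoid" where
  "semidirect_product H N \<alpha> =
     \<lparr>carrier = carrier H \<times> carrier N,
      mult = (\<lambda>(h, n) (h', n'). (h \<otimes>\<^bsub>H\<^esub> h', n \<otimes>\<^bsub>N\<^esub> \<alpha> h n')),
      one = (\<one>\<^bsub>H\<^esub>, \<one>\<^bsub>N\<^esub>)\<rparr>"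

definition real_additive_group :: "real monoid" where
  "real_additive_group = \<lparr>carrier = UNIV, mult = (+), one = 0\<rparr>"

definition isometric_flow :: "'a set \<Rightarrow> ('a \<Rightarrow> 'a \<Rightarrow> real) \<Rightarrow> (real \<Rightarrow> 'a \<Rightarrow> 'a) \<Rightarrow> bool" where
  "isometric_flow S d F \<longleftrightarrow>
     F \<in> hom real_additive_group (isom_group S d) \<and>
     (\<forall>x\<in>S. \<forall>s. ((\<lambda>t. d (F t x) (F s x)) \<longlongrightarrow> 0) (at s))"

section \<open>The isometry group of the line\<close>

text \<open>\<open>\<int>/2\<int>\<close>, written multiplicatively as \<open>{1, -1}\<close>.\<close>

definition sign_group :: "real monoid" where
  "sign_group = \<lparr>carrier = {1, -1}, mult = (*), one = 1\<rparr>"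

definition affine_map :: "real \<times> real \<Rightarrow> real \<Rightarrow> real" where
  "affine_map = (\<lambda>(\<epsilon>, v) x. \<epsilon> * x + v)"

definition isom_coords :: "(real \<Rightarrow> real) \<Rightarrow> real \<times> real" where
  "isom_coords = inv_into ({1, -1} \<times> UNIV) affine_map"

text \<open>The action \<open>(\<epsilon>, v) \<cdot> (\<eta>, t) = (\<eta>, \<epsilon> t)\<close>. It is restricted to isometries because
  \<^const>\<open>AutoGroup\<close> consists of extensional functions.\<close>

definition isom_action :: "(real \<Rightarrow> real) \<Rightarrow> (real \<Rightarrow> real) \<Rightarrow> (real \<Rightarrow> real)" where
  "isom_action \<phi> = (\<lambda>\<psi>\<in>carrier Isom.
     (let (\<epsilon>, v) = isom_coords \<phi>; (\<eta>, t) = isom_coords \<psi> in affine_map (\<eta>, \<epsilon> * t)))"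

end

theory Submission
  imports Defs
begin

text \<open>
  The quadratic Wasserstein space of the line is a convex cone in a Hilbert space. Every measure is the law of its quantile
  function, a nondecreasing square-integrable function on the unit interval; the monotone coupling is optimal, so the Wasserstein
  distance is the \<open>L\<^sup>2\<close> distance of quantile functions (\<open>dW2_law\<close>). Dirac masses are the constants. The theorem is about the
  isometries of this cone.

  An isometry permutes the Dirac masses, since they are the points from which every segment can be doubled
  (\<open>dirac_iff_extendible\<close>): the segment from a nonconstant function to a constant cannot be
  prolonged within the cone. Composing with
  a push-forward, one reduces to isometries that fix all Dirac masses. These preserve inner products, hence linear relations, so they
  permute the extreme rays of the cone modulo constants (\<open>extremal_imp_unit_step\<close>). The rays are spanned by the standardised
  two-point distributions \<open>unit_step s\<close>, where \<open>s\<close> is the log-odds of the left atom, and the inner product of two of them is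
  \<open>exp (- \<bar>s - t\<bar> / 2)\<close>. So a Dirac-fixing isometry acts on the parameter \<open>s\<close> by an isometry of the line, and this
  action determines it, because inner products with all steps and the mean determine a quantile function
  (\<open>isometric_eq_if_eq_on_steps\<close>).

  Conversely every isometry of the parameter line occurs. The map \<open>s \<mapsto> - s\<close> comes from reflecting each measure through its own
  mean, which preserves shapes. The translation \<open>s \<mapsto> s + t\<close> comes from an explicit linear operator, \<open>flow t\<close>: it
  multiplies the derivative of a quantile function by an affine weight and transports it along a Moebius map of the unit interval. It
  is isometric because its squared norm differs from the original one by the integral of an exact derivative
  (\<open>flow_norm\<close>). It moves a measure with two atoms of equal mass to one with unequal masses, so it is exotic for \<open>t \<noteq> 0\<close>.

  Finally, conjugating by the push-forward along \<open>x \<mapsto> \<epsilon> x + v\<close> replaces the parameter \<open>s\<close> by \<open>\<epsilon> s\<close>, which gives the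
  action in the semidirect product (\<open>push_conj_dirac_isometry\<close>).
\<close>

section \<open>Laws of nondecreasing functions\<close>

definition U :: "real measure" where
  "U = restrict_space lborel {0<..<1}"

lemma space_U [simp]: "space U = {0<..<1}"
  by (simp add: U_def space_restrict_space)

lemma sets_U: "sets U = sets (restrict_space borel {0<..<1})"
  unfolding U_def by (intro sets_restrict_space_cong) simp

interpretation U: prob_space U
  by (auto simp: U_def emeasure_restrict_space space_restrict_space intro!: prob_spaceI)

definition law :: "(real \<Rightarrow> real) \<Rightarrow> real measure" where
  "law f = distr U borel f"

definition L2 :: "(real \<Rightarrow> real) set" where
  "L2 = {f \<in> borel_measurable U. integrable U (\<lambda>x. (f x)\<^sup>2)}"

definition mono_L2 :: "(real \<Rightarrow> real) set" where
  "mono_L2 = {f \<in> L2. mono_on {0<..<1} f}"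

lemma mono_measurable_U: "mono_on {0<..<1} f \<Longrightarrow> f \<in> borel_measurable U" for f :: "real \<Rightarrow> real"
  using borel_measurable_mono_on_fnc[of "{0<..<1}" f] sets_U measurable_cong_sets by blast

lemma L2_measurable [measurable_dest]: "f \<in> L2 \<Longrightarrow> f \<in> borel_measurable U"
  by (simp add: L2_def)

lemma mono_L2_L2: "f \<in> mono_L2 \<Longrightarrow> f \<in> L2"
  by (simp add: mono_L2_def)

lemma L2_iff_nn_integral:
  "f \<in> borel_measurable U \<Longrightarrow> f \<in> L2 \<longleftrightarrow> (\<integral>\<^sup>+x. ennreal ((f x)\<^sup>2) \<partial>U) < \<infinity>"
  by (auto simp: L2_def integrable_iff_bounded)

lemma nn_integral_dist_law:
  assumes [measurable]: "f \<in> borel_measurable U"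
  shows "(\<integral>\<^sup>+x. ennreal ((dist a x)\<^sup>2) \<partial>law f) = (\<integral>\<^sup>+x. ennreal ((f x - a)\<^sup>2) \<partial>U)"
  unfolding law_def by (subst nn_integral_distr) (auto simp: dist_real_def power2_commute)

lemma sq_add_le: "((a::real) + b)\<^sup>2 \<le> 2 * a\<^sup>2 + 2 * b\<^sup>2"
  using sum_squares_bound[of a b] by (simp add: power2_sum)

lemma L2_add:
  assumes "f \<in> L2" "g \<in> L2" shows "(\<lambda>x. f x + g x) \<in> L2"
proof -
  have [measurable]: "f \<in> borel_measurable U" "g \<in> borel_measurable U"
    using assms by (auto simp: L2_def)
  have "integrable U (\<lambda>x. 2 * (f x)\<^sup>2 + 2 * (g x)\<^sup>2)"
    using assms by (auto simp: L2_def)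
  then have "integrable U (\<lambda>x. (f x + g x)\<^sup>2)"
    by (rule Bochner_Integration.integrable_bound) (auto intro!: AE_I2 simp: sq_add_le)
  then show ?thesis by (auto simp: L2_def)
qed

lemma L2_scale: "f \<in> L2 \<Longrightarrow> (\<lambda>x. c * f x) \<in> L2"
  by (auto simp: L2_def power_mult_distrib)

lemma L2_const: "(\<lambda>x. c) \<in> L2"
  by (auto simp: L2_def)

lemma L2_diff: "f \<in> L2 \<Longrightarrow> g \<in> L2 \<Longrightarrow> (\<lambda>x. f x - g x) \<in> L2"
  using L2_add[of f "\<lambda>x. (-1) * g x"] L2_scale[of g "-1"] by simp

lemma mono_L2_add: "f \<in> mono_L2 \<Longrightarrow> g \<in> mono_L2 \<Longrightarrow> (\<lambda>x. f x + g x) \<in> mono_L2"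
  by (auto simp: mono_L2_def L2_add mono_on_def intro: add_mono)

lemma mono_L2_scale: "f \<in> mono_L2 \<Longrightarrow> 0 \<le> c \<Longrightarrow> (\<lambda>x. c * f x) \<in> mono_L2"
  by (auto simp: mono_L2_def L2_scale mono_on_def intro: mult_left_mono)

lemma mono_L2_const: "(\<lambda>x. c) \<in> mono_L2"
  by (auto simp: mono_L2_def L2_const mono_on_def)

lemma law_in_W2: assumes "f \<in> L2" shows "law f \<in> W2"
proof -
  have [measurable]: "f \<in> borel_measurable U" using assms by (auto simp: L2_def)
  have "prob_space (law f)" unfolding law_def by (intro U.prob_space_distr) simp
  moreover have "(\<integral>\<^sup>+x. ennreal ((dist 0 x)\<^sup>2) \<partial>law f) < \<infinity>"
    using assms L2_iff_nn_integral[of f] nn_integral_dist_law[of f 0] by simp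
  moreover have "sets (law f) = sets borel" by (simp add: law_def)
  ultimately show ?thesis unfolding W2_def by blast
qed

text \<open>The function is the generalised inverse of the distribution function. A second moment about some point is
  finite exactly when the second moment about 0 is, so it is square-integrable.\<close>

lemma W2_eq_law:
  assumes "\<mu> \<in> W2" obtains f where "f \<in> mono_L2" "law f = \<mu>"
proof -
  interpret prob_space \<mu> using assms by (simp add: W2_def)
  interpret cdf_distribution \<mu>
    using assms by (auto simp: W2_def cdf_distribution_def real_distribution_def real_distribution_axioms_def
        intro: prob_space_axioms)
  let ?f = "\<lambda>w. Inf {x. w \<le> cdf \<mu> x}"
  have law: "law ?f = \<mu>" unfolding law_def U_def by (rule distr_I_eq_M)
  have mono: "mono_on {0<..<1} ?f" by (rule mono_I)
  then have [measurable]: "?f \<in> borel_measurable U" by (rule mono_measurable_U)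
  obtain a where "(\<integral>\<^sup>+x. ennreal ((dist a x)\<^sup>2) \<partial>\<mu>) < \<infinity>"
    using assms by (auto simp: W2_def)
  then have "(\<integral>\<^sup>+x. ennreal ((?f x - a)\<^sup>2) \<partial>U) < \<infinity>"
    using nn_integral_dist_law[of ?f a] law by simp
  then have "(\<lambda>x. ?f x - a) \<in> L2" by (subst L2_iff_nn_integral) auto
  from L2_add[OF this L2_const[of a]] have "?f \<in> L2" by simp
  then show thesis using mono law that by (auto simp: mono_L2_def)
qed

section \<open>Optimality of the monotone coupling\<close>

text \<open>The square of the length of an interval is the area of its square. Written this way, the quadratic cost
  becomes a superposition of indicators of quadrants, whatever the order of the two points.\<close>

lemma sq_diff_eq_nn_integral:
  "ennreal ((x - y)\<^sup>2) = (\<integral>\<^sup>+s. \<integral>\<^sup>+t. indicator {x..<y} s * indicator {x..<y} t +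
     indicator {y..<x} s * indicator {y..<x} t \<partial>lborel \<partial>lborel)" for x y :: real
proof -
  have "(\<integral>\<^sup>+s. \<integral>\<^sup>+t. indicator {x..<y} s * indicator {x..<y} t +
     indicator {y..<x} s * indicator {y..<x} t \<partial>lborel \<partial>lborel)
     = emeasure lborel {x..<y} * emeasure lborel {x..<y} + emeasure lborel {y..<x} * emeasure lborel {y..<x}"
    by (simp add: nn_integral_add nn_integral_cmult nn_integral_multc)
  also have "\<dots> = ennreal ((x - y)\<^sup>2)"
    by (cases "x \<le> y") (auto simp: ennreal_mult[symmetric] power2_eq_square algebra_simps)
  finally show ?thesis ..
qed

text \<open>The cost of a coupling depends only on the masses of the quadrants \<open>{x \<le> a, b < y}\<close> and their mirror images,
  by Tonelli applied to the previous identity.\<close>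

lemma quadratic_cost_eq:
  fixes M :: "(real \<times> real) measure"
  assumes "prob_space M" and sets: "sets M = sets borel"
  shows "(\<integral>\<^sup>+(x, y). ennreal ((dist x y)\<^sup>2) \<partial>M) =
    (\<integral>\<^sup>+s. \<integral>\<^sup>+t. emeasure M {p. fst p \<le> min s t \<and> max s t < snd p} +
       emeasure M {p. snd p \<le> min s t \<and> max s t < fst p} \<partial>lborel \<partial>lborel)"
proof -
  interpret M: prob_space M by fact
  interpret P: pair_sigma_finite M "lborel :: real measure" ..
  have [measurable_cong]: "sets M = sets (borel \<Otimes>\<^sub>M borel)"
    unfolding borel_prod by (rule sets)
  let ?h = "\<lambda>p s t. indicator {fst p..<snd p} s * indicator {fst p..<snd p} t +
     indicator {snd p..<fst p} s * indicator {snd p..<fst p} t :: ennreal"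
  have h: "?h p s t = indicator {p. fst p \<le> min s t \<and> max s t < snd p} p +
       indicator {p. snd p \<le> min s t \<and> max s t < fst p} p" for p and s t :: real
    by (auto simp: indicator_def)
  have 1: "(\<lambda>(q, t). ?h (fst q) (snd q) t) \<in> borel_measurable ((M \<Otimes>\<^sub>M lborel) \<Otimes>\<^sub>M lborel)"
    unfolding h by measurable
  have "(\<integral>\<^sup>+(x, y). ennreal ((dist x y)\<^sup>2) \<partial>M) = (\<integral>\<^sup>+p. \<integral>\<^sup>+s. \<integral>\<^sup>+t. ?h p s t \<partial>lborel \<partial>lborel \<partial>M)"
    by (simp add: sq_diff_eq_nn_integral[symmetric] case_prod_unfold dist_real_def)
  also have "\<dots> = (\<integral>\<^sup>+s. \<integral>\<^sup>+p. \<integral>\<^sup>+t. ?h p s t \<partial>lborel \<partial>M \<partial>lborel)"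
    by (rule P.Fubini'[symmetric]) (use lborel.borel_measurable_nn_integral[OF 1] in \<open>simp add: case_prod_unfold\<close>)
  also have "\<dots> = (\<integral>\<^sup>+s. \<integral>\<^sup>+t. \<integral>\<^sup>+p. ?h p s t \<partial>M \<partial>lborel \<partial>lborel)"
  proof (intro nn_integral_cong, rule P.Fubini'[symmetric])
    fix s
    show "(\<lambda>(p, t). ?h p s t) \<in> borel_measurable (M \<Otimes>\<^sub>M lborel)" unfolding h by measurable
  qed
  also have "\<dots> = (\<integral>\<^sup>+s. \<integral>\<^sup>+t. emeasure M {p. fst p \<le> min s t \<and> max s t < snd p} +
       emeasure M {p. snd p \<le> min s t \<and> max s t < fst p} \<partial>lborel \<partial>lborel)"
  proof (intro nn_integral_cong)
    fix s t :: real
    have "{p \<in> space M. fst p \<le> min s t \<and> max s t < snd p} \<in> sets M"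
      "{p \<in> space M. snd p \<le> min s t \<and> max s t < fst p} \<in> sets M"
      by measurable
    then have "{p. fst p \<le> min s t \<and> max s t < snd p} \<in> sets M" "{p. snd p \<le> min s t \<and> max s t < fst p} \<in> sets M"
      using sets_eq_imp_space_eq[OF sets] by simp_all
    then show "(\<integral>\<^sup>+p. ?h p s t \<partial>M) = emeasure M {p. fst p \<le> min s t \<and> max s t < snd p} +
       emeasure M {p. snd p \<le> min s t \<and> max s t < fst p}"
      unfolding h by (subst nn_integral_add) auto
  qed
  finally show ?thesis .
qed

lemma coupling_marginals:
  assumes "\<gamma> \<in> couplings (law f) (law g)"
    and [measurable]: "f \<in> borel_measurable U" "g \<in> borel_measurable U"
  shows "measure \<gamma> {p. fst p \<le> a} = measure U {u \<in> space U. f u \<le> a}"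
    and "measure \<gamma> {p. snd p \<le> a} = measure U {u \<in> space U. g u \<le> a}"
proof -
  have [measurable_cong]: "sets \<gamma> = sets (borel \<Otimes>\<^sub>M borel)"
    using assms unfolding borel_prod by (simp add: couplings_def)
  have sp: "space \<gamma> = UNIV" using assms sets_eq_imp_space_eq[of \<gamma> borel] by (auto simp: couplings_def)
  have "measure \<gamma> {p. fst p \<le> a} = measure (distr \<gamma> borel fst) {..a}"
    by (subst measure_distr) (auto simp: sp vimage_def)
  also have "\<dots> = measure (law f) {..a}" using assms by (simp add: couplings_def)
  also have "\<dots> = measure U {u \<in> space U. f u \<le> a}"
    unfolding law_def by (subst measure_distr) (auto simp: vimage_def intro!: arg_cong[of _ _ "measure U"])
  finally show "measure \<gamma> {p. fst p \<le> a} = measure U {u \<in> space U. f u \<le> a}" .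
  have "measure \<gamma> {p. snd p \<le> a} = measure (distr \<gamma> borel snd) {..a}"
    by (subst measure_distr) (auto simp: sp vimage_def)
  also have "\<dots> = measure (law g) {..a}" using assms by (simp add: couplings_def)
  also have "\<dots> = measure U {u \<in> space U. g u \<le> a}"
    unfolding law_def by (subst measure_distr) (auto simp: vimage_def intro!: arg_cong[of _ _ "measure U"])
  finally show "measure \<gamma> {p. snd p \<le> a} = measure U {u \<in> space U. g u \<le> a}" .
qed

text \<open>The mass of a quadrant \<open>{x \<le> a, b < y}\<close> is at least the difference of the marginal masses of \<open>{x \<le> a}\<close> and
  \<open>{y \<le> b}\<close>. For two nondecreasing functions the sublevel sets are nested initial segments of the unit interval, so this lower
  bound (or 0) is attained: the monotone coupling minimises every quadrant at once.\<close>

lemma comonotone_quadrant_le: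
  assumes \<gamma>: "\<gamma> \<in> couplings (law f) (law g)" and mono: "mono_on {0<..<1} f" "mono_on {0<..<1} g"
  shows "emeasure U {u \<in> space U. f u \<le> a \<and> b < g u} \<le> emeasure \<gamma> {p. fst p \<le> a \<and> b < snd p}"
    and "emeasure U {u \<in> space U. g u \<le> a \<and> b < f u} \<le> emeasure \<gamma> {p. snd p \<le> a \<and> b < fst p}"
proof -
  have m[measurable]: "f \<in> borel_measurable U" "g \<in> borel_measurable U"
    using mono by (auto intro: mono_measurable_U)
  interpret G: prob_space \<gamma> using \<gamma> by (simp add: couplings_def)
  have [measurable_cong]: "sets \<gamma> = sets (borel \<Otimes>\<^sub>M borel)"
    using \<gamma> unfolding borel_prod by (simp add: couplings_def)
  have sp: "space \<gamma> = UNIV" using \<gamma> sets_eq_imp_space_eq[of \<gamma> borel] by (auto simp: couplings_def)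
  have nested: "measure U (A - B) \<le> measure \<gamma> (A' - B')"
    if "A \<subseteq> B \<or> B \<subseteq> A" "A \<in> sets U" "B \<in> sets U" "A' \<in> sets \<gamma>" "B' \<in> sets \<gamma>"
      "measure \<gamma> A' = measure U A" "measure \<gamma> B' = measure U B" for A B A' B'
    using that(1)
  proof
    assume "A \<subseteq> B" then have *: "A - B = {}" by auto
    show ?thesis unfolding * by simp
  next
    assume "B \<subseteq> A"
    then have "measure U (A - B) = measure \<gamma> A' - measure \<gamma> B'"
      using that by (simp add: U.finite_measure_Diff)
    also have "\<dots> \<le> measure \<gamma> A' - measure \<gamma> (A' \<inter> B')"
      using that G.finite_measure_mono[of "A' \<inter> B'" B'] by simp
    also have "\<dots> = measure \<gamma> (A' - B')" using that by (simp add: G.finite_measure_Diff')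
    finally show ?thesis .
  qed
  have down: "A \<subseteq> B \<or> B \<subseteq> A" if "A = {u \<in> space U. h u \<le> a}" "B = {u \<in> space U. k u \<le> b}"
    "mono_on {0<..<1} h" "mono_on {0<..<1} k" for A B and h k :: "real \<Rightarrow> real"
  proof (rule ccontr)
    assume "\<not> ?thesis"
    then obtain x y where "x \<in> A" "x \<notin> B" "y \<in> B" "y \<notin> A" by blast
    then show False using that mono_onD[of "{0<..<1}" h y x] mono_onD[of "{0<..<1}" k x y]
      by (cases "x \<le> y") (auto simp: not_le)
  qed
  have meas: "{u \<in> space U. f u \<le> c} \<in> sets U" "{u \<in> space U. g u \<le> c} \<in> sets U" for c
    by measurable
  have "{p \<in> space \<gamma>. fst p \<le> c} \<in> sets \<gamma>" "{p \<in> space \<gamma>. snd p \<le> c} \<in> sets \<gamma>" for c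
    by measurable
  then have meas': "{p. fst p \<le> c} \<in> sets \<gamma>" "{p. snd p \<le> c} \<in> sets \<gamma>" for c
    unfolding sp by auto
  have "measure U {u \<in> space U. f u \<le> a \<and> b < g u} =
      measure U ({u \<in> space U. f u \<le> a} - {u \<in> space U. g u \<le> b})"
    by (rule arg_cong[of _ _ "measure U"]) auto
  also have "\<dots> \<le> measure \<gamma> ({p. fst p \<le> a} - {p. snd p \<le> b})"
    by (intro nested down[OF refl refl mono] coupling_marginals[OF \<gamma> m] meas meas')
  also have "\<dots> = measure \<gamma> {p. fst p \<le> a \<and> b < snd p}"
    by (rule arg_cong[of _ _ "measure \<gamma>"]) auto
  finally show "emeasure U {u \<in> space U. f u \<le> a \<and> b < g u} \<le> emeasure \<gamma> {p. fst p \<le> a \<and> b < snd p}"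
    by (simp add: U.emeasure_eq_measure G.emeasure_eq_measure)
  have "measure U {u \<in> space U. g u \<le> a \<and> b < f u} =
      measure U ({u \<in> space U. g u \<le> a} - {u \<in> space U. f u \<le> b})"
    by (rule arg_cong[of _ _ "measure U"]) auto
  also have "\<dots> \<le> measure \<gamma> ({p. snd p \<le> a} - {p. fst p \<le> b})"
    by (intro nested down[OF refl refl mono(2,1)] coupling_marginals[OF \<gamma> m] meas meas')
  also have "\<dots> = measure \<gamma> {p. snd p \<le> a \<and> b < fst p}"
    by (rule arg_cong[of _ _ "measure \<gamma>"]) auto
  finally show "emeasure U {u \<in> space U. g u \<le> a \<and> b < f u} \<le> emeasure \<gamma> {p. snd p \<le> a \<and> b < fst p}"
    by (simp add: U.emeasure_eq_measure G.emeasure_eq_measure)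
qed

text \<open>The Wasserstein space of the line is isometric to the cone of nondecreasing functions in \<open>L\<^sup>2(0,1)\<close>.\<close>

lemma dW2_law:
  assumes "f \<in> mono_L2" "g \<in> mono_L2"
  shows "dW2 (law f) (law g) = sqrt (\<integral>x. (f x - g x)\<^sup>2 \<partial>U)"
proof -
  have m: "mono_on {0<..<1} f" "mono_on {0<..<1} g" using assms by (auto simp: mono_L2_def)
  then have [measurable]: "f \<in> borel_measurable U" "g \<in> borel_measurable U"
    by (auto intro: mono_measurable_U)
  \<comment> \<open>the monotone coupling\<close>
  define \<gamma>\<^sub>0 where "\<gamma>\<^sub>0 = distr U borel (\<lambda>u. (f u, g u))"
  let ?c = "\<lambda>\<gamma>. \<integral>\<^sup>+(x, y). ennreal ((dist x y)\<^sup>2) \<partial>\<gamma>"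
  have pm[measurable]: "(\<lambda>u. (f u, g u)) \<in> U \<rightarrow>\<^sub>M borel"
    unfolding borel_prod[symmetric] by measurable
  have fm[measurable]: "fst \<in> (borel :: (real \<times> real) measure) \<rightarrow>\<^sub>M (borel :: real measure)"
    "snd \<in> (borel :: (real \<times> real) measure) \<rightarrow>\<^sub>M (borel :: real measure)"
    unfolding borel_prod[symmetric] by measurable
  have \<gamma>\<^sub>0: "\<gamma>\<^sub>0 \<in> couplings (law f) (law g)"
    by (auto simp: couplings_def \<gamma>\<^sub>0_def law_def distr_distr comp_def intro!: U.prob_space_distr)
  have "?c \<gamma>\<^sub>0 \<le> ?c \<gamma>" if \<gamma>: "\<gamma> \<in> couplings (law f) (law g)" for \<gamma>
  proof -
    have em: "emeasure \<gamma>\<^sub>0 {p. P p} = emeasure U {u \<in> space U. P (f u, g u)}"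
      if "{p. P p} \<in> sets borel" for P
      unfolding \<gamma>\<^sub>0_def using that
      by (subst emeasure_distr) (auto simp: vimage_def intro!: arg_cong[of _ _ "emeasure U"])
    have "emeasure \<gamma>\<^sub>0 {p. fst p \<le> a \<and> b < snd p} \<le> emeasure \<gamma> {p. fst p \<le> a \<and> b < snd p}"
         "emeasure \<gamma>\<^sub>0 {p. snd p \<le> a \<and> b < fst p} \<le> emeasure \<gamma> {p. snd p \<le> a \<and> b < fst p}" for a b
      using comonotone_quadrant_le[OF \<gamma> m, of a b] by (subst em; simp)+
    then show ?thesis
      using \<gamma> \<gamma>\<^sub>0 by (subst (1 2) quadratic_cost_eq) (auto simp: couplings_def simp del: min.bounded_iff max_less_iff_conj min_less_iff_conj intro!: nn_integral_mono add_mono)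
  qed
  with \<gamma>\<^sub>0 have "(INF \<gamma>\<in>couplings (law f) (law g). ?c \<gamma>) = ?c \<gamma>\<^sub>0"
    by (intro antisym INF_lower INF_greatest)
  also have "\<dots> = (\<integral>\<^sup>+u. ennreal ((f u - g u)\<^sup>2) \<partial>U)"
    unfolding \<gamma>\<^sub>0_def by (subst nn_integral_distr) (auto simp: dist_real_def case_prod_unfold)
  also have "\<dots> = ennreal (\<integral>u. (f u - g u)\<^sup>2 \<partial>U)"
    using L2_diff[of f g] assms by (intro nn_integral_eq_integral) (auto simp: mono_L2_def L2_def)
  finally show ?thesis by (simp add: dW2_def)
qed

section \<open>The inner product on quantile functions\<close>

definition ip :: "(real \<Rightarrow> real) \<Rightarrow> (real \<Rightarrow> real) \<Rightarrow> real" where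
  "ip f g = (\<integral>x. f x * g x \<partial>U)"

lemma integrable_mult_L2:
  assumes "f \<in> L2" "g \<in> L2" shows "integrable U (\<lambda>x. f x * g x)"
proof -
  have [measurable]: "f \<in> borel_measurable U" "g \<in> borel_measurable U"
    using assms by (auto simp: L2_def)
  have int: "integrable U (\<lambda>x. (f x)\<^sup>2 + (g x)\<^sup>2)" using assms by (auto simp: L2_def)
  have le: "norm (f x * g x) \<le> norm ((f x)\<^sup>2 + (g x)\<^sup>2)" for x
  proof -
    have "2 * (\<bar>f x\<bar> * \<bar>g x\<bar>) \<le> (f x)\<^sup>2 + (g x)\<^sup>2"
      using sum_squares_bound[of "\<bar>f x\<bar>" "\<bar>g x\<bar>"] by simp
    moreover have "0 \<le> \<bar>f x\<bar> * \<bar>g x\<bar>" by simp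
    ultimately have "\<bar>f x\<bar> * \<bar>g x\<bar> \<le> (f x)\<^sup>2 + (g x)\<^sup>2" by linarith
    then show ?thesis by (simp add: abs_mult)
  qed
  from int show ?thesis
    by (rule Bochner_Integration.integrable_bound) (use le in \<open>auto intro!: AE_I2\<close>)
qed

lemma integrable_L2: "f \<in> L2 \<Longrightarrow> integrable U f"
  using integrable_mult_L2[OF _ L2_const[of 1], of f] by simp

lemma ip_commute: "ip f g = ip g f"
  by (simp add: ip_def mult.commute)

lemma ip_add_left: "f \<in> L2 \<Longrightarrow> g \<in> L2 \<Longrightarrow> h \<in> L2 \<Longrightarrow> ip (\<lambda>x. f x + g x) h = ip f h + ip g h"
  by (simp add: ip_def algebra_simps integrable_mult_L2)

lemma ip_diff_left: "f \<in> L2 \<Longrightarrow> g \<in> L2 \<Longrightarrow> h \<in> L2 \<Longrightarrow> ip (\<lambda>x. f x - g x) h = ip f h - ip g h"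
  by (simp add: ip_def algebra_simps integrable_mult_L2)

lemma ip_scale_left: "ip (\<lambda>x. c * f x) h = c * ip f h"
  by (simp add: ip_def mult.assoc)

lemma ip_add_right: "f \<in> L2 \<Longrightarrow> g \<in> L2 \<Longrightarrow> h \<in> L2 \<Longrightarrow> ip h (\<lambda>x. f x + g x) = ip h f + ip h g"
  by (simp add: ip_add_left ip_commute[of h])

lemma ip_diff_right: "f \<in> L2 \<Longrightarrow> g \<in> L2 \<Longrightarrow> h \<in> L2 \<Longrightarrow> ip h (\<lambda>x. f x - g x) = ip h f - ip h g"
  by (simp add: ip_diff_left ip_commute[of h])

lemma ip_scale_right: "ip h (\<lambda>x. c * f x) = c * ip h f"
  by (simp add: ip_scale_left ip_commute[of h])

lemma ip_const: "ip (\<lambda>x. a) (\<lambda>x. b) = a * b"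
  using U.prob_space by (simp add: ip_def)

lemmas ip_linear = ip_add_left ip_diff_left ip_scale_left ip_add_right ip_diff_right ip_scale_right
  ip_const L2_add L2_diff L2_scale L2_const mono_L2_L2

lemma ip_cong_AE:
  assumes "f \<in> L2" "g \<in> L2" "h \<in> L2" "AE x in U. f x = g x"
  shows "ip f h = ip g h" "ip h f = ip h g"
proof -
  show "ip f h = ip g h" unfolding ip_def using assms
    by (intro integral_cong_AE) (auto simp: L2_def)
  then show "ip h f = ip h g" by (simp add: ip_commute)
qed

lemma ip_self_eq_0_iff: "f \<in> L2 \<Longrightarrow> ip f f = 0 \<longleftrightarrow> (AE x in U. f x = 0)"
  unfolding ip_def by (subst integral_nonneg_eq_0_iff_AE) (auto simp: integrable_mult_L2)

lemma dW2_law_ip: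
  assumes "f \<in> mono_L2" "g \<in> mono_L2"
  shows "(dW2 (law f) (law g))\<^sup>2 = ip f f + ip g g - 2 * ip f g"
proof -
  have "(dW2 (law f) (law g))\<^sup>2 = ip (\<lambda>x. f x - g x) (\<lambda>x. f x - g x)"
    by (simp add: dW2_law[OF assms] ip_def power2_eq_square)
  also have "\<dots> = ip f f + ip g g - 2 * ip f g"
    using assms by (simp add: ip_linear ip_commute[of g f])
  finally show ?thesis .
qed

lemma dW2_nonneg: "0 \<le> dW2 \<mu> \<nu>"
  by (simp add: dW2_def)

lemma law_cong_AE:
  assumes "f \<in> borel_measurable U" "g \<in> borel_measurable U" "AE x in U. f x = g x"
  shows "law f = law g"
  unfolding law_def using assms by (intro distr_cong_AE) auto

text \<open>Equal laws force equal functions because their distance is both the \<open>L\<^sup>2\<close> distance and 0.\<close>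

lemma law_eq_iff:
  assumes "f \<in> mono_L2" "g \<in> mono_L2"
  shows "law f = law g \<longleftrightarrow> (AE x in U. f x = g x)"
proof
  assume "law f = law g"
  then have "dW2 (law f) (law g) = dW2 (law f) (law f)" by simp
  then have "ip f f + ip g g - 2 * ip f g = 0"
    using dW2_law_ip[OF assms] dW2_law_ip[OF assms(1,1)] by simp
  then have "ip (\<lambda>x. f x - g x) (\<lambda>x. f x - g x) = 0"
    using assms by (simp add: ip_linear ip_commute[of g f])
  then show "AE x in U. f x = g x"
    using assms ip_self_eq_0_iff[of "\<lambda>x. f x - g x"] by (simp add: ip_linear)
qed (use assms in \<open>auto intro!: law_cong_AE simp: mono_L2_def L2_def\<close>)

lemma return_eq_law: "return borel c = law (\<lambda>_. c)"
  by (simp add: law_def U.distr_const)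

section \<open>Primitives\<close>

definition primitive :: "(real \<Rightarrow> real) \<Rightarrow> real \<Rightarrow> real" where
  "primitive f p = integral {0..p} f"

lemma integrable_U_iff: "integrable U f \<longleftrightarrow> set_integrable lborel {0<..<1} (f :: real \<Rightarrow> real)"
  unfolding U_def set_integrable_def by (subst integrable_restrict_space) auto

lemma integrable_U_imp_abs_integrable:
  fixes f :: "real \<Rightarrow> real"
  assumes "integrable U f" shows "f absolutely_integrable_on {0..1}"
proof -
  have "f absolutely_integrable_on {0<..<1}"
    using assms unfolding integrable_U_iff set_integrable_def
    using borel_measurable_integrable integrable_completion by blast
  then show ?thesis by (simp add: absolutely_integrable_on_Icc_iff_Ioo)
qed

lemma integral_U:
  fixes f :: "real \<Rightarrow> real"
  assumes "integrable U f" shows "integral\<^sup>L U f = integral {0..1} f"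
proof -
  have "integral\<^sup>L U f = (LINT x:{0<..<1}|lborel. f x)"
    unfolding U_def set_lebesgue_integral_def by (rule integral_restrict_space) simp
  also have "\<dots> = integral {0<..<1} f"
    using assms by (intro set_borel_integral_eq_integral) (simp add: integrable_U_iff)
  also have "\<dots> = integral {0..1} f" by (simp add: integral_open_interval_real)
  finally show ?thesis .
qed

lemma primitive_0 [simp]: "primitive f 0 = 0" by (simp add: primitive_def)

lemma primitive_1: "f \<in> L2 \<Longrightarrow> primitive f 1 = ip f (\<lambda>_. 1)"
  by (simp add: primitive_def ip_def integral_U integrable_L2)

lemma integrable_on_01: "integrable U f \<Longrightarrow> 0 \<le> a \<Longrightarrow> b \<le> 1 \<Longrightarrow> f integrable_on {a..b}"
  for f :: "real \<Rightarrow> real"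
  using integrable_U_imp_abs_integrable[of f] integrable_on_subinterval[of f "{0..1}" a b]
  by (simp add: absolutely_integrable_on_def)

lemma continuous_on_primitive: "integrable U f \<Longrightarrow> continuous_on {0..1} (primitive f)"
  unfolding primitive_def by (intro indefinite_integral_continuous_1 integrable_on_01) auto

lemma primitive_has_derivative:
  assumes "integrable U f" "p \<in> {0<..<1}" "isCont f p"
  shows "(primitive f has_real_derivative f p) (at p)"
proof -
  have "(primitive f has_vector_derivative f p) (at p within {0..1} - {})"
    unfolding primitive_def using assms
    by (intro integral_has_vector_derivative_continuous_at integrable_on_01)
       (auto intro: continuous_at_imp_continuous_at_within)
  then show ?thesis
    using assms by (simp add: has_real_derivative_iff_has_vector_derivative at_within_Icc_at)
qed

lemma primitive_diff:
  "integrable U f \<Longrightarrow> integrable U g \<Longrightarrow> p \<in> {0..1} \<Longrightarrow> primitive (\<lambda>x. f x - g x) p = primitive f p - primitive g p"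
  unfolding primitive_def by (intro Henstock_Kurzweil_Integration.integral_diff integrable_on_01) auto

lemma primitive_const: "0 \<le> p \<Longrightarrow> primitive (\<lambda>_. c) p = c * p"
  by (simp add: primitive_def)

lemma borel_measurable_U [measurable (raw)]: "f \<in> borel_measurable borel \<Longrightarrow> f \<in> borel_measurable U"
  unfolding U_def by (intro measurable_restrict_space1) simp

lemma integrable_mult_indicator_U:
  fixes f :: "real \<Rightarrow> real"
  assumes f: "integrable U f" and A: "A \<in> sets borel"
  shows "integrable U (\<lambda>x. f x * indicator A x)"
proof (rule Bochner_Integration.integrable_bound[OF f])
  have "f \<in> borel_measurable U" using f by simp
  moreover have "(\<lambda>x. indicator A x :: real) \<in> borel_measurable U" using A by simp
  ultimately show "(\<lambda>x. f x * indicator A x) \<in> borel_measurable U" by (rule borel_measurable_times)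
qed (auto simp: indicator_def)

lemma indicator_L2:
  assumes "f \<in> L2" "A \<in> sets borel" shows "(\<lambda>x. f x * indicator A x) \<in> L2"
proof -
  have "integrable U (\<lambda>x. (f x)\<^sup>2 * indicator A x)"
    using assms by (intro integrable_mult_indicator_U) (auto simp: L2_def)
  also have "(\<lambda>x. (f x)\<^sup>2 * indicator A x) = (\<lambda>x. (f x * indicator A x)\<^sup>2)"
    by (auto simp: indicator_def)
  finally show ?thesis
    using integrable_mult_indicator_U[OF integrable_L2[OF assms(1)] assms(2)]
    by (simp add: L2_def borel_measurable_integrable)
qed

lemma primitive_eq_integral_indicator:
  assumes f: "integrable U f" and p: "p \<in> {0..1}"
  shows "primitive f p = (\<integral>x. f x * indicator {..p} x \<partial>U)"
proof -
  have "(\<integral>x. f x * indicator {..p} x \<partial>U) = integral {0..1} (\<lambda>x. f x * indicator {..p} x)"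
    using f by (intro integral_U integrable_mult_indicator_U) simp_all
  also have "\<dots> = integral {0..1} (\<lambda>x. if x \<in> {0..p} then f x else 0)"
    by (intro integral_cong) auto
  also have "\<dots> = integral ({0..p} \<inter> {0..1}) f"
    using integral_restrict_Int[of "{0..1}" "{0..p}" f] by (simp add: inf_commute)
  also have "{0..p} \<inter> {0..1} = {0..p}" using p by auto
  finally show ?thesis by (simp add: primitive_def)
qed

lemma primitive_eq_ip_indicator: "f \<in> L2 \<Longrightarrow> p \<in> {0..1} \<Longrightarrow> ip f (indicator {..p}) = primitive f p"
  by (simp add: ip_def primitive_eq_integral_indicator integrable_L2)

lemma countable_AE_U: "countable A \<Longrightarrow> AE x in U. x \<notin> A"
  using AE_not_in[OF countable_imp_null_set_lborel, of A]
  unfolding U_def by (subst AE_restrict_space_iff) (auto elim: eventually_mono)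

lemma mono_countable_discont: "mono_on {0<..<1} f \<Longrightarrow> countable {a\<in>{0<..<1::real}. \<not> isCont f a}" 
  for f :: "real \<Rightarrow> real"
  by (intro mono_on_ctble_discont_open) auto

text \<open>Nondecreasing functions are continuous off a countable set, and there they are the derivatives of their primitives.\<close>

lemma AE_eq_if_primitive_eq:
  assumes "f \<in> mono_L2" "g \<in> mono_L2" "\<And>p. p \<in> {0<..<1} \<Longrightarrow> primitive f p = primitive g p"
  shows "AE x in U. f x = g x"
proof -
  have "countable ({a\<in>{0<..<1}. \<not> isCont f a} \<union> {a\<in>{0<..<1}. \<not> isCont g a})" (is "countable ?A")
    using assms mono_countable_discont[of f] mono_countable_discont[of g] by (simp add: mono_L2_def)
  then have "AE x in U. x \<notin> ?A" by (rule countable_AE_U)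
  then show ?thesis
  proof (rule AE_mp, intro AE_I2 impI)
    fix x assume x: "x \<in> space U" "x \<notin> ?A"
    have "(primitive f has_real_derivative f x) (at x)" "(primitive g has_real_derivative g x) (at x)"
      using x assms by (auto intro!: primitive_has_derivative integrable_L2 simp: mono_L2_L2)
    moreover have "eventually (\<lambda>p. primitive f p = primitive g p) (nhds x)"
      using x assms(3) eventually_nhds_in_open[of "{0<..<1}" x] by (auto elim!: eventually_mono)
    ultimately show "f x = g x" 
      using DERIV_cong_ev[OF refl _ refl, of "primitive f" "primitive g" x "f x"] DERIV_unique by blast
  qed
qed

section \<open>Standardised two-point distributions\<close>

text \<open>The parameter \<open>s\<close> of a two-point distribution is the log-odds of its left atom. In this coordinate the
  inner product of two standardised two-point distributions depends only on the distance of their parameters.\<close>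

definition logistic :: "real \<Rightarrow> real" where
  "logistic s = 1 / (1 + exp (- s))"

text \<open>The quantile function with mean 0 and variance 1 whose only jump is at \<open>logistic s\<close>.\<close>

definition unit_step :: "real \<Rightarrow> real \<Rightarrow> real" where
  "unit_step s x = (if x \<le> logistic s then - exp (- s / 2) else exp (s / 2))"

lemma logistic_01: "0 < logistic s" "logistic s < 1"
proof -
  have "0 < 1 + exp (- s)" by (simp add: add_pos_pos)
  then show "0 < logistic s" "logistic s < 1" by (simp_all add: logistic_def)
qed

lemma logistic_surj: assumes "0 < p" "p < 1" obtains s where "logistic s = p"
proof
  show "logistic (ln (p / (1 - p))) = p"
    using assms by (simp add: logistic_def exp_minus) (simp add: field_simps)
qed

lemma logistic_le_iff: "logistic s \<le> logistic t \<longleftrightarrow> s \<le> t"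
proof -
  have "0 < 1 + exp (- s)" "0 < 1 + exp (- t)" by (simp_all add: add_pos_pos)
  then have "logistic s \<le> logistic t \<longleftrightarrow> 1 + exp (- t) \<le> 1 + exp (- s)"
    unfolding logistic_def divide_inverse by simp
  then show ?thesis by simp
qed

lemma unit_step_eq: "unit_step s = (\<lambda>x. exp (s / 2) - (exp (s / 2) + exp (- s / 2)) * indicator {..logistic s} x)"
  by (auto simp: unit_step_def fun_eq_iff)

lemma logistic_mult: "logistic s * (exp (s / 2) + exp (- s / 2)) = exp (s / 2)"
proof -
  have "exp (s / 2) + exp (- s / 2) = exp (s / 2) * (1 + exp (- s))"
    by (simp add: distrib_left exp_add[symmetric])
  moreover have "1 + exp (- s) \<noteq> 0" using exp_gt_zero[of "- s"] by linarith
  ultimately show ?thesis by (simp add: logistic_def)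
qed

lemma unit_step_mono_L2: "unit_step s \<in> mono_L2"
proof -
  have "mono_on {0<..<1} (unit_step s)" 
    by (auto simp: mono_on_def unit_step_def intro: order_trans[of _ 0])
  moreover have "unit_step s \<in> L2" unfolding unit_step_eq
    using indicator_L2[OF L2_const, of "{..logistic s}" 1] by (simp add: ip_linear)
  ultimately show ?thesis by (simp add: mono_L2_def)
qed

lemma ip_unit_step:
  assumes "f \<in> L2"
  shows "ip f (unit_step s) = exp (s / 2) * ip f (\<lambda>_. 1) - (exp (s / 2) + exp (- s / 2)) * primitive f (logistic s)"
proof -
  have "indicator {..logistic s} \<in> L2"
    using indicator_L2[OF L2_const, of "{..logistic s}" 1] by simp
  then have "ip f (unit_step s) = ip f (\<lambda>x. exp (s/2) * 1) - ip f (\<lambda>x. (exp (s / 2) + exp (- s / 2)) * indicator {..logistic s} x)"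
    unfolding unit_step_eq using assms by (subst ip_diff_right) (auto simp: ip_linear)
  also have "\<dots> = exp (s / 2) * ip f (\<lambda>_. 1) - (exp (s / 2) + exp (- s / 2)) * primitive f (logistic s)"
    using assms primitive_eq_ip_indicator[of f "logistic s"] logistic_01[of s] by (simp only: ip_scale_right) simp
  finally show ?thesis .
qed

text \<open>Pairing with a step computes the primitive at the jump, up to the mean; so the steps and the constants
  separate nondecreasing functions.\<close>

lemma AE_eq_if_ip_unit_step_eq:
  assumes "f \<in> mono_L2" "g \<in> mono_L2" "ip f (\<lambda>_. 1) = ip g (\<lambda>_. 1)"
    and "\<And>s. ip f (unit_step s) = ip g (unit_step s)"
  shows "AE x in U. f x = g x"
proof (rule AE_eq_if_primitive_eq[OF assms(1,2)])
  fix p :: real assume "p \<in> {0<..<1}"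
  then obtain s where "logistic s = p" by (auto elim: logistic_surj)
  then show "primitive f p = primitive g p"
    using assms(4)[of s] assms(1-3) add_pos_pos[OF exp_gt_zero[of "s/2"] exp_gt_zero[of "- s/2"]]
    by (auto simp: ip_unit_step mono_L2_L2)
qed

lemma primitive_unit_step:
  assumes "0 \<le> p" "p \<le> 1"
  shows "primitive (unit_step s) p = (if p \<le> logistic s then - exp (- s / 2) * p else exp (s / 2) * (p - 1))"
proof -
  have "primitive (unit_step s) p = ip (indicator {..p}) (unit_step s)"
    using primitive_eq_ip_indicator[of "unit_step s" p] unit_step_mono_L2 assms by (simp add: mono_L2_L2 ip_commute)
  also have "\<dots> = exp (s / 2) * ip (indicator {..p}) (\<lambda>_. 1) - (exp (s / 2) + exp (- s / 2)) * primitive (indicator {..p}) (logistic s)"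
    using indicator_L2[OF L2_const, of "{..p}" 1] by (intro ip_unit_step) simp
  also have "ip (indicator {..p}) (\<lambda>_. 1) = primitive (\<lambda>_. 1) p"
    using primitive_eq_ip_indicator[of "\<lambda>_. 1" p] assms by (simp add: ip_commute L2_const)
  also have "primitive (\<lambda>_. 1) p = p" using assms by (simp add: primitive_def)
  also have "primitive (indicator {..p}) (logistic s) = min p (logistic s)"
  proof -
    have "primitive (indicator {..p}) (logistic s) = integral {0..logistic s} (\<lambda>x. if x \<in> {0..p} then 1 else (0::real))"
      unfolding primitive_def by (intro integral_cong) auto
    also have "\<dots> = integral ({0..logistic s} \<inter> {0..p}) (\<lambda>_. 1)"
      using integral_restrict_Int[of "{0..logistic s}" "{0..p}" "\<lambda>_. 1::real"]
      by (simp only: inf_commute)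
    also have "{0..logistic s} \<inter> {0..p} = {0..min p (logistic s)}" by auto
    finally show ?thesis using assms logistic_01[of s] by (simp add: min.commute[of "logistic s"])
  qed
  finally show ?thesis using logistic_mult[of s] by (auto simp: min_def algebra_simps)
qed

lemma mean_unit_step: "ip (unit_step s) (\<lambda>_. 1) = 0"
  using primitive_1[of "unit_step s"] primitive_unit_step[of 1 s] logistic_01[of s] unit_step_mono_L2 by (simp add: mono_L2_L2)

text \<open>Strictly decreasing in the distance of the parameters: a map that preserves inner products and permutes
  the steps acts on their parameters by an isometry of the line.\<close>

lemma ip_unit_step_unit_step: "ip (unit_step r) (unit_step s) = exp (- \<bar>r - s\<bar> / 2)"
proof -
  have *: "ip (unit_step r) (unit_step s) = exp (- \<bar>r - s\<bar> / 2)" if "s \<le> r" for r s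
  proof -
    have "ip (unit_step r) (unit_step s) = exp (- r / 2) * (logistic s * (exp (s / 2) + exp (- s / 2)))"
      using that by (simp add: ip_unit_step mono_L2_L2 unit_step_mono_L2 mean_unit_step primitive_unit_step logistic_le_iff less_imp_le logistic_01 algebra_simps)
    also have "\<dots> = exp (- \<bar>r - s\<bar> / 2)"
      unfolding logistic_mult using that by (simp add: exp_add[symmetric] field_simps)
    finally show ?thesis .
  qed
  show ?thesis using *[of s r] *[of r s] by (cases "s \<le> r") (auto simp: ip_commute[of "unit_step r"] abs_minus_commute)
qed

section \<open>A metric characterisation of Dirac masses\<close>

definition W2_isometric :: "(real measure \<Rightarrow> real measure) \<Rightarrow> bool" where
  "W2_isometric \<Phi> \<longleftrightarrow> \<Phi> \<in> W2 \<rightarrow> W2 \<and> (\<forall>\<mu>\<in>W2. \<forall>\<nu>\<in>W2. dW2 (\<Phi> \<mu>) (\<Phi> \<nu>) = dW2 \<mu> \<nu>)"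

lemma law_mono_W2: "f \<in> mono_L2 \<Longrightarrow> law f \<in> W2"
  by (simp add: law_in_W2 mono_L2_L2)

lemma return_W2: "return borel (c :: real) \<in> W2"
  by (simp add: return_eq_law law_mono_W2 mono_L2_const)

lemma dW2_eq_0_iff:
  assumes "\<mu> \<in> W2" "\<nu> \<in> W2" shows "dW2 \<mu> \<nu> = 0 \<longleftrightarrow> \<mu> = (\<nu> :: real measure)"
proof -
  obtain f g where f: "f \<in> mono_L2" "law f = \<mu>" and g: "g \<in> mono_L2" "law g = \<nu>"
    using assms by (metis W2_eq_law)
  have "dW2 \<mu> \<nu> = 0 \<longleftrightarrow> ip (\<lambda>x. f x - g x) (\<lambda>x. f x - g x) = 0"
    using dW2_law[OF f(1) g(1)] by (simp add: f g ip_def power2_eq_square)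
  also have "\<dots> \<longleftrightarrow> (AE x in U. f x = g x)"
    using ip_self_eq_0_iff[of "\<lambda>x. f x - g x"] f g by (simp add: ip_linear)
  also have "\<dots> \<longleftrightarrow> \<mu> = \<nu>" using law_eq_iff[OF f(1) g(1)] f g by simp
  finally show ?thesis .
qed

lemma W2_isometric_inj: "W2_isometric \<Phi> \<Longrightarrow> \<mu> \<in> W2 \<Longrightarrow> \<nu> \<in> W2 \<Longrightarrow> \<Phi> \<mu> = \<Phi> \<nu> \<Longrightarrow> \<mu> = \<nu>"
  using dW2_eq_0_iff by (metis (no_types, lifting) PiE W2_isometric_def)

lemma AE_U_ex:
  assumes "AE x in U. P x" "0 \<le> a" "a < b" "b \<le> 1"
  obtains x where "x \<in> {a<..<b}" "P x"
proof -
  have "\<exists>x\<in>{a<..<b}. P x"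
  proof (rule ccontr)
    assume n: "\<not> ?thesis"
    from assms(1) have "AE x in U. x \<notin> {a<..<b}"
      by (rule eventually_mono) (use n in blast)
    then have "AE x in lborel. x \<notin> {a<..<b}"
      unfolding U_def using assms by (subst (asm) AE_restrict_space_iff) (auto elim: eventually_mono)
    then have "{a<..<b} \<in> null_sets lborel" by (subst AE_iff_null_sets) auto
    then show False using assms by (simp add: null_sets_def)
  qed
  then show thesis using that by blast
qed

text \<open>On an interval where a sum of two nondecreasing functions is constant, an increase of one summand would have to
  be a decrease of the other. This is what makes constants and steps extremal in the cone.\<close>

lemma mono_summand_const:
  assumes f: "mono_on {0<..<1} f" and h: "mono_on {0<..<1} (h :: real \<Rightarrow> real)"
    and ab: "0 \<le> a" "a < b" "b \<le> 1"
    and sum: "AE x in U. x \<in> {a<..<b} \<longrightarrow> f x + h x = k"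
  obtains c :: real where "AE x in U. x \<in> {a<..<b} \<longrightarrow> f x = c"
proof -
  obtain y where y: "y \<in> {a<..<b}" "f y + h y = k" using AE_U_ex[OF sum ab] by blast
  have "AE x in U. x \<in> {a<..<b} \<longrightarrow> f x = f y"
    using sum
  proof (rule eventually_mono, intro impI)
    fix x assume x: "x \<in> {a<..<b} \<longrightarrow> f x + h x = k" "x \<in> {a<..<b}"
    then have "x \<in> {0<..<1}" "y \<in> {0<..<1}" "f x + h x = f y + h y" using y ab by auto
    then show "f x = f y"
      using mono_onD[OF f, of x y] mono_onD[OF f, of y x] mono_onD[OF h, of x y] mono_onD[OF h, of y x]
      by (cases "x \<le> y") auto
  qed
  then show thesis by (rule that)
qed

text \<open>Dirac masses are the constants in the cone. From a constant \<open>c\<close> the segment to \<open>g\<close> can always be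
  doubled, ending at \<open>2g - c\<close>, which is still nondecreasing. From a function \<open>f\<close> the segment to the constant 0 could only be
  doubled to \<open>-f\<close>, which is nondecreasing only if \<open>f\<close> is constant.\<close>

lemma dirac_iff_extendible:
  assumes "\<mu> \<in> W2"
  shows "(\<exists>c. \<mu> = return borel c) \<longleftrightarrow>
    (\<forall>\<nu>\<in>W2. \<exists>\<xi>\<in>W2. dW2 \<nu> \<xi> = dW2 \<mu> \<nu> \<and> dW2 \<mu> \<xi> = 2 * dW2 \<mu> (\<nu> :: real measure))" (is "?L \<longleftrightarrow> ?R")
proof
  assume ?L
  then obtain c where \<mu>: "\<mu> = law (\<lambda>_. c)" by (auto simp: return_eq_law)
  show ?R
  proof
    fix \<nu> :: "real measure" assume "\<nu> \<in> W2"
    then obtain g where g: "g \<in> mono_L2" "law g = \<nu>" by (rule W2_eq_law)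
    define h where "h = (\<lambda>x. 2 * g x + (- c))"
    have h: "h \<in> mono_L2" unfolding h_def
      using g by (intro mono_L2_add mono_L2_scale mono_L2_const) auto
    have "dW2 \<nu> (law h) = sqrt (\<integral>x. (g x - h x)\<^sup>2 \<partial>U)" using dW2_law[OF g(1) h] g by simp
    also have "(\<lambda>x. (g x - h x)\<^sup>2) = (\<lambda>x. (c - g x)\<^sup>2)" by (auto simp: h_def power2_eq_square algebra_simps)
    also have "sqrt (\<integral>x. (c - g x)\<^sup>2 \<partial>U) = dW2 \<mu> \<nu>"
      using dW2_law[OF mono_L2_const g(1)] g \<mu> by simp
    finally have 1: "dW2 \<nu> (law h) = dW2 \<mu> \<nu>" .
    have "dW2 \<mu> (law h) = sqrt (\<integral>x. (c - h x)\<^sup>2 \<partial>U)" using dW2_law[OF mono_L2_const h] \<mu> by simp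
    also have "(\<lambda>x. (c - h x)\<^sup>2) = (\<lambda>x. 4 * (c - g x)\<^sup>2)" by (auto simp: h_def power2_eq_square algebra_simps)
    also have "sqrt (\<integral>x. 4 * (c - g x)\<^sup>2 \<partial>U) = 2 * sqrt (\<integral>x. (c - g x)\<^sup>2 \<partial>U)"
      by (simp add: real_sqrt_mult)
    also have "\<dots> = 2 * dW2 \<mu> \<nu>"
      using dW2_law[OF mono_L2_const g(1)] g \<mu> by simp
    finally show "\<exists>\<xi>\<in>W2. dW2 \<nu> \<xi> = dW2 \<mu> \<nu> \<and> dW2 \<mu> \<xi> = 2 * dW2 \<mu> \<nu>"
      using 1 law_mono_W2[OF h] by blast
  qed
next
  assume ?R
  obtain f where f: "f \<in> mono_L2" "law f = \<mu>" using assms by (rule W2_eq_law)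
  from \<open>?R\<close> return_W2[of 0] obtain \<xi> where \<xi>: "\<xi> \<in> W2" "dW2 (law (\<lambda>_. 0)) \<xi> = dW2 \<mu> (law (\<lambda>_. 0))"
    "dW2 \<mu> \<xi> = 2 * dW2 \<mu> (law (\<lambda>_. 0))" unfolding return_eq_law by blast
  obtain h where h: "h \<in> mono_L2" "law h = \<xi>" using \<xi>(1) by (rule W2_eq_law)
  have "ip h h = ip f f"
    using arg_cong[OF \<xi>(2), of "\<lambda>x. x\<^sup>2"] dW2_law_ip[OF mono_L2_const[of 0] h(1)] dW2_law_ip[OF f(1) mono_L2_const[of 0]]
    by (simp add: f h) (simp add: ip_def)
  moreover have "ip f f + ip h h - 2 * ip f h = 4 * ip f f"
    using arg_cong[OF \<xi>(3), of "\<lambda>x. x\<^sup>2"] dW2_law_ip[OF f(1) h(1)] dW2_law_ip[OF f(1) mono_L2_const[of 0]]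
    by (simp add: f h power_mult_distrib) (simp add: ip_def)
  moreover have "ip (\<lambda>x. f x + h x) (\<lambda>x. f x + h x) = ip f f + ip h h + 2 * ip f h"
    using f h by (simp add: ip_linear ip_commute[of h f])
  ultimately have "ip (\<lambda>x. f x + h x) (\<lambda>x. f x + h x) = 0" by simp
  then have "AE x in U. f x + h x = 0"
    using f h ip_self_eq_0_iff[of "\<lambda>x. f x + h x"] by (simp add: ip_linear)
  then have sum: "AE x in U. x \<in> {0<..<1} \<longrightarrow> f x + h x = 0" by (rule eventually_mono) simp
  have mono: "mono_on {0<..<1} f" "mono_on {0<..<1} h" using f h by (auto simp: mono_L2_def)
  obtain c where "AE x in U. x \<in> {0<..<1} \<longrightarrow> f x = c"
    by (rule mono_summand_const[OF mono order_refl zero_less_one order_refl sum])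
  then have "AE x in U. f x = c" by (rule AE_mp) (auto intro: AE_I2)
  then have "law f = law (\<lambda>_. c)" using law_eq_iff[OF f(1) mono_L2_const] by blast
  then show ?L using f by (auto simp: return_eq_law)
qed

section \<open>Isometries fixing the Dirac masses preserve the linear structure\<close>

text \<open>Polarisation at the Dirac mass at 0, the origin of the cone.\<close>

lemma ip_preserved:
  assumes \<Phi>: "W2_isometric \<Phi>" "\<And>c. \<Phi> (return borel c) = return borel c"
    and m: "f \<in> mono_L2" "g \<in> mono_L2" "f' \<in> mono_L2" "g' \<in> mono_L2"
    and f': "\<Phi> (law f) = law f'" and g': "\<Phi> (law g) = law g'"
  shows "ip f' g' = ip f g"
proof -
  have iso: "dW2 (\<Phi> \<mu>) (\<Phi> \<nu>) = dW2 \<mu> \<nu>" if "\<mu> \<in> W2" "\<nu> \<in> W2" for \<mu> \<nu>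
    using \<Phi> that by (auto simp: W2_isometric_def)
  have norm: "ip h h = (dW2 (law h) (law (\<lambda>_. 0)))\<^sup>2" if "h \<in> mono_L2" for h
    using dW2_law_ip[OF that mono_L2_const[of 0]] by (simp add: ip_def)
  have 0: "\<Phi> (law (\<lambda>_. 0)) = law (\<lambda>_. 0)" using \<Phi>(2)[of 0] by (simp add: return_eq_law)
  have "ip f' f' = ip f f" "ip g' g' = ip g g"
    using iso[of "law f" "law (\<lambda>_. 0)"] iso[of "law g" "law (\<lambda>_. 0)"] m
    by (simp_all add: norm f' g' 0 law_mono_W2 mono_L2_const)
  moreover have "ip f' f' + ip g' g' - 2 * ip f' g' = ip f f + ip g g - 2 * ip f g"
    using iso[of "law f" "law g"] dW2_law_ip[OF m(1,2)] dW2_law_ip[OF m(3,4)] m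
    by (simp add: f' g' law_mono_W2)
  ultimately show ?thesis by simp
qed

lemma ip_one_preserved:
  assumes "W2_isometric \<Phi>" "\<And>c. \<Phi> (return borel c) = return borel c"
    and "f \<in> mono_L2" "f' \<in> mono_L2" "\<Phi> (law f) = law f'"
  shows "ip f' (\<lambda>_. 1) = ip f (\<lambda>_. 1)"
  using assms assms(2)[of 1]
  by (intro ip_preserved[where \<Phi> = \<Phi>]) (auto simp: mono_L2_const return_eq_law)

text \<open>Steps, and constants, separate points, and inner products with them are preserved. Applied to a
  composite and the identity, the lemma also shows that a map has an inverse.\<close>

lemma isometric_eq_if_eq_on_steps:
  assumes \<Phi>: "W2_isometric \<Phi>" "\<And>c. \<Phi> (return borel c) = return borel c"
    and \<Psi>: "W2_isometric \<Psi>" "\<And>c. \<Psi> (return borel c) = return borel c"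
    and steps: "\<And>s. \<Phi> (law (unit_step s)) = law (unit_step (\<rho> s))" "\<And>s. \<Psi> (law (unit_step s)) = law (unit_step (\<rho> s))"
    and "surj \<rho>" "\<mu> \<in> W2"
  shows "\<Phi> \<mu> = \<Psi> \<mu>"
proof -
  obtain h where h: "h \<in> mono_L2" "law h = \<mu>" using \<open>\<mu> \<in> W2\<close> by (rule W2_eq_law)
  have W2: "\<Phi> \<mu> \<in> W2" "\<Psi> \<mu> \<in> W2" using assms by (auto simp: W2_isometric_def)
  obtain f where f: "f \<in> mono_L2" "law f = \<Phi> \<mu>" using W2(1) by (rule W2_eq_law)
  obtain g where g: "g \<in> mono_L2" "law g = \<Psi> \<mu>" using W2(2) by (rule W2_eq_law)
  have "ip f (unit_step t) = ip g (unit_step t)" for t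
  proof -
    obtain s where s: "t = \<rho> s" using \<open>surj \<rho>\<close> by (metis surjD)
    have "ip f (unit_step t) = ip h (unit_step s)"
      by (rule ip_preserved[OF \<Phi>]) (use h f steps s unit_step_mono_L2 in auto)
    moreover have "ip g (unit_step t) = ip h (unit_step s)"
      by (rule ip_preserved[OF \<Psi>]) (use h g steps s unit_step_mono_L2 in auto)
    ultimately show ?thesis by simp
  qed
  moreover have "ip f (\<lambda>_. 1) = ip g (\<lambda>_. 1)"
    using ip_one_preserved[OF \<Phi> h(1) f(1)] ip_one_preserved[OF \<Psi> h(1) g(1)] h f g by simp
  ultimately have "AE x in U. f x = g x" using f g by (intro AE_eq_if_ip_unit_step_eq)
  then show ?thesis using f g law_eq_iff by metis
qed

text \<open>Spanning an extreme ray of the cone modulo constants. The coefficient \<open>l\<close> may be any real number,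
  and the condition is additive, hence visible to maps that preserve inner products.\<close>

definition extremal :: "(real \<Rightarrow> real) \<Rightarrow> bool" where
  "extremal f \<longleftrightarrow> (\<forall>g\<in>mono_L2. \<forall>h\<in>mono_L2. (AE x in U. f x = g x + h x) \<longrightarrow>
     (\<exists>l m. AE x in U. g x = l * f x + m))"

lemma extremal_unit_step: "extremal (unit_step s)"
  unfolding extremal_def
proof (intro ballI impI)
  fix g h assume g: "g \<in> mono_L2" and h: "h \<in> mono_L2" and sum: "AE x in U. unit_step s x = g x + h x"
  let ?p = "logistic s"
  have m: "mono_on {0<..<1} g" "mono_on {0<..<1} h" using g h by (auto simp: mono_L2_def)
  have "AE x in U. x \<in> {0<..<?p} \<longrightarrow> g x + h x = - exp (- s / 2)"
    using sum by (rule eventually_mono) (auto simp: unit_step_def)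
  then obtain a where a: "AE x in U. x \<in> {0<..<?p} \<longrightarrow> g x = a"
    using mono_summand_const[OF m, of 0 ?p] logistic_01[of s] by (metis less_imp_le order_refl)
  have "AE x in U. x \<in> {?p<..<1} \<longrightarrow> g x + h x = exp (s / 2)"
    using sum by (rule eventually_mono) (auto simp: unit_step_def)
  then obtain b where b: "AE x in U. x \<in> {?p<..<1} \<longrightarrow> g x = b"
    using mono_summand_const[OF m, of ?p 1] logistic_01[of s] by (metis less_imp_le order_refl)
  define D where "D = exp (s / 2) + exp (- s / 2)"
  have D: "D > 0" unfolding D_def by (simp add: add_pos_pos)
  \<comment> \<open>the affine map taking the two values of the step to \<open>a\<close> and \<open>b\<close>\<close>
  define l where "l = (b - a) / D"
  have l: "l * D = b - a" using D by (simp add: l_def)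
  have "AE x in U. x \<notin> {?p}" by (rule countable_AE_U) simp
  then have "AE x in U. g x = l * unit_step s x + (b - l * exp (s / 2))"
    using a b AE_space
  proof eventually_elim
    case (elim x)
    show ?case
    proof (cases "x < ?p")
      case True
      then have "g x = a" using elim by auto
      moreover have "a = l * (- exp (- s / 2)) + (b - l * exp (s / 2))" using l by (simp add: D_def algebra_simps)
      ultimately show ?thesis using True by (simp add: unit_step_def)
    next
      case False
      then show ?thesis using elim by (auto simp: unit_step_def)
    qed
  qed
  then show "\<exists>l m. AE x in U. g x = l * unit_step s x + m" by blast
qed

lemma min_max_mono_L2:
  assumes "f \<in> mono_L2" shows "(\<lambda>x. min (f x) 0) \<in> mono_L2" "(\<lambda>x. max (f x) 0) \<in> mono_L2"
proof -
  have [measurable]: "f \<in> borel_measurable U" using assms by (simp add: mono_L2_def L2_def)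
  have i: "integrable U (\<lambda>x. (f x)\<^sup>2)" using assms by (simp add: mono_L2_def L2_def)
  have "integrable U (\<lambda>x. (min (f x) 0)\<^sup>2)" "integrable U (\<lambda>x. (max (f x) 0)\<^sup>2)"
    by (rule Bochner_Integration.integrable_bound[OF i]; auto simp: min_def max_def)+
  moreover have "mono_on {0<..<1} f" using assms by (simp add: mono_L2_def)
  then have "mono_on {0<..<1} (\<lambda>x. min (f x) 0)" "mono_on {0<..<1} (\<lambda>x. max (f x) 0)"
    unfolding mono_on_def by (meson min.mono max.mono order_refl)+
  ultimately show "(\<lambda>x. min (f x) 0) \<in> mono_L2" "(\<lambda>x. max (f x) 0) \<in> mono_L2"
    by (simp_all add: mono_L2_def L2_def)
qed

text \<open>Split \<open>f\<close> as \<open>min f 0 + max f 0\<close>. Extremality makes \<open>min f 0\<close> an affine function of \<open>f\<close>; since \<open>f\<close> takes values of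
  both signs, this forces a single negative value, a single positive value, and no zero. A nondecreasing function with two values is
  an affine image of a step, and the normalisation removes the affine map.\<close>

lemma extremal_imp_unit_step:
  assumes f: "f \<in> mono_L2" and ex: "extremal f" and mean: "ip f (\<lambda>_. 1) = 0" and norm: "ip f f = 1"
  obtains s where "AE x in U. f x = unit_step s x"
proof -
  have int: "integrable U f" "(\<integral>x. f x \<partial>U) = 0"
    using f mean by (simp_all add: integrable_L2 mono_L2_L2 ip_def)
  have nz: "\<not> (AE x in U. f x = 0)" using norm f ip_self_eq_0_iff[of f] by (simp add: mono_L2_L2)
  have neg: "\<not> (AE x in U. 0 \<le> f x)"
    using integral_nonneg_eq_0_iff_AE[of U f] int nz by auto
  have pos: "\<not> (AE x in U. f x \<le> 0)"
    using integral_nonneg_eq_0_iff_AE[of U "\<lambda>x. - f x"] int nz by auto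
  have "AE x in U. f x = min (f x) 0 + max (f x) 0" by (intro AE_I2) (auto simp: min_def max_def)
  then have "\<exists>l m. AE x in U. min (f x) 0 = l * f x + m"
    using ex[unfolded extremal_def, THEN bspec, OF min_max_mono_L2(1)[OF f], THEN bspec, OF min_max_mono_L2(2)[OF f]] by simp
  then obtain l m where "AE x in U. min (f x) 0 = l * f x + m" by blast
  then have good: "AE x in U. x \<in> {0<..<1} \<and> min (f x) 0 = l * f x + m" (is "AE x in U. ?good x")
    using AE_space by eventually_elim simp
  have "\<exists>x. ?good x \<and> f x < 0"
  proof (rule ccontr)
    assume "\<not> ?thesis"
    then have "?good x \<Longrightarrow> 0 \<le> f x" for x by (meson not_less)
    then have "AE x in U. 0 \<le> f x" using good by (rule eventually_mono[rotated])
    with neg show False by blast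
  qed
  then obtain x\<^sub>1 where x\<^sub>1: "?good x\<^sub>1" "f x\<^sub>1 < 0" by blast
  have "\<exists>x. ?good x \<and> f x > 0"
  proof (rule ccontr)
    assume "\<not> ?thesis"
    then have "?good x \<Longrightarrow> f x \<le> 0" for x by (meson not_less)
    then have "AE x in U. f x \<le> 0" using good by (rule eventually_mono[rotated])
    with pos show False by blast
  qed
  then obtain x\<^sub>2 where x\<^sub>2: "?good x\<^sub>2" "f x\<^sub>2 > 0" by blast
  have m1: "f x\<^sub>1 * (1 - l) = m" and m2: "l * f x\<^sub>2 = - m" using x\<^sub>1 x\<^sub>2 by (auto simp: min_def algebra_simps)
  have l: "l \<noteq> 0" "l \<noteq> 1" and m: "m \<noteq> 0" using m1 m2 x\<^sub>1 x\<^sub>2 by auto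
  let ?a = "f x\<^sub>1" and ?b = "f x\<^sub>2"
  have two: "f x = (if f x \<le> 0 then ?a else ?b)" if "?good x" for x
  proof (cases "f x < 0")
    case True
    then have "f x * (1 - l) = f x\<^sub>1 * (1 - l)" using that m1 by (simp add: min_def algebra_simps)
    then show ?thesis using True l by simp
  next
    case False
    then have "l * f x = l * f x\<^sub>2" using that m2 by (simp add: min_def algebra_simps split: if_splits)
    then have "f x = f x\<^sub>2" using l by simp
    then show ?thesis using x\<^sub>2 by simp
  qed
  have mono: "mono_on {0<..<1} f" using f by (simp add: mono_L2_def)
  define S where "S = {x \<in> {0<..<1}. f x \<le> 0}"
  \<comment> \<open>the position of the jump, where the value of \<open>f\<close> is arbitrary\<close>
  define p where "p = Sup S"
  have bdd: "bdd_above S" by (auto simp: S_def intro!: bdd_aboveI[of _ 1])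
  have "x\<^sub>1 \<in> S" using x\<^sub>1 by (auto simp: S_def)
  then have "x\<^sub>1 \<le> p" unfolding p_def using bdd by (rule cSup_upper)
  have "x \<le> x\<^sub>2" if "x \<in> S" for x
    using that x\<^sub>2 mono_onD[OF mono, of x\<^sub>2 x] by (cases "x \<le> x\<^sub>2") (auto simp: S_def)
  then have "p \<le> x\<^sub>2" unfolding p_def using \<open>x\<^sub>1 \<in> S\<close> by (intro cSup_least) auto
  have p: "0 < p" "p < 1" using x\<^sub>1 x\<^sub>2 \<open>x\<^sub>1 \<le> p\<close> \<open>p \<le> x\<^sub>2\<close> by auto
  then obtain s where s: "logistic s = p" by (auto elim: logistic_surj)
  define \<beta> where "\<beta> = (?b - ?a) / (exp (s / 2) + exp (- s / 2))"
  define \<alpha> where "\<alpha> = ?b - \<beta> * exp (s / 2)"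
  have D: "0 < exp (s / 2) + exp (- s / 2)" by (simp add: add_pos_pos)
  then have \<beta>0: "\<beta> > 0" using x\<^sub>1 x\<^sub>2 by (simp add: \<beta>_def)
  have \<beta>: "\<beta> * (exp (s / 2) + exp (- s / 2)) = ?b - ?a" using D by (simp add: \<beta>_def)
  have "AE x in U. x \<notin> {p}" by (rule countable_AE_U) simp
  then have f_eq: "AE x in U. f x = \<alpha> + \<beta> * unit_step s x"
    using good
  proof eventually_elim
    case (elim x)
    show ?case
    proof (cases "x < p")
      case True
      then obtain y where "y \<in> S" "x < y" unfolding p_def using less_cSup_iff[OF _ bdd] \<open>x\<^sub>1 \<in> S\<close> by blast
      then have "f x \<le> 0" using elim mono_onD[OF mono, of x y] by (auto simp: S_def)
      then have "f x = ?a" using two[of x] elim by simp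
      moreover have "?a = \<alpha> + \<beta> * (- exp (- s / 2))" using \<beta> by (simp add: \<alpha>_def algebra_simps)
      ultimately show ?thesis using True s by (simp add: unit_step_def)
    next
      case False
      then have "x \<notin> S" using elim cSup_upper[OF _ bdd, of x] by (auto simp: p_def)
      then have "f x = ?b" using two[of x] elim by (auto simp: S_def)
      then show ?thesis using False elim s by (auto simp: unit_step_def \<alpha>_def)
    qed
  qed
  note L = ip_linear unit_step_mono_L2[THEN mono_L2_L2] mean_unit_step ip_unit_step_unit_step ip_commute[of "\<lambda>_. 1" "unit_step s"]
  let ?g = "\<lambda>x. \<alpha> * 1 + \<beta> * unit_step s x"
  have g: "?g \<in> L2" by (intro L2_add L2_scale L2_const unit_step_mono_L2[THEN mono_L2_L2])
  have fg: "AE x in U. f x = ?g x" using f_eq by simp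
  have "ip f (\<lambda>_. 1) = ip ?g (\<lambda>_. 1)" using f g fg by (intro ip_cong_AE) (auto simp: L2_const mono_L2_L2)
  also have "\<dots> = ip (\<lambda>x. \<alpha>) (\<lambda>_. 1) + ip (\<lambda>x. \<beta> * unit_step s x) (\<lambda>_. 1)" 
    by (subst ip_add_left[symmetric]) (simp_all add: L)
  also have "\<dots> = \<alpha>" by (simp add: L)
  finally have \<alpha>: "\<alpha> = 0" using mean by simp
  then have fg': "AE x in U. f x = \<beta> * unit_step s x" using f_eq by simp
  have "ip f f = ip (\<lambda>x. \<beta> * unit_step s x) f" using f fg' by (intro ip_cong_AE) (auto simp: L)
  also have "\<dots> = ip (\<lambda>x. \<beta> * unit_step s x) (\<lambda>x. \<beta> * unit_step s x)" using f fg' by (intro ip_cong_AE) (auto simp: L)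
  also have "\<dots> = \<beta>\<^sup>2" by (simp add: ip_scale_left ip_scale_right ip_unit_step_unit_step power2_eq_square)
  finally have "\<beta> = 1" using norm \<beta>0 by (simp add: power2_eq_1_iff)
  then show thesis using that fg' by simp
qed

text \<open>A linear relation says that a norm vanishes, and that norm is a polynomial in the inner products.\<close>

lemma AE_relation_transfer:
  assumes L: "f \<in> L2" "g \<in> L2" "h \<in> L2" "f' \<in> L2" "g' \<in> L2" "h' \<in> L2"
    and eq: "ip f' f' = ip f f" "ip g' g' = ip g g" "ip h' h' = ip h h"
      "ip f' g' = ip f g" "ip f' h' = ip f h" "ip g' h' = ip g h"
    and rel: "AE x in U. a * f x + b * g x + c * h x = 0"
  shows "AE x in U. a * f' x + b * g' x + c * h' x = 0"
proof -
  have expand: "ip (\<lambda>x. a * u x + b * v x + c * w x) (\<lambda>x. a * u x + b * v x + c * w x)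
     = a\<^sup>2 * ip u u + b\<^sup>2 * ip v v + c\<^sup>2 * ip w w + 2 * a * b * ip u v + 2 * a * c * ip u w + 2 * b * c * ip v w"
    if "u \<in> L2" "v \<in> L2" "w \<in> L2" for u v w
    using that by (simp add: ip_linear ip_commute[of v u] ip_commute[of w u] ip_commute[of w v] 
        power2_eq_square algebra_simps)
  have "ip (\<lambda>x. a * f x + b * g x + c * h x) (\<lambda>x. a * f x + b * g x + c * h x) = 0"
    using rel L by (subst ip_self_eq_0_iff) (auto simp: ip_linear)
  then have "ip (\<lambda>x. a * f' x + b * g' x + c * h' x) (\<lambda>x. a * f' x + b * g' x + c * h' x) = 0"
    using L eq by (simp add: expand)
  then show ?thesis using L by (subst (asm) ip_self_eq_0_iff) (auto simp: ip_linear)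
qed

text \<open>Preserving inner products, the isometry is additive; being onto, it maps extreme rays to extreme rays.\<close>

lemma dirac_fixing_maps_unit_step:
  assumes \<Phi>: "W2_isometric \<Phi>" "\<And>c. \<Phi> (return borel c) = return borel c" and surj: "W2 \<subseteq> \<Phi> ` W2"
  obtains t where "\<Phi> (law (unit_step s)) = law (unit_step t)"
proof -
  have W2: "\<Phi> \<mu> \<in> W2" if "\<mu> \<in> W2" for \<mu> using \<Phi> that by (auto simp: W2_isometric_def)
  note pres = ip_preserved[OF \<Phi>] and pres1 = ip_one_preserved[OF \<Phi>]
  have e: "unit_step s \<in> mono_L2" by (rule unit_step_mono_L2)
  obtain f where f: "f \<in> mono_L2" "law f = \<Phi> (law (unit_step s))"
    using W2[OF law_mono_W2[OF e]] by (rule W2_eq_law)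
  \<comment> \<open>a decomposition of the image is pulled back, where the step is extremal, and pushed forward again\<close>
  have "extremal f" unfolding extremal_def
  proof (intro ballI impI)
    fix g h assume g: "g \<in> mono_L2" and h: "h \<in> mono_L2" and sum: "AE x in U. f x = g x + h x"
    obtain g0 where g0: "g0 \<in> mono_L2" "\<Phi> (law g0) = law g"
      using surj law_mono_W2[OF g] by (metis W2_eq_law image_iff subsetD)
    obtain h0 where h0: "h0 \<in> mono_L2" "\<Phi> (law h0) = law h"
      using surj law_mono_W2[OF h] by (metis W2_eq_law image_iff subsetD)
    let ?k0 = "\<lambda>x. g0 x + h0 x"
    have k0: "?k0 \<in> mono_L2" using g0 h0 by (intro mono_L2_add)
    obtain k where k: "k \<in> mono_L2" "law k = \<Phi> (law ?k0)"
      using W2[OF law_mono_W2[OF k0]] by (rule W2_eq_law)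
    have "AE x in U. 1 * g x + 1 * h x + (-1) * k x = 0"
      by (rule AE_relation_transfer[of g0 h0 ?k0 g h k])
        (use g h k g0 h0 k0 in \<open>auto intro!: pres mono_L2_L2\<close>)
    then have "AE x in U. f x = k x" using sum by eventually_elim simp
    then have "law f = law k" using law_eq_iff[OF f(1) k(1)] by blast
    then have "law ?k0 = law (unit_step s)"
      using f k W2_isometric_inj[OF \<Phi>(1) law_mono_W2[OF k0] law_mono_W2[OF e]] by simp
    then have "AE x in U. unit_step s x = g0 x + h0 x"
      using law_eq_iff[OF k0 e] by (auto elim: eventually_mono)
    then obtain l m where "AE x in U. g0 x = l * unit_step s x + m"
      using extremal_unit_step[of s] g0 h0 unfolding extremal_def by blast
    then have *: "AE x in U. 1 * g0 x + (-l) * unit_step s x + (-m) * 1 = 0" by eventually_elim simp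
    have "AE x in U. 1 * g x + (-l) * f x + (-m) * 1 = 0"
      by (rule AE_relation_transfer[OF _ _ _ _ _ _ _ _ _ _ _ _ *])
        (use g f g0 e in \<open>auto intro!: pres pres1 mono_L2_L2 mono_L2_const\<close>)
    then have "AE x in U. g x = l * f x + m" by eventually_elim simp
    then show "\<exists>l m. AE x in U. g x = l * f x + m" by blast
  qed
  moreover have "ip f (\<lambda>_. 1) = 0" using pres1[OF e f(1)] f mean_unit_step by simp
  moreover have "ip f f = 1"
    using pres[OF e e f(1) f(1) f(2)[symmetric] f(2)[symmetric]] by (simp add: ip_unit_step_unit_step)
  ultimately obtain t where "AE x in U. f x = unit_step t x" using f extremal_imp_unit_step by metis
  then have "law f = law (unit_step t)" using law_eq_iff[OF f(1) unit_step_mono_L2] by blast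
  then show thesis using that f by simp
qed

lemma dirac_fixing_acts_isometrically:
  assumes \<Phi>: "W2_isometric \<Phi>" "\<And>c. \<Phi> (return borel c) = return borel c" and surj: "W2 \<subseteq> \<Phi> ` W2"
  obtains \<rho> :: "real \<Rightarrow> real" where "\<And>s. \<Phi> (law (unit_step s)) = law (unit_step (\<rho> s))" "\<And>s t. dist (\<rho> s) (\<rho> t) = dist s t"
proof -
  have "\<exists>t. \<Phi> (law (unit_step s)) = law (unit_step t)" for s
    using dirac_fixing_maps_unit_step[OF assms] by metis
  then obtain \<rho> where \<rho>: "\<Phi> (law (unit_step s)) = law (unit_step (\<rho> s))" for s by metis
  moreover have "dist (\<rho> s) (\<rho> t) = dist s t" for s t
  proof -
    have "ip (unit_step (\<rho> s)) (unit_step (\<rho> t)) = ip (unit_step s) (unit_step t)"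
      by (rule ip_preserved[OF \<Phi>]) (auto simp: \<rho> unit_step_mono_L2)
    then show ?thesis by (simp add: ip_unit_step_unit_step dist_real_def)
  qed
  ultimately show thesis by (rule that)
qed

lemma law_unit_step_inj: "law (unit_step s) = law (\<lambda>x. unit_step t x + v) \<Longrightarrow> s = t \<and> v = 0"
proof -
  assume eq: "law (unit_step s) = law (\<lambda>x. unit_step t x + v)"
  note L = unit_step_mono_L2[THEN mono_L2_L2] ip_linear mean_unit_step ip_unit_step_unit_step ip_commute[of "\<lambda>_. 1" "unit_step s"]
  have m: "(\<lambda>x. unit_step t x + v) \<in> mono_L2" by (intro mono_L2_add unit_step_mono_L2 mono_L2_const)
  then have "AE x in U. unit_step s x = unit_step t x + v" using eq by (simp add: law_eq_iff unit_step_mono_L2)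
  then have "ip (unit_step s) h = ip (\<lambda>x. unit_step t x + v) h" if "h \<in> L2" for h
    using that m by (intro ip_cong_AE) (auto simp: L)
  from this[of "\<lambda>_. 1"] this[of "unit_step s"] have "v = 0" "exp (- \<bar>t - s\<bar> / 2) = 1"
    by (simp_all add: L ip_unit_step)
  then show ?thesis by simp
qed

section \<open>Integration by parts for integrable functions\<close>

lemma continuous_measurable_U: 
  fixes g :: "real \<Rightarrow> real" shows "continuous_on {0..1} g \<Longrightarrow> g \<in> borel_measurable U"
proof -
  assume "continuous_on {0..1} g"
  then have "continuous_on {0<..<1} g" by (rule continuous_on_subset) auto
  then have "g \<in> borel_measurable (restrict_space borel {0<..<1})" by (rule borel_measurable_continuous_on_restrict)
  then show ?thesis using sets_U measurable_cong_sets by blast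
qed

lemma integrable_mult_continuous:
  fixes f :: "real \<Rightarrow> real"
  assumes f: "integrable U f" and g: "continuous_on {0..1} g"
  shows "integrable U (\<lambda>x. f x * g x)"
proof -
  have [measurable]: "f \<in> borel_measurable U" "g \<in> borel_measurable U"
    using f g by (auto intro: continuous_measurable_U)
  have "bounded (g ` {0..1})" using g by (intro compact_imp_bounded compact_continuous_image) auto
  then obtain B where B: "\<And>x. x \<in> {0..1} \<Longrightarrow> \<bar>g x\<bar> \<le> B"
    unfolding bounded_iff by (metis imageI real_norm_def)
  have "integrable U (\<lambda>x. B * \<bar>f x\<bar>)" using f by simp
  then show ?thesis
  proof (rule Bochner_Integration.integrable_bound)
    show "AE x in U. norm (f x * g x) \<le> norm (B * \<bar>f x\<bar>)"
    proof (rule AE_I2)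
      fix x assume "x \<in> space U"
      then have "\<bar>g x\<bar> \<le> B" by (intro B) auto
      then have "\<bar>g x\<bar> * \<bar>f x\<bar> \<le> \<bar>B\<bar> * \<bar>f x\<bar>" by (intro mult_right_mono) auto
      then show "norm (f x * g x) \<le> norm (B * \<bar>f x\<bar>)" by (simp add: abs_mult mult.commute)
    qed
  qed measurable
qed

lemma integrable_continuous_U: "continuous_on {0..1} g \<Longrightarrow> integrable U g" for g :: "real \<Rightarrow> real"
  using integrable_mult_continuous[of "\<lambda>_. 1" g] by simp

lemma primitive_1_integral: "integrable U f \<Longrightarrow> primitive f 1 = (\<integral>x. f x \<partial>U)"
  by (simp add: primitive_def integral_U)

text \<open>The functions are only integrable, so the formula is obtained from Fubini on the unit square, cut along its
  diagonal.\<close>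

lemma integral_by_parts:
  assumes a: "integrable U a" and b: "integrable U b"
  shows "(\<integral>x. a x * primitive b x + primitive a x * b x \<partial>U) = primitive a 1 * primitive b 1"
proof -
  interpret P: pair_sigma_finite U U ..
  have [measurable]: "a \<in> borel_measurable U" "b \<in> borel_measurable U" using a b by auto
  have [measurable]: "(\<lambda>x. x) \<in> U \<rightarrow>\<^sub>M borel" by (rule borel_measurable_U) simp
  have [measurable]: "(\<lambda>q. fst q) \<in> U \<Otimes>\<^sub>M U \<rightarrow>\<^sub>M borel" "(\<lambda>q. snd q) \<in> U \<Otimes>\<^sub>M U \<rightarrow>\<^sub>M borel"
    using measurable_compose[of fst "U \<Otimes>\<^sub>M U" U "\<lambda>x. x" borel] measurable_compose[of snd "U \<Otimes>\<^sub>M U" U "\<lambda>x. x" borel]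
    by simp_all
  define h where "h = (\<lambda>x y. a x * b y * (if x \<le> y then 1 else 0) :: real)"
  have ab: "integrable (U \<Otimes>\<^sub>M U) (\<lambda>q. a (fst q) * b (snd q))"
    by (rule P.Fubini_integrable) (use a b in \<open>auto simp: abs_mult\<close>)
  have h: "integrable (U \<Otimes>\<^sub>M U) (case_prod h)"
    by (rule Bochner_Integration.integrable_bound[OF ab]) (auto simp: h_def case_prod_unfold)
  have eq: "primitive b x + (\<integral>y. b y * (if x \<le> y then 1 else 0) \<partial>U) = primitive b 1" if x: "x \<in> space U" for x
  proof -
    have i1: "integrable U (\<lambda>y. b y * indicator {..x} y)" and i2: "integrable U (\<lambda>y. b y * indicator {x..} y)"
      using b by (auto intro: integrable_mult_indicator_U)
    have "primitive b x + (\<integral>y. b y * (if x \<le> y then 1 else 0) \<partial>U)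
      = (\<integral>y. b y * indicator {..x} y \<partial>U) + (\<integral>y. b y * indicator {x..} y \<partial>U)"
      using x primitive_eq_integral_indicator[OF b, of x] by (auto simp: indicator_def of_bool_def)
    also have "\<dots> = (\<integral>y. b y * indicator {..x} y + b y * indicator {x..} y \<partial>U)"
      using i1 i2 by simp
    also have "\<dots> = (\<integral>y. b y \<partial>U)"
    proof (rule integral_cong_AE)
      have "AE y in U. y \<notin> {x}" by (rule countable_AE_U) simp
      then show "AE y in U. b y * indicator {..x} y + b y * indicator {x..} y = b y"
        by eventually_elim (auto simp: indicator_def)
    qed (use i1 i2 in auto)
    finally show ?thesis using b by (simp add: primitive_1_integral)
  qed
  have i1: "integrable U (\<lambda>x. a x * primitive b x)"
    using a b by (intro integrable_mult_continuous continuous_on_primitive)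
  have i2: "integrable U (\<lambda>x. primitive a x * b x)"
    using integrable_mult_continuous[OF b continuous_on_primitive[OF a]] by (simp add: mult.commute)
  have "(\<integral>x. primitive a x * b x \<partial>U) = (\<integral>y. \<integral>x. h x y \<partial>U \<partial>U)"
  proof (intro Bochner_Integration.integral_cong refl)
    fix y assume "y \<in> space U"
    then have "primitive a y * b y = (\<integral>x. a x * indicator {..y} x \<partial>U) * b y"
      using primitive_eq_integral_indicator[OF a, of y] by auto
    also have "\<dots> = (\<integral>x. (a x * indicator {..y} x) * b y \<partial>U)" by simp
    also have "\<dots> = (\<integral>x. h x y \<partial>U)"
      by (rule Bochner_Integration.integral_cong) (auto simp: h_def indicator_def)
    finally show "primitive a y * b y = (\<integral>x. h x y \<partial>U)" .
  qed
  also have "\<dots> = (\<integral>x. \<integral>y. h x y \<partial>U \<partial>U)" using h by (rule P.Fubini_integral)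
  also have "\<dots> = (\<integral>x. a x * (primitive b 1 - primitive b x) \<partial>U)"
  proof (intro Bochner_Integration.integral_cong refl)
    fix x assume x: "x \<in> space U"
    have "(\<integral>y. h x y \<partial>U) = (\<integral>y. a x * (b y * (if x \<le> y then 1 else 0)) \<partial>U)"
      by (simp add: h_def mult.assoc)
    also have "\<dots> = a x * (\<integral>y. b y * (if x \<le> y then 1 else 0) \<partial>U)" by simp
    also have "\<dots> = a x * (primitive b 1 - primitive b x)" using eq[OF x] by simp
    finally show "(\<integral>y. h x y \<partial>U) = a x * (primitive b 1 - primitive b x)" .
  qed
  also have "\<dots> = primitive a 1 * primitive b 1 - (\<integral>x. a x * primitive b x \<partial>U)"
    using a i1 by (simp add: right_diff_distrib primitive_1_integral[OF a])
  finally show ?thesis using i1 i2 by simp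
qed

text \<open>The previous lemma for the functions cut off at \<open>p\<close>.\<close>

lemma primitive_by_parts:
  assumes a: "integrable U a" and b: "integrable U b" and p: "p \<in> {0..1}"
  shows "primitive (\<lambda>x. a x * primitive b x + primitive a x * b x) p = primitive a p * primitive b p"
proof -
  let ?a = "\<lambda>x. a x * indicator {..p} x" and ?b = "\<lambda>x. b x * indicator {..p} x"
  have i: "integrable U ?a" "integrable U ?b" using a b by (auto intro: integrable_mult_indicator_U)
  have cut: "primitive (\<lambda>x. c x * indicator {..p} x) x = primitive c x" if "x \<le> p" for c x
    unfolding primitive_def by (intro integral_cong) (use that in auto)
  have cut1: "primitive (\<lambda>x. c x * indicator {..p} x) 1 = primitive c p" if "integrable U c" for c
    using that p primitive_eq_integral_indicator[of c p] by (simp add: primitive_1_integral integrable_mult_indicator_U)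
  have int: "integrable U (\<lambda>x. a x * primitive b x + primitive a x * b x)"
    using integrable_mult_continuous[OF a continuous_on_primitive[OF b]] integrable_mult_continuous[OF b continuous_on_primitive[OF a]]
    by (simp add: mult.commute)
  have "primitive (\<lambda>x. a x * primitive b x + primitive a x * b x) p
    = (\<integral>x. (a x * primitive b x + primitive a x * b x) * indicator {..p} x \<partial>U)"
    by (rule primitive_eq_integral_indicator[OF int p])
  also have "\<dots> = (\<integral>x. ?a x * primitive ?b x + primitive ?a x * ?b x \<partial>U)"
  proof (intro Bochner_Integration.integral_cong refl)
    fix x
    show "(a x * primitive b x + primitive a x * b x) * indicator {..p} x = ?a x * primitive ?b x + primitive ?a x * ?b x"
      by (cases "x \<le> p") (simp_all add: cut)
  qed
  also have "\<dots> = primitive a p * primitive b p"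
    using integral_by_parts[OF i] by (simp add: cut1 a b)
  finally show ?thesis .
qed

section \<open>A Moebius flow on the unit interval\<close>

definition rate :: "real \<Rightarrow> real" where
  "rate t = exp (t / 2) - exp (- t / 2)"

definition weight :: "real \<Rightarrow> real \<Rightarrow> real" where
  "weight t p = exp (- t / 2) + rate t * p"

text \<open>In the logistic coordinate the flow \<open>moebius\<close> is translation. Its weight is an affine function of \<open>p\<close>, and its
  derivative is the inverse square of the weight; both facts are used throughout.\<close>

definition moebius :: "real \<Rightarrow> real \<Rightarrow> real" where
  "moebius t p = exp (t / 2) * p / weight t p"

lemma rate_minus [simp]: "rate (- t) = - rate t"
  by (simp add: rate_def)

lemma weight_pos: assumes "0 \<le> p" "p \<le> 1" shows "0 < weight t p"
proof -
  have "weight t p = exp (- t / 2) * (1 - p) + exp (t / 2) * p" by (simp add: weight_def rate_def algebra_simps)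
  moreover have "0 \<le> exp (- t / 2) * (1 - p)" "0 \<le> exp (t / 2) * p" using assms by auto
  moreover have "0 < exp (- t / 2) * (1 - p) \<or> 0 < exp (t / 2) * p" using assms by (cases "p = 0") auto
  ultimately show ?thesis by linarith
qed

lemma exp_half_minus: "exp (- (t / 2)) * exp (t / 2) = 1" "exp (t / 2) * exp (- (t / 2)) = 1" for t :: real
  by (simp_all add: exp_add[symmetric])

lemma weight_moebius: assumes "0 \<le> p" "p \<le> 1" shows "weight (- t) (moebius t p) = 1 / weight t p"
proof -
  have w: "weight t p \<noteq> 0" using weight_pos[OF assms, of t] by simp
  have "weight (- t) (moebius t p) = exp (t / 2) * (weight t p - rate t * p) / weight t p"
    using w by (simp add: weight_def[of "- t"] moebius_def field_simps)
  also have "weight t p - rate t * p = exp (- t / 2)" by (simp add: weight_def)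
  finally show ?thesis by (simp add: exp_half_minus)
qed

lemma moebius_moebius: assumes "0 \<le> p" "p \<le> 1" shows "moebius (- t) (moebius t p) = p"
proof -
  have w: "weight t p \<noteq> 0" using weight_pos[OF assms, of t] by simp
  have "moebius (- t) (moebius t p) = exp (- t / 2) * moebius t p * weight t p"
    unfolding moebius_def[of "- t"] weight_moebius[OF assms] by simp
  also have "\<dots> = (exp (- t / 2) * exp (t / 2)) * p" using w by (simp add: moebius_def mult.assoc)
  finally show ?thesis by (simp add: exp_half_minus)
qed

lemma moebius_le_iff:
  assumes "0 \<le> p" "p \<le> 1" "0 \<le> q" "q \<le> 1" shows "moebius t p \<le> moebius t q \<longleftrightarrow> p \<le> q"
proof -
  have w: "0 < weight t p" "0 < weight t q" using assms by (auto intro: weight_pos)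
  have "moebius t p \<le> moebius t q \<longleftrightarrow> exp (t / 2) * p * weight t q \<le> exp (t / 2) * q * weight t p"
    using w by (simp add: moebius_def divide_le_eq le_divide_eq pos_le_divide_eq pos_divide_le_eq mult.commute mult.left_commute field_simps)
  also have "\<dots> \<longleftrightarrow> p * weight t q \<le> q * weight t p" by (simp add: mult.assoc)
  also have "\<dots> \<longleftrightarrow> p * exp (- t / 2) \<le> q * exp (- t / 2)" by (simp add: weight_def algebra_simps)
  finally show ?thesis by simp
qed

lemma moebius_0 [simp]: "moebius t 0 = 0" and moebius_1 [simp]: "moebius t 1 = 1"
  by (simp_all add: moebius_def weight_def rate_def)

lemma moebius_01: assumes "p \<in> {0<..<1}" shows "moebius t p \<in> {0<..<1}"
  using assms moebius_le_iff[of p 0 t] moebius_le_iff[of 1 p t] by (auto simp: not_le)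

lemma moebius_has_derivative:
  assumes "0 \<le> p" "p \<le> 1" shows "(moebius t has_real_derivative 1 / (weight t p)\<^sup>2) (at p)"
proof -
  have w: "weight t p \<noteq> 0" using weight_pos[OF assms, of t] by simp
  have wd: "(weight t has_real_derivative rate t) (at p)"
    unfolding weight_def by (auto intro!: derivative_eq_intros)
  have "(moebius t has_real_derivative (exp (t / 2) * weight t p - exp (t / 2) * p * rate t) / (weight t p * weight t p)) (at p)"
    unfolding moebius_def using w by (auto intro!: derivative_eq_intros wd)
  also have "exp (t / 2) * weight t p - exp (t / 2) * p * rate t = exp (t / 2) * exp (- t / 2)"
    by (simp add: weight_def algebra_simps)
  finally show ?thesis by (simp add: exp_half_minus power2_eq_square)
qed

lemma moebius_logistic: "moebius t (logistic s) = logistic (s + t)"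
proof -
  define E where "E = 1 + exp (- s)"
  have E: "E > 0" unfolding E_def by (simp add: add_pos_pos)
  have l: "logistic s = 1 / E" by (simp add: logistic_def E_def)
  have w: "weight t (logistic s) = (exp (- t / 2) * exp (- s) + exp (t / 2)) / E"
  proof -
    have 1: "E * weight t (1 / E) = exp (- t / 2) * (E - 1) + exp (t / 2)"
      using E by (simp add: weight_def rate_def algebra_simps)
    have 2: "exp (- s) = E - 1" by (simp add: E_def)
    show ?thesis unfolding l 2 1[symmetric] using E by simp
  qed
  have "moebius t (logistic s) = exp (t / 2) / (exp (- t / 2) * exp (- s) + exp (t / 2))"
    unfolding moebius_def w unfolding l using E by simp
  also have "exp (- t / 2) * exp (- s) + exp (t / 2) = exp (t / 2) * (1 + exp (- (s + t)))"
    by (simp add: distrib_left exp_add[symmetric])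
  finally show ?thesis by (simp add: logistic_def)
qed

section \<open>The flow on quantile functions\<close>

text \<open>The flow should send \<open>unit_step s\<close> to \<open>unit_step (s + t)\<close>. On the Stieltjes derivative of a quantile function this means
  multiplication by \<open>weight t\<close> followed by transport along \<open>moebius t\<close>. Integrating, with the constant fixed by keeping the
  mean \<open>m\<close>, gives the formula below, which makes sense without Stieltjes integrals. Equivalently, the primitive of the
  centred function is divided by the weight and transported.\<close>

definition flow :: "real \<Rightarrow> (real \<Rightarrow> real) \<Rightarrow> real \<Rightarrow> real" where
  "flow t f x = (let p = moebius (- t) x; m = primitive f 1
     in m + weight t p * (f p - m) - rate t * (primitive f p - m * p))"

lemma flow_moebius:
  assumes "p \<in> {0..1}"
  shows "flow t f (moebius t p) = primitive f 1 + weight t p * (f p - primitive f 1) - rate t * (primitive f p - primitive f 1 * p)"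
  using assms by (simp add: flow_def Let_def moebius_moebius)

lemma flow_diff:
  assumes "f \<in> L2" "g \<in> L2" "x \<in> {0<..<1}"
  shows "flow t (\<lambda>x. f x - g x) x = flow t f x - flow t g x"
  using assms moebius_01[OF assms(3), of "- t"]
  by (simp add: flow_def Let_def primitive_diff integrable_L2 algebra_simps)

lemma flow_const: "x \<in> {0<..<1} \<Longrightarrow> flow t (\<lambda>_. c) x = c"
  using moebius_01[of x "- t"] by (simp add: flow_def Let_def primitive_const)

lemma flow_unit_step:
  assumes x: "x \<in> {0<..<1}" shows "flow t (unit_step s) x = unit_step (s + t) x"
proof -
  let ?p = "moebius (- t) x"
  have p: "?p \<in> {0<..<1}" using x by (rule moebius_01)
  have 1: "primitive (unit_step s) 1 = 0" using primitive_unit_step[of 1 s] logistic_01[of s] by simp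
  have "moebius (- t) (logistic (s + t)) = logistic s" by (simp add: moebius_logistic)
  then have iff: "?p \<le> logistic s \<longleftrightarrow> x \<le> logistic (s + t)"
    using moebius_le_iff[of x "logistic (s + t)" "- t"] x logistic_01[of "s + t"] by auto
  have "flow t (unit_step s) x = weight t ?p * unit_step s ?p - rate t * primitive (unit_step s) ?p"
    by (simp add: flow_def Let_def 1)
  also have "\<dots> = unit_step (s + t) x"
  proof (cases "?p \<le> logistic s")
    case True
    then have "weight t ?p * unit_step s ?p - rate t * primitive (unit_step s) ?p = - (exp (- s / 2) * exp (- t / 2))"
      using p by (simp add: primitive_unit_step unit_step_def weight_def algebra_simps)
    then show ?thesis using True iff by (simp add: unit_step_def exp_add[symmetric] field_simps)
  next
    case False
    then have "weight t ?p * unit_step s ?p - rate t * primitive (unit_step s) ?p = exp (s / 2) * exp (t / 2)"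
      using p by (simp add: primitive_unit_step unit_step_def weight_def rate_def algebra_simps)
    then show ?thesis using False iff by (simp add: unit_step_def exp_add[symmetric] field_simps)
  qed
  finally show ?thesis .
qed

lemma primitive_increment_bounds:
  assumes f: "f \<in> mono_L2" and pq: "0 < p" "p \<le> q" "q < 1"
  shows "f p * (q - p) \<le> primitive f q - primitive f p" "primitive f q - primitive f p \<le> f q * (q - p)"
proof -
  have i: "integrable U f" using f by (simp add: integrable_L2 mono_L2_L2)
  have "integral {0..p} f + integral {p..q} f = integral {0..q} f"
    using pq i by (intro Henstock_Kurzweil_Integration.integral_combine integrable_on_01) auto
  then have eq: "primitive f q - primitive f p = integral {p..q} f" by (simp add: primitive_def)
  have m: "f x \<le> f y" if "p \<le> x" "x \<le> y" "y \<le> q" for x y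
    using f that pq unfolding mono_L2_def by (auto intro: mono_onD)
  have "integral {p..q} (\<lambda>_. f p) \<le> integral {p..q} f"
    using pq i m by (intro integral_le integrable_on_01) auto
  then show "f p * (q - p) \<le> primitive f q - primitive f p" unfolding eq using pq by (simp add: mult.commute)
  have "integral {p..q} f \<le> integral {p..q} (\<lambda>_. f q)"
    using pq i m by (intro integral_le integrable_on_01) auto
  then show "primitive f q - primitive f p \<le> f q * (q - p)" unfolding eq using pq by (simp add: mult.commute)
qed

text \<open>The Stieltjes derivative is multiplied by a positive function. In terms of increments: the increment of the
  primitive lies between the bounds that monotonicity gives, and the sign of \<open>rate t\<close> decides which of them is needed.\<close>

lemma flow_mono:
  assumes f: "f \<in> mono_L2" shows "mono_on {0<..<1} (flow t f)"
proof (rule mono_onI)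
  fix x y :: real assume xy: "x \<in> {0<..<1}" "y \<in> {0<..<1}" "x \<le> y"
  define p q where "p = moebius (- t) x" and "q = moebius (- t) y"
  have pq: "0 < p" "p < 1" "0 < q" "q < 1" "p \<le> q"
    using xy moebius_01[of x "- t"] moebius_01[of y "- t"] moebius_le_iff[of x y "- t"] by (auto simp: p_def q_def)
  define m where "m = primitive f 1"
  define a b I where "a = f p - m" and "b = f q - m" and "I = (primitive f q - m * q) - (primitive f p - m * p)"
  have ab: "a \<le> b" using f pq unfolding a_def b_def mono_L2_def by (auto intro: mono_onD)
  have I: "a * (q - p) \<le> I" "I \<le> b * (q - p)"
    using primitive_increment_bounds[OF f, of p q] pq by (auto simp: I_def a_def b_def algebra_simps)
  have w: "0 < weight t p" "0 < weight t q" using pq by (auto intro: weight_pos)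
  have wd: "weight t q = weight t p + rate t * (q - p)" by (simp add: weight_def algebra_simps)
  have "flow t f y - flow t f x = weight t q * b - weight t p * a - rate t * I"
    by (simp add: flow_def Let_def p_def q_def m_def a_def b_def I_def algebra_simps)
  also have "\<dots> \<ge> 0"
  proof (cases "0 \<le> rate t")
    case True
    then have "rate t * I \<le> rate t * (b * (q - p))" using I by (intro mult_left_mono)
    moreover have "weight t p * a \<le> weight t p * b" using ab w by (intro mult_left_mono) auto
    ultimately show ?thesis unfolding wd by (simp add: algebra_simps)
  next
    case False
    then have "rate t * I \<le> rate t * (a * (q - p))" using I by (intro mult_left_mono_neg) auto
    moreover have "weight t q * a \<le> weight t q * b" using ab w by (intro mult_left_mono) auto
    ultimately show ?thesis unfolding wd by (simp add: algebra_simps)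
  qed
  finally show "flow t f x \<le> flow t f y" by simp
qed

lemma nn_integral_U: "(\<integral>\<^sup>+x. f x \<partial>U) = (\<integral>\<^sup>+x. f x * indicator {0<..<1} x \<partial>lborel)"
  unfolding U_def by (subst nn_integral_restrict_space) auto

lemma nn_integral_moebius:
  fixes f :: "real \<Rightarrow> real"
  assumes f: "f \<in> borel_measurable U"
  shows "(\<integral>\<^sup>+x. ennreal (f x) \<partial>U) = (\<integral>\<^sup>+p. ennreal (f (moebius t p) * (1 / (weight t p)\<^sup>2)) \<partial>U)"
proof -
  let ?f = "\<lambda>x. f x * indicator {0<..<1} x"
  have "?f \<in> borel_measurable borel"
    using f unfolding U_def by (subst (asm) borel_measurable_restrict_space_iff) (auto simp: mult.commute)
  then have m: "set_borel_measurable borel {moebius t 0..moebius t 1} ?f"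
    unfolding set_borel_measurable_def by (intro borel_measurable_scaleR borel_measurable_indicator) auto
  have c: "continuous_on {0..1} (\<lambda>p. 1 / (weight t p)\<^sup>2)"
    unfolding weight_def using weight_pos[of _ t] 
    by (intro continuous_intros) (auto simp: weight_def less_le)
  have "(\<integral>\<^sup>+x. ennreal (f x) \<partial>U) = (\<integral>\<^sup>+x. ennreal (?f x) * indicator {moebius t 0..moebius t 1} x \<partial>lborel)"
    unfolding nn_integral_U by (intro nn_integral_cong) (auto simp: indicator_def)
  also have "(\<integral>\<^sup>+x. ennreal (?f x * indicator {moebius t 0..moebius t 1} x) \<partial>lborel) =
    (\<integral>\<^sup>+p. ennreal (?f (moebius t p) * (1 / (weight t p)\<^sup>2) * indicator {0..1} p) \<partial>lborel)"
    using m c by (intro nn_integral_substitution moebius_has_derivative) auto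
  then have "(\<integral>\<^sup>+x. ennreal (?f x) * indicator {moebius t 0..moebius t 1} x \<partial>lborel) =
    (\<integral>\<^sup>+p. ennreal (?f (moebius t p) * (1 / (weight t p)\<^sup>2) * indicator {0..1} p) \<partial>lborel)"
    by (simp add: ennreal_mult'' ennreal_indicator)
  also have "\<dots> = (\<integral>\<^sup>+p. ennreal (f (moebius t p) * (1 / (weight t p)\<^sup>2)) \<partial>U)"
    unfolding nn_integral_U
  proof (intro nn_integral_cong)
    fix p :: real
    consider "p \<in> {0<..<1}" | "p = 0" | "p = 1" | "p \<notin> {0..1}" by fastforce
    then show "ennreal (?f (moebius t p) * (1 / (weight t p)\<^sup>2) * indicator {0..1} p) =
        ennreal (f (moebius t p) * (1 / (weight t p)\<^sup>2)) * indicator {0<..<1} p"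
      by cases (use moebius_01[of p t] in \<open>auto simp: indicator_def\<close>)
  qed
  finally show ?thesis .
qed

lemma primitive_C1:
  assumes "\<And>x. 0 \<le> x \<Longrightarrow> x \<le> 1 \<Longrightarrow> (F has_real_derivative f x) (at x)" "0 \<le> p" "p \<le> 1"
  shows "primitive f p = F p - F 0"
proof -
  have "(f has_integral (F p - F 0)) {0..p}"
    using assms by (intro fundamental_theorem_of_calculus)
      (auto simp: has_real_derivative_iff_has_vector_derivative[symmetric] intro: has_field_derivative_at_within)
  then show ?thesis by (simp add: primitive_def integral_unique)
qed

text \<open>After the substitution \<open>x = moebius t p\<close>, the difference of the two integrands is an exact derivative of an
  expression in the primitive \<open>H\<close> of the centred function, and \<open>H\<close> vanishes at both ends. As \<open>H\<close> is differentiable only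
  almost everywhere, the exact derivatives are integrated by parts.\<close>

lemma flow_norm:
  assumes d: "d \<in> L2" and [measurable]: "flow t d \<in> borel_measurable U"
  shows "flow t d \<in> L2" "ip (flow t d) (flow t d) = ip d d"
proof -
  define m where "m = primitive d 1"
  define a where "a = (\<lambda>p. d p - m)"
  define H where "H = primitive a"
  define \<psi> where "\<psi> = (\<lambda>p. 1 / weight t p)"
  define b where "b = (\<lambda>p. - rate t * (\<psi> p)\<^sup>2)"
  let ?k = "rate t"
  have aL: "a \<in> L2" unfolding a_def using d by (intro L2_diff L2_const)
  have ai: "integrable U a" using aL by (rule integrable_L2)
  have H: "H p = primitive d p - m * p" if "p \<in> {0..1}" for p
    unfolding H_def a_def using that d by (subst primitive_diff) (auto simp: primitive_const integrable_L2)
  have H1: "H 1 = 0" using H[of 1] by (simp add: m_def)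
  have cw: "continuous_on {0..1} (weight t)" unfolding weight_def by (intro continuous_intros)
  have wnz: "weight t p \<noteq> 0" if "p \<in> {0..1}" for p using weight_pos[of p t] that by auto
  have c\<psi>: "continuous_on {0..1} \<psi>" unfolding \<psi>_def using wnz by (intro continuous_intros cw) auto
  have cb: "continuous_on {0..1} b" unfolding b_def by (intro continuous_intros c\<psi>)
  have bi: "integrable U b" using cb by (rule integrable_continuous_U)
  have cH: "continuous_on {0..1} H" unfolding H_def using ai by (rule continuous_on_primitive)
  have \<psi>b: "primitive b p = \<psi> p - \<psi> 0" if "p \<in> {0..1}" for p
  proof (rule primitive_C1)
    fix x :: real assume "0 \<le> x" "x \<le> 1"
    then have "weight t x \<noteq> 0" using wnz by auto
    moreover have "(weight t has_real_derivative ?k) (at x)"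
      unfolding weight_def by (auto intro!: derivative_eq_intros)
    ultimately show "(\<psi> has_real_derivative b x) (at x)"
      unfolding \<psi>_def b_def by (auto intro!: derivative_eq_intros simp: power2_eq_square)
  qed (use that in auto)
  \<comment> \<open>the derivative of \<open>H\<^sup>2\<close>\<close>
  define c where "c = (\<lambda>p. 2 * (a p * H p))"
  have ci: "integrable U c" unfolding c_def using ai cH by (intro integrable_mult_right integrable_mult_continuous)
  have Hc: "primitive c p = (H p)\<^sup>2" if "p \<in> {0..1}" for p
    using primitive_by_parts[OF ai ai that] by (simp add: H_def c_def power2_eq_square mult.commute)
  \<comment> \<open>the integrand is the derivative of \<open>primitive e * \<psi>\<close>, as \<open>b\<close> is the derivative of \<open>\<psi>\<close>\<close>
  have vanish: "integrable U (\<lambda>p. e p * \<psi> p + primitive e p * b p)" 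
      "(\<integral>p. e p * \<psi> p + primitive e p * b p \<partial>U) = 0" if e: "integrable U e" "primitive e 1 = 0" for e
  proof -
    have i1: "integrable U (\<lambda>p. e p * primitive b p + primitive e p * b p)"
      using e integrable_mult_continuous[OF bi continuous_on_primitive[OF e(1)]] integrable_mult_continuous[OF e(1) continuous_on_primitive[OF bi]]
      by (simp add: mult.commute)
    have "e p * \<psi> p + primitive e p * b p = (e p * primitive b p + primitive e p * b p) + \<psi> 0 * e p" if "p \<in> space U" for p
    proof -
      have *: "\<psi> p = primitive b p + \<psi> 0" using that \<psi>b[of p] by simp
      show ?thesis unfolding * by (simp add: algebra_simps)
    qed
    then have cong: "integrable U (\<lambda>p. e p * \<psi> p + primitive e p * b p) \<longleftrightarrow> integrable U (\<lambda>p. (e p * primitive b p + primitive e p * b p) + \<psi> 0 * e p)"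
      "(\<integral>p. e p * \<psi> p + primitive e p * b p \<partial>U) = (\<integral>p. (e p * primitive b p + primitive e p * b p) + \<psi> 0 * e p \<partial>U)"
      by (auto intro!: Bochner_Integration.integrable_cong Bochner_Integration.integral_cong)
    show "integrable U (\<lambda>p. e p * \<psi> p + primitive e p * b p)" unfolding cong using i1 e by simp
    have "(\<integral>p. (e p * primitive b p + primitive e p * b p) + \<psi> 0 * e p \<partial>U)
      = (\<integral>p. e p * primitive b p + primitive e p * b p \<partial>U) + \<psi> 0 * (\<integral>p. e p \<partial>U)"
      using i1 e by simp
    also have "\<dots> = 0" using integral_by_parts[OF e(1) bi] e by (simp add: primitive_1_integral)
    finally show "(\<integral>p. e p * \<psi> p + primitive e p * b p \<partial>U) = 0" unfolding cong .
  qed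
  have a1: "primitive a 1 = 0" using H1 by (simp add: H_def)
  have c1: "primitive c 1 = 0" using Hc[of 1] H1 by simp
  have \<psi>2: "integrable U (\<lambda>p. (\<psi> p)\<^sup>2)" "(\<integral>p. (\<psi> p)\<^sup>2 \<partial>U) = 1"
  proof -
    show i: "integrable U (\<lambda>p. (\<psi> p)\<^sup>2)" by (intro integrable_continuous_U continuous_intros c\<psi>)
    have "primitive (\<lambda>p. (\<psi> p)\<^sup>2) 1 = moebius t 1 - moebius t 0"
      by (rule primitive_C1) (use moebius_has_derivative[of _ t] in \<open>auto simp: \<psi>_def power_one_over\<close>)
    then show "(\<integral>p. (\<psi> p)\<^sup>2 \<partial>U) = 1" using i by (simp add: primitive_1_integral)
  qed
  have a2: "integrable U (\<lambda>p. (a p)\<^sup>2)" using aL by (simp add: L2_def)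
  \<comment> \<open>the transformed integrand, with the two exact derivatives displayed\<close>
  let ?Q = "\<lambda>p. m\<^sup>2 * (\<psi> p)\<^sup>2 + 2 * m * (a p * \<psi> p + primitive a p * b p) + (a p)\<^sup>2
      - ?k * (c p * \<psi> p + primitive c p * b p)"
  have Qi: "integrable U ?Q" using vanish[OF ai a1] vanish[OF ci c1] \<psi>2 a2 by simp
  have QI: "(\<integral>p. ?Q p \<partial>U) = m\<^sup>2 + (\<integral>p. (a p)\<^sup>2 \<partial>U)"
    using vanish[OF ai a1] vanish[OF ci c1] \<psi>2 a2 by simp
  have Q: "(flow t d (moebius t p))\<^sup>2 * (1 / (weight t p)\<^sup>2) = ?Q p" if p: "p \<in> space U" for p
  proof -
    have w: "weight t p * \<psi> p = 1" using wnz[of p] p by (simp add: \<psi>_def)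
    have "flow t d (moebius t p) * \<psi> p = m * \<psi> p + (weight t p * \<psi> p) * a p - ?k * H p * \<psi> p"
    proof -
      have H': "primitive d p = H p + m * p" using p H[of p] by simp
      have "p \<in> {0..1}" using p by simp
      then show ?thesis unfolding flow_moebius[OF \<open>p \<in> {0..1}\<close>] m_def[symmetric] H' a_def
        by (simp add: algebra_simps)
    qed
    also have "\<dots> = m * \<psi> p + a p - ?k * H p * \<psi> p" by (simp add: w)
    finally have "(flow t d (moebius t p) * \<psi> p)\<^sup>2 = (m * \<psi> p + a p - ?k * H p * \<psi> p)\<^sup>2" by simp
    also have "\<dots> = ?Q p" using p Hc[of p]
      by (simp add: H_def[symmetric] c_def b_def power2_eq_square algebra_simps)
    finally show ?thesis by (simp add: \<psi>_def power_divide)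
  qed
  have Qnn: "0 \<le> ?Q p" if "p \<in> space U" for p unfolding Q[OF that, symmetric] by simp
  have "(\<integral>\<^sup>+x. ennreal ((flow t d x)\<^sup>2) \<partial>U) = (\<integral>\<^sup>+p. ennreal ((flow t d (moebius t p))\<^sup>2 * (1 / (weight t p)\<^sup>2)) \<partial>U)"
    by (rule nn_integral_moebius) measurable
  also have "\<dots> = (\<integral>\<^sup>+p. ennreal (?Q p) \<partial>U)" by (intro nn_integral_cong arg_cong[of _ _ ennreal] Q)
  also have "\<dots> = ennreal (\<integral>p. ?Q p \<partial>U)" using Qi Qnn by (intro nn_integral_eq_integral AE_I2)
  finally have nn: "(\<integral>\<^sup>+x. ennreal ((flow t d x)\<^sup>2) \<partial>U) = ennreal (\<integral>p. ?Q p \<partial>U)" .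
  have Q0: "0 \<le> (\<integral>p. ?Q p \<partial>U)" using Qnn by (rule Bochner_Integration.integral_nonneg_AE[OF AE_I2])
  show fL: "flow t d \<in> L2" using nn by (subst L2_iff_nn_integral) auto
  have "ip (flow t d) (flow t d) = (\<integral>p. ?Q p \<partial>U)"
    using nn Q0 unfolding ip_def power2_eq_square[symmetric]
    by (intro integral_eq_nn_integral[THEN trans]) auto
  also have "\<dots> = m\<^sup>2 + (\<integral>p. (a p)\<^sup>2 \<partial>U)" by (rule QI)
  also have "\<dots> = ip d d"
  proof -
    have "ip d d = (\<integral>p. (a p)\<^sup>2 + 2 * m * a p + m\<^sup>2 \<partial>U)"
      by (simp add: ip_def a_def power2_eq_square algebra_simps)
    also have "\<dots> = (\<integral>p. (a p)\<^sup>2 \<partial>U) + 2 * m * primitive a 1 + m\<^sup>2"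
      using a2 ai U.prob_space by (simp add: primitive_1_integral)
    finally show ?thesis by (simp add: a1)
  qed
  finally show "ip (flow t d) (flow t d) = ip d d" .
qed

lemma flow_mono_L2: assumes "f \<in> mono_L2" shows "flow t f \<in> mono_L2"
  using flow_norm(1)[OF mono_L2_L2[OF assms] mono_measurable_U[OF flow_mono[OF assms]]] flow_mono[OF assms]
  by (simp add: mono_L2_def)

text \<open>The formula is linear, so the previous lemma applies to the difference of two quantile functions.\<close>

lemma flow_isometric:
  assumes f: "f \<in> mono_L2" and g: "g \<in> mono_L2"
  shows "dW2 (law (flow t f)) (law (flow t g)) = dW2 (law f) (law g)"
proof -
  let ?d = "\<lambda>x. f x - g x"
  have d: "?d \<in> L2" using f g by (simp add: ip_linear)
  have VL: "(\<lambda>x. flow t f x - flow t g x) \<in> L2" using flow_mono_L2[OF f] flow_mono_L2[OF g] by (simp add: ip_linear)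
  have eq: "flow t ?d x = flow t f x - flow t g x" if "x \<in> space U" for x
    using that f g by (intro flow_diff) (auto simp: mono_L2_L2)
  have "flow t ?d \<in> borel_measurable U" using VL measurable_cong[of U _ _ borel, OF eq] by (simp add: L2_def)
  from flow_norm(2)[OF d this] have "ip (\<lambda>x. flow t f x - flow t g x) (\<lambda>x. flow t f x - flow t g x) = ip ?d ?d"
    unfolding ip_def using eq by (metis (no_types, lifting) Bochner_Integration.integral_cong)
  then show ?thesis
    by (simp add: dW2_law f g flow_mono_L2 ip_def power2_eq_square)
qed

lemma flow_0: "x \<in> {0<..<1} \<Longrightarrow> flow 0 f x = f x"
  by (simp add: flow_def Let_def moebius_def weight_def rate_def)

lemma flow_isCont_0:
  assumes f: "f \<in> L2" and x: "x \<in> {0<..<1}" and c: "isCont f x"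
  shows "isCont (\<lambda>t. flow t f x) 0"
proof -
  have m0: "moebius (- 0) x = x" by (simp add: moebius_def weight_def rate_def)
  have w: "weight (- 0) x \<noteq> 0" by (simp add: weight_def rate_def)
  have cm: "isCont (\<lambda>t. moebius (- t) x) 0"
    unfolding moebius_def using w unfolding weight_def rate_def by (intro continuous_intros) auto
  have cf: "isCont (\<lambda>t. f (moebius (- t) x)) 0"
    using isCont_o2[OF cm, of f] c by (simp add: m0[simplified])
  have "isCont (primitive f) x"
    using continuous_on_primitive[OF integrable_L2[OF f]] x continuous_on_interior[of "{0..1}" "primitive f" x] by simp
  then have cp: "isCont (\<lambda>t. primitive f (moebius (- t) x)) 0"
    using isCont_o2[OF cm, of "primitive f"] by (simp add: m0[simplified])
  show ?thesis unfolding flow_def Let_def weight_def rate_def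
    by (intro continuous_intros cm cf cp) auto
qed

text \<open>The functions converge pointwise at every continuity point, and their norms are constant. Scheffe's lemma
  for the squares controls the excess of \<open>(F n - f)\<^sup>2\<close> over a dominated function.\<close>

lemma flow_strongly_continuous:
  assumes f: "f \<in> mono_L2"
  shows "((\<lambda>t. dW2 (law (flow t f)) (law f)) \<longlongrightarrow> 0) (at 0)"
  unfolding tendsto_at_iff_sequentially
proof (intro allI impI)
  fix X :: "nat \<Rightarrow> real" assume "\<forall>i. X i \<in> UNIV - {0}" and X: "X \<longlonglongrightarrow> 0"
  define F where "F n = flow (X n) f" for n
  have fL: "f \<in> L2" using f by (rule mono_L2_L2)
  have F: "F n \<in> mono_L2" for n unfolding F_def using f by (rule flow_mono_L2)
  have FL: "F n \<in> L2" for n using F by (rule mono_L2_L2)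
  have [measurable]: "f \<in> borel_measurable U" "F n \<in> borel_measurable U" for n
    using fL FL by (auto simp: L2_def)
  have "AE x in U. x \<notin> {a\<in>{0<..<1}. \<not> isCont f a}"
    using f by (intro countable_AE_U mono_countable_discont) (simp add: mono_L2_def)
  then have lim: "AE x in U. (\<lambda>n. F n x) \<longlonglongrightarrow> f x"
    using AE_space
  proof eventually_elim
    case (elim x)
    then have "isCont (\<lambda>t. flow t f x) 0" using fL by (intro flow_isCont_0) auto
    then have "(\<lambda>n. flow (X n) f x) \<longlonglongrightarrow> flow 0 f x" using X by (rule isCont_tendsto_compose)
    then show ?case using elim by (simp add: F_def flow_0)
  qed
  have f2: "integrable U (\<lambda>x. (f x)\<^sup>2)" and F2: "integrable U (\<lambda>x. (F n x)\<^sup>2)" for n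
    using fL FL by (auto simp: L2_def)
  have norm: "(\<integral>x. (F n x)\<^sup>2 \<partial>U) = (\<integral>x. (f x)\<^sup>2 \<partial>U)" for n
    using flow_norm(2)[OF fL, of "X n"] FL[of n] by (simp add: F_def L2_def ip_def power2_eq_square)
  have "(\<lambda>n. \<integral>\<^sup>+x. norm ((F n x)\<^sup>2 - (f x)\<^sup>2) \<partial>U) \<longlonglongrightarrow> 0"
  proof (rule Scheffe_lemma2)
    show "AE x in U. (\<lambda>n. (F n x)\<^sup>2) \<longlonglongrightarrow> (f x)\<^sup>2"
      using lim by eventually_elim (intro tendsto_intros)
    show "(\<integral>\<^sup>+x. norm ((F n x)\<^sup>2) \<partial>U) \<le> (\<integral>\<^sup>+x. norm ((f x)\<^sup>2) \<partial>U)" for n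
      using f2 F2[of n] norm[of n] by (simp add: nn_integral_eq_integral)
  qed (use f2 in auto)
  moreover have "(\<integral>\<^sup>+x. norm ((F n x)\<^sup>2 - (f x)\<^sup>2) \<partial>U) = ennreal (\<integral>x. \<bar>(F n x)\<^sup>2 - (f x)\<^sup>2\<bar> \<partial>U)" for n
    using f2 F2[of n] by (subst nn_integral_eq_integral) auto
  ultimately have L1: "(\<lambda>n. \<integral>x. \<bar>(F n x)\<^sup>2 - (f x)\<^sup>2\<bar> \<partial>U) \<longlonglongrightarrow> 0"
    by (simp add: tendsto_ennreal_iff[of _ _ 0, simplified])
  \<comment> \<open>\<open>(F n - f)\<^sup>2 \<le> 2 (F n)\<^sup>2 + 2 f\<^sup>2\<close>, so this part is dominated by \<open>4 f\<^sup>2\<close>\<close>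
  define G where "G n x = max 0 ((F n x - f x)\<^sup>2 - 2 * \<bar>(F n x)\<^sup>2 - (f x)\<^sup>2\<bar>)" for n x
  have Gm: "G n \<in> borel_measurable U" for n unfolding G_def by measurable
  have Gb: "0 \<le> G n x" "G n x \<le> 4 * (f x)\<^sup>2" for n x
  proof -
    show "0 \<le> G n x" by (simp add: G_def)
    have "(F n x - f x)\<^sup>2 \<le> 2 * (F n x)\<^sup>2 + 2 * (f x)\<^sup>2" using sq_add_le[of "F n x" "- f x"] by simp
    moreover have "(F n x)\<^sup>2 - (f x)\<^sup>2 \<le> \<bar>(F n x)\<^sup>2 - (f x)\<^sup>2\<bar>" by simp
    moreover have "u - 2 * z \<le> 4 * w" if "u \<le> 2 * v + 2 * w" "v - w \<le> z" for u v w z :: real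
      using that by linarith
    ultimately have "(F n x - f x)\<^sup>2 - 2 * \<bar>(F n x)\<^sup>2 - (f x)\<^sup>2\<bar> \<le> 4 * (f x)\<^sup>2" by blast
    then show "G n x \<le> 4 * (f x)\<^sup>2" by (simp add: G_def)
  qed
  have G0: "(\<lambda>n. \<integral>x. G n x \<partial>U) \<longlonglongrightarrow> (\<integral>x. 0 \<partial>U)"
  proof (rule integral_dominated_convergence[where w = "\<lambda>x. 4 * (f x)\<^sup>2"])
    show "AE x in U. (\<lambda>n. G n x) \<longlonglongrightarrow> 0"
      using lim
    proof eventually_elim
      case (elim x)
      have "(\<lambda>n. G n x) \<longlonglongrightarrow> max 0 ((f x - f x)\<^sup>2 - 2 * \<bar>(f x)\<^sup>2 - (f x)\<^sup>2\<bar>)"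
        unfolding G_def by (intro tendsto_intros elim)
      then show ?case by simp
    qed
  qed (use Gm Gb f2 in auto)
  have Gi: "integrable U (G n)" for n
    by (rule Bochner_Integration.integrable_bound[of U "\<lambda>x. 4 * (f x)\<^sup>2"]) (use Gm Gb f2 in auto)
  have bound: "(\<integral>x. (F n x - f x)\<^sup>2 \<partial>U) \<le> (\<integral>x. G n x \<partial>U) + 2 * (\<integral>x. \<bar>(F n x)\<^sup>2 - (f x)\<^sup>2\<bar> \<partial>U)" for n
  proof -
    have "(\<integral>x. (F n x - f x)\<^sup>2 \<partial>U) \<le> (\<integral>x. G n x + 2 * \<bar>(F n x)\<^sup>2 - (f x)\<^sup>2\<bar> \<partial>U)"
      using L2_diff[OF FL fL, of n] Gi f2 F2 
      by (intro integral_mono Bochner_Integration.integrable_add integrable_mult_right integrable_abs Bochner_Integration.integrable_diff)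
         (auto simp: L2_def G_def)
    then show ?thesis using Gi f2 F2 by simp
  qed
  have up: "(\<lambda>n. (\<integral>x. G n x \<partial>U) + 2 * (\<integral>x. \<bar>(F n x)\<^sup>2 - (f x)\<^sup>2\<bar> \<partial>U)) \<longlonglongrightarrow> 0"
    using tendsto_add[OF G0 tendsto_mult_left[OF L1, of 2]] by simp
  have "(\<lambda>n. \<integral>x. (F n x - f x)\<^sup>2 \<partial>U) \<longlonglongrightarrow> 0"
    by (rule real_tendsto_sandwich[OF _ _ tendsto_const up])
      (simp, intro always_eventually allI bound)
  then have "(\<lambda>n. sqrt (\<integral>x. (F n x - f x)\<^sup>2 \<partial>U)) \<longlonglongrightarrow> 0"
    using tendsto_real_sqrt[of _ 0] by simp
  then show "((\<lambda>t. dW2 (law (flow t f)) (law f)) \<circ> X) \<longlonglongrightarrow> 0"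
    using F f by (simp add: comp_def dW2_law F_def)
qed

section \<open>Groups of isometries\<close>

lemma isom_carrier_iff:
  "f \<in> carrier (isom_group S d) \<longleftrightarrow> f \<in> extensional S \<and> bij_betw f S S \<and> (\<forall>x\<in>S. \<forall>y\<in>S. d (f x) (f y) = d x y)"
  by (auto simp: isom_group_def Bij_def)

lemma isom_mult:
  "f \<in> carrier (isom_group S d) \<Longrightarrow> g \<in> carrier (isom_group S d) \<Longrightarrow> f \<otimes>\<^bsub>isom_group S d\<^esub> g = compose S f g"
  by (simp add: isom_group_def BijGroup_def)

lemma isom_one: "\<one>\<^bsub>isom_group S d\<^esub> = (\<lambda>x\<in>S. x)"
  by (simp add: isom_group_def BijGroup_def)

lemma group_isom_group: "group (isom_group S d)"
proof -
  let ?C = "{f \<in> Bij S. \<forall>x\<in>S. \<forall>y\<in>S. d (f x) (f y) = d x y}"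
  have "subgroup ?C (BijGroup S)"
  proof (rule group.subgroupI[OF group_BijGroup])
    show "?C \<subseteq> carrier (BijGroup S)" by (auto simp: BijGroup_def)
    have "(\<lambda>x\<in>S. x) \<in> ?C" by (auto simp: id_Bij)
    then show "?C \<noteq> {}" by blast
  next
    fix f assume f: "f \<in> ?C"
    then have img: "f ` S = S" and inv: "inv_into S f x \<in> S" "f (inv_into S f x) = x" if "x \<in> S" for x
      using that by (auto simp: Bij_def bij_betw_def intro: inv_into_into f_inv_into_f)
    have "inv\<^bsub>BijGroup S\<^esub> f = (\<lambda>x\<in>S. inv_into S f x)" using f by (intro inv_BijGroup) auto
    moreover have "d (inv_into S f x) (inv_into S f y) = d x y" if "x \<in> S" "y \<in> S" for x y
    proof -
      have "d (f (inv_into S f x)) (f (inv_into S f y)) = d (inv_into S f x) (inv_into S f y)"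
        using f inv that by blast
      then show ?thesis using inv that by simp
    qed
    ultimately show "inv\<^bsub>BijGroup S\<^esub> f \<in> ?C" using f by (auto intro!: restrict_inv_into_Bij)
  next
    fix f g assume fg: "f \<in> ?C" "g \<in> ?C"
    then have "g x \<in> S" if "x \<in> S" for x using that Bij_imp_funcset by blast
    then show "f \<otimes>\<^bsub>BijGroup S\<^esub> g \<in> ?C"
      using fg by (simp add: BijGroup_def compose_Bij) (simp add: compose_def)
  qed
  from group.subgroup_imp_group[OF group_BijGroup this] show ?thesis by (simp add: isom_group_def)
qed

lemma isom_closed: "f \<in> carrier (isom_group S d) \<Longrightarrow> x \<in> S \<Longrightarrow> f x \<in> S"
  by (auto simp: isom_carrier_iff bij_betw_def)

lemma isom_inv_apply:
  assumes "f \<in> carrier (isom_group S d)" "x \<in> S"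
  shows "f ((inv\<^bsub>isom_group S d\<^esub> f) x) = x" "(inv\<^bsub>isom_group S d\<^esub> f) (f x) = x"
proof -
  interpret group "isom_group S d" by (rule group_isom_group)
  have i: "inv\<^bsub>isom_group S d\<^esub> f \<in> carrier (isom_group S d)" using assms by simp
  have "compose S f (inv\<^bsub>isom_group S d\<^esub> f) = (\<lambda>x\<in>S. x)" "compose S (inv\<^bsub>isom_group S d\<^esub> f) f = (\<lambda>x\<in>S. x)"
    using assms i r_inv[of f] l_inv[of f] by (simp_all add: isom_mult isom_one)
  then show "f ((inv\<^bsub>isom_group S d\<^esub> f) x) = x" "(inv\<^bsub>isom_group S d\<^esub> f) (f x) = x"
    using assms by (auto simp: compose_def fun_eq_iff split: if_splits)
qed

section \<open>The isometry group of the line\<close>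

text \<open>After subtracting its value at 0 the map preserves products, by polarisation; so it is multiplication by its
  value at 1, whose square is 1.\<close>

lemma real_isometry_affine:
  fixes f :: "real \<Rightarrow> real"
  assumes "\<And>x y. dist (f x) (f y) = dist x y"
  obtains e v where "e \<in> {1, -1}" "f = affine_map (e, v)"
proof -
  define g where "g x = f x - f 0" for x
  have g: "\<bar>g x - g y\<bar> = \<bar>x - y\<bar>" for x y using assms[of x y] by (simp add: g_def dist_real_def)
  have g0: "g 0 = 0" by (simp add: g_def)
  have sq: "(g x - g y)\<^sup>2 = (x - y)\<^sup>2" for x y using g[of x y] by (metis power2_abs)
  have mult: "g x * g y = x * y" for x y
    using sq[of x y] sq[of x 0] sq[of y 0] by (simp add: g0 power2_diff)
  have e: "g 1 \<in> {1, -1}" using mult[of 1 1] by (simp add: square_eq_1_iff)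
  have "g x = g 1 * x" for x using mult[of x 1] e by auto
  then have "f = affine_map (g 1, f 0)" by (auto simp: fun_eq_iff affine_map_def g_def algebra_simps)
  then show thesis using e that by blast
qed

lemma affine_map_apply [simp]: "affine_map (e, v) x = e * x + v"
  by (simp add: affine_map_def)

lemma affine_map_inj_on: "inj_on affine_map A"
proof (rule inj_onI)
  fix c d assume "affine_map c = affine_map d"
  then have "affine_map c 0 = affine_map d 0" "affine_map c 1 = affine_map d 1" by auto
  then show "c = d" by (cases c; cases d) auto
qed

lemma affine_map_Isom:
  assumes "e \<in> {1, -1}" shows "affine_map (e, v) \<in> carrier (Isom :: (real \<Rightarrow> real) monoid)"
proof -
  have "bij (affine_map (e, v))"
    by (rule o_bij[of "affine_map (e, - e * v)"]) (use assms in \<open>auto simp: fun_eq_iff algebra_simps\<close>)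
  then show ?thesis using assms by (auto simp: isom_carrier_iff dist_real_def)
qed

lemma carrier_Isom_eq: "carrier (Isom :: (real \<Rightarrow> real) monoid) = affine_map ` ({1, -1} \<times> UNIV)"
proof
  show "carrier Isom \<subseteq> affine_map ` ({1, -1} \<times> UNIV)"
  proof
    fix f :: "real \<Rightarrow> real" assume "f \<in> carrier Isom"
    then have "\<And>x y. dist (f x) (f y) = dist x y" by (simp add: isom_carrier_iff)
    then show "f \<in> affine_map ` ({1, -1} \<times> UNIV)" by (rule real_isometry_affine) blast
  qed
qed (use affine_map_Isom in blast)

lemma IsomE:
  assumes "\<phi> \<in> carrier (Isom :: (real \<Rightarrow> real) monoid)"
  obtains e v where "e = 1 \<or> e = -1" "\<phi> = affine_map (e, v)"
  using assms unfolding carrier_Isom_eq by blast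

lemma IsomE':
  assumes "\<phi> \<in> carrier (Isom :: (real \<Rightarrow> real) monoid)"
  obtains e v where "e \<in> {1, -1}" "\<phi> = affine_map (e, v)"
  using assms unfolding carrier_Isom_eq by blast

lemma Isom_mult:
  "\<phi> \<in> carrier Isom \<Longrightarrow> \<psi> \<in> carrier Isom \<Longrightarrow> \<phi> \<otimes>\<^bsub>Isom\<^esub> \<psi> = \<phi> \<circ> (\<psi> :: real \<Rightarrow> real)"
  by (auto simp: isom_mult compose_def fun_eq_iff)

lemma affine_map_comp: "affine_map (e, v) \<circ> affine_map (e', v') = affine_map (e * e', v + e * v')"
  by (auto simp: fun_eq_iff algebra_simps)

lemma affine_map_mult:
  "e \<in> {1, -1} \<Longrightarrow> e' \<in> {1, -1} \<Longrightarrow>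
    affine_map (e, v) \<otimes>\<^bsub>Isom\<^esub> affine_map (e', v') = affine_map (e * e', v + e * v')"
  by (simp add: Isom_mult affine_map_Isom affine_map_comp del: insert_iff)

lemma affine_map_iso:
  "affine_map \<in> iso (semidirect_product sign_group real_additive_group (\<lambda>\<epsilon> v. \<epsilon> * v)) (Isom :: (real \<Rightarrow> real) monoid)"
proof -
  have c: "carrier (semidirect_product sign_group real_additive_group (\<lambda>\<epsilon> v. \<epsilon> * v)) = {1, -1} \<times> UNIV"
    by (simp add: semidirect_product_def sign_group_def real_additive_group_def)
  have "affine_map (x \<otimes>\<^bsub>semidirect_product sign_group real_additive_group (\<lambda>\<epsilon> v. \<epsilon> * v)\<^esub> y)
      = affine_map x \<otimes>\<^bsub>Isom\<^esub> affine_map y" if "x \<in> {1, -1} \<times> UNIV" "y \<in> {1, -1} \<times> UNIV" for x y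
  proof -
    obtain e v e' v' where "x = (e, v)" "y = (e', v')" "e \<in> {1, -1}" "e' \<in> {1, -1}" using \<open>x \<in> _\<close> \<open>y \<in> _\<close> by blast
    then show ?thesis
      by (simp add: affine_map_mult semidirect_product_def sign_group_def real_additive_group_def del: insert_iff)
  qed
  then show ?thesis
    unfolding iso_def hom_def c bij_betw_def carrier_Isom_eq by (auto simp: affine_map_inj_on)
qed

lemma isom_coords_affine_map: "e \<in> {1, -1} \<Longrightarrow> isom_coords (affine_map (e, v)) = (e, v)"
  unfolding isom_coords_def by (rule inv_into_f_f[OF affine_map_inj_on]) auto

lemma isom_action_affine_map:
  "e \<in> {1, -1} \<Longrightarrow> e' \<in> {1, -1} \<Longrightarrow> isom_action (affine_map (e, v)) (affine_map (e', t)) = affine_map (e', e * t)"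
  unfolding isom_action_def
  by (simp add: affine_map_Isom isom_coords_affine_map del: insert_iff)

lemma isom_action_closed:
  assumes "\<phi> \<in> carrier Isom" "\<psi> \<in> carrier Isom" shows "isom_action \<phi> \<psi> \<in> carrier Isom"
proof -
  obtain e v where \<phi>: "e = 1 \<or> e = -1" "\<phi> = affine_map (e, v)" using assms(1) by (rule IsomE)
  obtain e' v' where \<psi>: "e' = 1 \<or> e' = -1" "\<psi> = affine_map (e', v')" using assms(2) by (rule IsomE)
  show ?thesis using \<phi>(1) \<psi>(1) unfolding \<phi> \<psi> by (subst isom_action_affine_map) (auto intro: affine_map_Isom)
qed

text \<open>The automorphism attached to an isometry of the line is an involution, since \<open>e * e = 1\<close>; this gives bijectivity.\<close>

lemma isom_action_auto:
  assumes "\<phi> \<in> carrier Isom" shows "isom_action \<phi> \<in> auto Isom"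
proof -
  obtain e v where e: "e \<in> {1, -1}" and \<phi>: "\<phi> = affine_map (e, v)" using assms by (rule IsomE')
  have "isom_action \<phi> (\<psi> \<otimes>\<^bsub>Isom\<^esub> \<psi>') = isom_action \<phi> \<psi> \<otimes>\<^bsub>Isom\<^esub> isom_action \<phi> \<psi>'"
    if "\<psi> \<in> carrier Isom" "\<psi>' \<in> carrier Isom" for \<psi> \<psi>'
  proof -
    obtain a b where a: "a \<in> {1, -1}" and \<psi>: "\<psi> = affine_map (a, b)" using \<open>\<psi> \<in> carrier Isom\<close> by (rule IsomE')
    obtain a' b' where a': "a' \<in> {1, -1}" and \<psi>': "\<psi>' = affine_map (a', b')" using \<open>\<psi>' \<in> carrier Isom\<close> by (rule IsomE')
    have aa: "a * a' \<in> {1, -1}" using a a' by auto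
    show ?thesis unfolding \<phi> \<psi> \<psi>'
      using e a a' aa by (simp add: isom_action_affine_map affine_map_mult del: insert_iff) (simp add: algebra_simps)
  qed
  then have hom: "isom_action \<phi> \<in> hom Isom Isom" using assms by (auto simp: hom_def isom_action_closed)
  have invol: "isom_action \<phi> (isom_action \<phi> \<psi>) = \<psi>" if "\<psi> \<in> carrier Isom" for \<psi>
  proof -
    obtain a b where a: "a \<in> {1, -1}" and \<psi>: "\<psi> = affine_map (a, b)" using \<open>\<psi> \<in> carrier Isom\<close> by (rule IsomE')
    have "e * (e * b) = b" using e by auto
    then show ?thesis unfolding \<phi> \<psi> by (simp only: isom_action_affine_map[OF e a])
  qed
  have "bij_betw (isom_action \<phi>) (carrier Isom) (carrier Isom)"
    by (rule bij_betw_byWitness[where f' = "isom_action \<phi>"]) (use invol isom_action_closed[OF assms] in auto)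
  moreover have "isom_action \<phi> \<in> extensional (carrier Isom)" by (simp add: isom_action_def)
  ultimately show ?thesis using hom by (simp add: auto_def Bij_def)
qed

lemma isom_action_hom: "isom_action \<in> hom Isom (AutoGroup Isom)"
proof (rule homI)
  show "isom_action \<phi> \<in> carrier (AutoGroup Isom)" if "\<phi> \<in> carrier Isom" for \<phi>
    using isom_action_auto[OF that] by (simp add: AutoGroup_def)
next
  fix \<phi> \<psi> :: "real \<Rightarrow> real" assume \<phi>\<psi>: "\<phi> \<in> carrier Isom" "\<psi> \<in> carrier Isom"
  obtain e v where e: "e \<in> {1, -1}" and \<phi>: "\<phi> = affine_map (e, v)" using \<phi>\<psi>(1) by (rule IsomE')
  obtain e' v' where e': "e' \<in> {1, -1}" and \<psi>: "\<psi> = affine_map (e', v')" using \<phi>\<psi>(2) by (rule IsomE')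
  have ee: "e * e' \<in> {1, -1}" using e e' by auto
  have "isom_action (\<phi> \<otimes>\<^bsub>Isom\<^esub> \<psi>) = compose (carrier Isom) (isom_action \<phi>) (isom_action \<psi>)"
  proof
    fix \<theta> :: "real \<Rightarrow> real"
    show "isom_action (\<phi> \<otimes>\<^bsub>Isom\<^esub> \<psi>) \<theta> = compose (carrier Isom) (isom_action \<phi>) (isom_action \<psi>) \<theta>"
    proof (cases "\<theta> \<in> carrier Isom")
      case True
      then obtain a b where a: "a \<in> {1, -1}" and \<theta>: "\<theta> = affine_map (a, b)" by (rule IsomE')
      show ?thesis using True unfolding compose_def \<phi> \<psi> \<theta>
        using e e' ee a by (simp add: isom_action_affine_map affine_map_mult mult.assoc del: insert_iff)
    next
      case False then show ?thesis by (simp add: isom_action_def compose_def)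
    qed
  qed
  then show "isom_action (\<phi> \<otimes>\<^bsub>Isom\<^esub> \<psi>) = isom_action \<phi> \<otimes>\<^bsub>AutoGroup Isom\<^esub> isom_action \<psi>"
    using isom_action_auto[OF \<phi>\<psi>(1)] isom_action_auto[OF \<phi>\<psi>(2)]
    by (simp add: AutoGroup_def BijGroup_def auto_def)
qed

section \<open>Isometries of the Wasserstein space\<close>

abbreviation (input) IW :: "(real measure \<Rightarrow> real measure) monoid" where "IW \<equiv> IsomW2"

interpretation IW: group IW by (rule group_isom_group)
interpretation IR: group "Isom :: (real \<Rightarrow> real) monoid" by (rule group_isom_group)

lemma IW_isometric: "\<Phi> \<in> carrier IW \<Longrightarrow> W2_isometric \<Phi>"
  by (auto simp: W2_isometric_def isom_carrier_iff bij_betw_def)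

lemma IW_surj: "\<Phi> \<in> carrier IW \<Longrightarrow> W2 \<subseteq> \<Phi> ` W2"
  by (auto simp: isom_carrier_iff bij_betw_def)

lemma IW_eqI: "\<Phi> \<in> carrier IW \<Longrightarrow> \<Psi> \<in> carrier IW \<Longrightarrow> (\<And>\<mu>. \<mu> \<in> W2 \<Longrightarrow> \<Phi> \<mu> = \<Psi> \<mu>) \<Longrightarrow> \<Phi> = \<Psi>"
  by (rule extensionalityI[of _ W2]) (auto simp: isom_carrier_iff)

lemma IW_mult: "\<Phi> \<in> carrier IW \<Longrightarrow> \<Psi> \<in> carrier IW \<Longrightarrow> \<mu> \<in> W2 \<Longrightarrow> (\<Phi> \<otimes>\<^bsub>IW\<^esub> \<Psi>) \<mu> = \<Phi> (\<Psi> \<mu>)"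
  by (simp add: isom_mult compose_def)

lemma IW_one: "\<mu> \<in> W2 \<Longrightarrow> \<one>\<^bsub>IW\<^esub> \<mu> = \<mu>"
  by (simp add: isom_one)

lemma restrict_IW:
  assumes \<Phi>: "W2_isometric \<Phi>" and surj: "W2 \<subseteq> \<Phi> ` W2"
  shows "restrict \<Phi> W2 \<in> carrier IW"
proof -
  have "bij_betw \<Phi> W2 W2"
    using \<Phi> surj W2_isometric_inj[OF \<Phi>] by (auto simp: bij_betw_def W2_isometric_def intro!: inj_onI)
  then show ?thesis using \<Phi> by (auto simp: isom_carrier_iff W2_isometric_def cong: bij_betw_cong)
qed

lemma dW2_return: "dW2 (return borel x) (return borel y) = \<bar>x - y\<bar>" for x y :: real
  using U.prob_space by (simp add: return_eq_law dW2_law mono_L2_const)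

lemma return_inj: "return borel x = return borel y \<longleftrightarrow> x = y" for x y :: real
  using dW2_eq_0_iff[OF return_W2[of x] return_W2[of y]] by (simp add: dW2_return)

text \<open>The characterisation of Dirac masses by distances is invariant under bijective isometries.\<close>

lemma isometry_preserves_diracs:
  assumes \<Phi>: "\<Phi> \<in> carrier IW"
  obtains \<phi> where "\<phi> \<in> carrier Isom" "\<And>x. \<Phi> (return borel x) = return borel (\<phi> x)"
proof -
  have d: "dW2 (\<Phi> \<mu>) (\<Phi> \<nu>) = dW2 \<mu> \<nu>" if "\<mu> \<in> W2" "\<nu> \<in> W2" for \<mu> \<nu>
    using \<Phi> that by (simp add: isom_carrier_iff)
  have "\<exists>y. \<Phi> (return borel x) = return borel y" for x
  proof -
    let ?\<mu> = "return borel x"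
    have \<mu>: "?\<mu> \<in> W2" by (rule return_W2)
    have "\<forall>\<nu>\<in>W2. \<exists>\<xi>\<in>W2. dW2 \<nu> \<xi> = dW2 (\<Phi> ?\<mu>) \<nu> \<and> dW2 (\<Phi> ?\<mu>) \<xi> = 2 * dW2 (\<Phi> ?\<mu>) \<nu>"
    proof
      fix \<nu> :: "real measure" assume "\<nu> \<in> W2"
      then obtain \<nu>' where \<nu>': "\<nu>' \<in> W2" "\<nu> = \<Phi> \<nu>'" using IW_surj[OF \<Phi>] by blast
      obtain \<xi> where \<xi>: "\<xi> \<in> W2" "dW2 \<nu>' \<xi> = dW2 ?\<mu> \<nu>'" "dW2 ?\<mu> \<xi> = 2 * dW2 ?\<mu> \<nu>'"
        using dirac_iff_extendible[OF \<mu>] \<nu>'(1) by blast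
      then show "\<exists>\<xi>\<in>W2. dW2 \<nu> \<xi> = dW2 (\<Phi> ?\<mu>) \<nu> \<and> dW2 (\<Phi> ?\<mu>) \<xi> = 2 * dW2 (\<Phi> ?\<mu>) \<nu>"
        using \<mu> \<nu>' isom_closed[OF \<Phi>] by (intro bexI[of _ "\<Phi> \<xi>"]) (auto simp: d)
    qed
    then show ?thesis using dirac_iff_extendible[OF isom_closed[OF \<Phi> \<mu>]] by blast
  qed
  then obtain \<phi> where \<phi>: "\<Phi> (return borel x) = return borel (\<phi> x)" for x by metis
  have "dist (\<phi> x) (\<phi> y) = dist x y" for x y
    using d[OF return_W2 return_W2, of x y] by (simp add: \<phi> dW2_return dist_real_def)
  then have "\<phi> \<in> carrier Isom" by (rule real_isometry_affine) (auto intro: affine_map_Isom)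
  then show thesis using \<phi> that by blast
qed

section \<open>Push-forwards\<close>

lemma measurable_reflect_U: "(\<lambda>x. 1 - x) \<in> measurable U U"
proof -
  have "(\<lambda>x. 1 - x) \<in> borel_measurable U" by (rule borel_measurable_U) measurable
  then have "(\<lambda>x. 1 - x) \<in> measurable U (restrict_space borel {0<..<1})"
    by (intro measurable_restrict_space2) auto
  then show ?thesis using measurable_cong_sets[OF refl sets_U] by blast
qed

lemma distr_reflect_U: "distr U U (\<lambda>x. 1 - x) = U"
proof (rule measure_eqI)
  fix A assume "A \<in> sets (distr U U (\<lambda>x. 1 - x))"
  then have A: "A \<in> sets U" by simp
  then have "A \<in> sets (restrict_space borel {0<..<1})" by (simp add: sets_U)
  then have AB: "A \<in> sets borel" "A \<subseteq> {0<..<1}" by (auto simp: sets_restrict_space_iff)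
  note m = measurable_reflect_U
  have "emeasure (distr U U (\<lambda>x. 1 - x)) A = emeasure U ((\<lambda>x. 1 - x) -` A \<inter> space U)"
    using m A by (rule emeasure_distr)
  also have "\<dots> = (\<integral>\<^sup>+x. indicator ((\<lambda>x. 1 - x) -` A \<inter> space U) x \<partial>U)"
    using measurable_sets[OF m A] by simp
  also have "\<dots> = (\<integral>\<^sup>+x. indicator A (1 + (-1) * x) \<partial>lborel)"
    unfolding nn_integral_U using AB by (intro nn_integral_cong) (auto simp: indicator_def)
  also have "\<dots> = (\<integral>\<^sup>+x. indicator A x \<partial>lborel)"
    using nn_integral_real_affine[of "indicator A" "-1" 1] AB by simp
  also have "\<dots> = emeasure U A"
    using AB by (simp add: U_def emeasure_restrict_space)
  finally show "emeasure (distr U U (\<lambda>x. 1 - x)) A = emeasure U A" .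
qed simp

lemma law_reflect: "f \<in> borel_measurable U \<Longrightarrow> law (\<lambda>x. f (1 - x)) = law f"
  using distr_distr[OF _ measurable_reflect_U, of f borel] by (simp add: law_def distr_reflect_U comp_def)

lemma integral_reflect: "f \<in> borel_measurable U \<Longrightarrow> (\<integral>x. f (1 - x) \<partial>U) = (\<integral>x. f x \<partial>U)" for f :: "real \<Rightarrow> real"
  using integral_distr[OF measurable_reflect_U, of f] by (simp add: distr_reflect_U)

lemma integrable_reflect: "integrable U f \<Longrightarrow> integrable U (\<lambda>x. f (1 - x))" for f :: "real \<Rightarrow> real"
  using integrable_distr[OF measurable_reflect_U, of f] by (simp add: distr_reflect_U)

text \<open>A quantile function of the push-forward along \<open>x \<mapsto> e * x + v\<close>: for \<open>e = -1\<close> the unit interval is reversed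
  so that the function is again nondecreasing.\<close>

definition affine_quantile :: "real \<Rightarrow> real \<Rightarrow> (real \<Rightarrow> real) \<Rightarrow> real \<Rightarrow> real" where
  "affine_quantile e v f = (\<lambda>x. e * f (if e = -1 then 1 - x else x) + v)"

lemma affine_quantile_mono_L2:
  assumes f: "f \<in> mono_L2" and e: "e = 1 \<or> e = -1" shows "affine_quantile e v f \<in> mono_L2"
proof -
  have [measurable]: "f \<in> borel_measurable U" using f by (simp add: mono_L2_def L2_def)
  have "(\<lambda>x. - f (1 - x)) \<in> mono_L2"
  proof -
    have "mono_on {0<..<1} (\<lambda>x. - f (1 - x))"
      using f by (auto simp: mono_L2_def mono_on_def)
    moreover have "(\<lambda>x. - f (1 - x)) \<in> L2"
      using f integrable_reflect[of "\<lambda>x. (f x)\<^sup>2"] mono_measurable_U[OF calculation] by (simp add: mono_L2_def L2_def)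
    ultimately show ?thesis by (simp add: mono_L2_def)
  qed
  then have "(\<lambda>x. - f (1 - x) + v) \<in> mono_L2" by (intro mono_L2_add mono_L2_const)
  moreover have "(\<lambda>x. f x + v) \<in> mono_L2" using f by (intro mono_L2_add mono_L2_const)
  ultimately show ?thesis using e by (auto simp: affine_quantile_def)
qed

lemma push_law:
  assumes f: "f \<in> mono_L2" and e: "e = 1 \<or> e = -1"
  shows "push (affine_map (e, v)) (law f) = law (affine_quantile e v f)"
proof -
  have [measurable]: "f \<in> borel_measurable U" using f by (simp add: mono_L2_def L2_def)
  have "push (affine_map (e, v)) (law f) = distr (law f) borel (affine_map (e, v))"
    using f by (simp add: push_def law_mono_W2)
  also have "\<dots> = law (\<lambda>x. e * f x + v)"
    unfolding law_def by (subst distr_distr) (auto simp: comp_def affine_map_def)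
  also have "\<dots> = law (affine_quantile e v f)"
    using e law_reflect[of "\<lambda>x. - f x + v"] by (auto simp: affine_quantile_def)
  finally show ?thesis .
qed

lemma push_return:
  assumes "\<phi> \<in> carrier Isom" shows "push \<phi> (return borel (x :: real)) = return borel (\<phi> x)"
  using assms
  by (elim IsomE) (simp add: return_eq_law push_law mono_L2_const affine_quantile_def)

lemma affine_quantile_diff_norm:
  assumes f: "f \<in> mono_L2" and g: "g \<in> mono_L2" and e: "e = 1 \<or> e = -1"
  shows "(\<integral>x. (affine_quantile e v f x - affine_quantile e v g x)\<^sup>2 \<partial>U) = (\<integral>x. (f x - g x)\<^sup>2 \<partial>U)"
proof -
  have [measurable]: "f \<in> borel_measurable U" "g \<in> borel_measurable U" using f g by (auto simp: mono_L2_def L2_def)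
  show ?thesis using e
  proof
    assume "e = -1"
    then have "(\<lambda>x. (affine_quantile e v f x - affine_quantile e v g x)\<^sup>2) = (\<lambda>x. (f (1 - x) - g (1 - x))\<^sup>2)"
      by (auto simp: affine_quantile_def power2_commute)
    then show ?thesis using integral_reflect[of "\<lambda>x. (f x - g x)\<^sup>2"] by simp
  qed (simp add: affine_quantile_def)
qed

lemma push_isometric:
  assumes e: "e = 1 \<or> e = -1" shows "W2_isometric (push (affine_map (e, v)))"
  unfolding W2_isometric_def
proof (intro conjI ballI Pi_I)
  show "push (affine_map (e, v)) \<mu> \<in> W2" if "\<mu> \<in> W2" for \<mu>
    using that e by (elim W2_eq_law) (auto simp: push_law intro!: law_mono_W2 affine_quantile_mono_L2)
next
  fix \<mu> \<nu> :: "real measure" assume \<mu>: "\<mu> \<in> W2" and \<nu>: "\<nu> \<in> W2"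
  obtain f where f: "f \<in> mono_L2" "law f = \<mu>" using \<mu> by (rule W2_eq_law)
  obtain g where g: "g \<in> mono_L2" "law g = \<nu>" using \<nu> by (rule W2_eq_law)
  show "dW2 (push (affine_map (e, v)) \<mu>) (push (affine_map (e, v)) \<nu>) = dW2 \<mu> \<nu>"
    using f(1) g(1) e unfolding f(2)[symmetric] g(2)[symmetric]
    by (simp add: push_law dW2_law affine_quantile_mono_L2 affine_quantile_diff_norm)
qed

lemma push_comp:
  assumes "\<phi> \<in> carrier Isom" "\<psi> \<in> carrier Isom" "\<mu> \<in> W2"
  shows "push \<phi> (push \<psi> \<mu>) = push (\<phi> \<circ> \<psi>) (\<mu> :: real measure)"
proof -
  obtain e v where e: "e = 1 \<or> e = -1" "\<phi> = affine_map (e, v)" using assms(1) by (rule IsomE)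
  obtain e' v' where e': "e' = 1 \<or> e' = -1" "\<psi> = affine_map (e', v')" using assms(2) by (rule IsomE)
  have "push \<psi> \<mu> \<in> W2" using push_isometric[OF e'(1), of v'] assms(3) e' by (auto simp: W2_isometric_def)
  moreover have "\<phi> \<in> borel_measurable borel" "\<psi> \<in> borel_measurable borel"
    unfolding e e' affine_map_def by auto
  moreover have "sets \<mu> = sets borel" using assms by (simp add: W2_def)
  ultimately show ?thesis using assms(3)
    by (simp add: push_def distr_distr measurable_cong_sets[of \<mu> borel borel borel])
qed

lemma push_id: "\<mu> \<in> W2 \<Longrightarrow> push (\<lambda>x. x) \<mu> = (\<mu> :: real measure)"
  by (simp add: push_def W2_def distr_id2)

lemma push_IW: assumes "\<phi> \<in> carrier Isom" shows "push \<phi> \<in> carrier IW"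
proof -
  obtain e v where e: "e = 1 \<or> e = -1" "\<phi> = affine_map (e, v)" using assms by (rule IsomE)
  have iso: "W2_isometric (push \<psi>)" if "\<psi> \<in> carrier Isom" for \<psi>
    using that by (elim IsomE) (simp add: push_isometric)
  have i: "inv\<^bsub>Isom\<^esub> \<phi> \<in> carrier Isom" using assms by simp
  have "\<phi> \<circ> inv\<^bsub>Isom\<^esub> \<phi> = (\<lambda>x. x)" using isom_inv_apply(1)[OF assms] by (auto simp: fun_eq_iff)
  then have "push \<phi> (push (inv\<^bsub>Isom\<^esub> \<phi>) \<mu>) = \<mu>" if "\<mu> \<in> W2" for \<mu>
    using push_comp[OF assms i that] that by (simp add: push_id)
  then have "W2 \<subseteq> push \<phi> ` W2" using iso[OF i] by (force simp: W2_isometric_def image_iff)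
  then have "restrict (push \<phi>) W2 \<in> carrier IW" by (intro restrict_IW iso assms)
  then show ?thesis by (simp add: push_def)
qed

lemma push_hom: "push \<in> hom Isom IW"
proof (rule homI)
  fix \<phi> \<psi> :: "real \<Rightarrow> real" assume \<phi>\<psi>: "\<phi> \<in> carrier Isom" "\<psi> \<in> carrier Isom"
  show "push (\<phi> \<otimes>\<^bsub>Isom\<^esub> \<psi>) = push \<phi> \<otimes>\<^bsub>IW\<^esub> push \<psi>"
  proof (rule IW_eqI)
    fix \<mu> :: "real measure" assume "\<mu> \<in> W2"
    then show "push (\<phi> \<otimes>\<^bsub>Isom\<^esub> \<psi>) \<mu> = (push \<phi> \<otimes>\<^bsub>IW\<^esub> push \<psi>) \<mu>"
      using \<phi>\<psi> by (simp add: IW_mult push_IW Isom_mult push_comp)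
  qed (use \<phi>\<psi> in \<open>auto intro!: push_IW IR.m_closed\<close>)
qed (rule push_IW)

lemma push_inj: "inj_on push (carrier (Isom :: (real \<Rightarrow> real) monoid))"
proof (rule inj_onI)
  fix \<phi> \<psi> :: "real \<Rightarrow> real" assume \<phi>\<psi>: "\<phi> \<in> carrier Isom" "\<psi> \<in> carrier Isom" "push \<phi> = push \<psi>"
  have "return borel (\<phi> x) = return borel (\<psi> x)" for x
    using \<phi>\<psi> push_return[of \<phi> x] push_return[of \<psi> x] by simp
  then show "\<phi> = \<psi>" by (auto simp: return_inj)
qed

lemma push_iso: "push \<in> iso Isom (IW\<lparr>carrier := trivial_isometries\<rparr>)"
  using push_hom push_inj by (auto simp: iso_def hom_def bij_betw_def trivial_isometries_def)

lemma trivial_isometries_subgroup: "subgroup (trivial_isometries :: (real measure \<Rightarrow> real measure) set) IW"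
proof -
  have "group_hom Isom IW push"
    using push_hom by (simp add: group_hom_def group_hom_axioms_def IW.is_group IR.is_group)
  then show ?thesis unfolding trivial_isometries_def by (rule group_hom.img_is_subgroup)
qed

text \<open>Every isometry permutes the Dirac masses, so a conjugate of an isometry that fixes them fixes them again.\<close>

lemma dirac_fixing_normal: "(dirac_fixing_isometries :: (real measure \<Rightarrow> real measure) set) \<lhd> IW"
proof -
  let ?D = "dirac_fixing_isometries :: (real measure \<Rightarrow> real measure) set"
  have inv_return: "(inv\<^bsub>IW\<^esub> \<Phi>) (return borel x) = return borel y"
    if "\<Phi> \<in> carrier IW" "\<Phi> (return borel y) = return borel x" for \<Phi> x y
    using isom_inv_apply(2)[OF that(1) return_W2[of y]] that by simp
  have sub: "subgroup ?D IW"
  proof (rule IW.subgroupI)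
    have "\<one>\<^bsub>IW\<^esub> \<in> ?D" by (simp add: dirac_fixing_isometries_def IW_one return_W2)
    then show "?D \<noteq> {}" by blast
  qed (auto simp: dirac_fixing_isometries_def IW_mult return_W2 inv_return)
  have "\<Phi> \<otimes>\<^bsub>IW\<^esub> \<Psi> \<otimes>\<^bsub>IW\<^esub> inv\<^bsub>IW\<^esub> \<Phi> \<in> ?D" if \<Phi>: "\<Phi> \<in> carrier IW" and "\<Psi> \<in> ?D" for \<Phi> \<Psi>
  proof -
    have \<Psi>: "\<Psi> \<in> carrier IW" "\<Psi> (return borel x) = return borel x" for x
      using \<open>\<Psi> \<in> ?D\<close> by (auto simp: dirac_fixing_isometries_def)
    obtain \<phi> where \<phi>: "\<phi> \<in> carrier Isom" "\<And>x. (inv\<^bsub>IW\<^esub> \<Phi>) (return borel x) = return borel (\<phi> x)"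
      using isometry_preserves_diracs[OF IW.inv_closed[OF \<Phi>]] by blast
    have "\<Phi> (return borel (\<phi> x)) = return borel x" for x
      using isom_inv_apply(1)[OF \<Phi> return_W2[of x]] by (simp add: \<phi>)
    then show ?thesis
      using \<Phi> \<Psi> by (simp add: dirac_fixing_isometries_def IW_mult return_W2 \<phi>)
  qed
  then show ?thesis using sub by (simp add: IW.normal_inv_iff)
qed

section \<open>The flow of isometries\<close>

definition quantile :: "real measure \<Rightarrow> real \<Rightarrow> real" where
  "quantile \<mu> = (SOME f. f \<in> mono_L2 \<and> law f = \<mu>)"

lemma quantile: assumes "\<mu> \<in> W2" shows "quantile \<mu> \<in> mono_L2" "law (quantile \<mu>) = \<mu>"
proof -
  have "\<exists>f. f \<in> mono_L2 \<and> law f = \<mu>" using assms by (rule W2_eq_law) blast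
  from someI_ex[OF this] show "quantile \<mu> \<in> mono_L2" "law (quantile \<mu>) = \<mu>" by (auto simp: quantile_def)
qed

text \<open>Well defined on laws when \<open>V\<close> is isometric, whatever quantile function is chosen.\<close>

definition on_quantiles :: "((real \<Rightarrow> real) \<Rightarrow> real \<Rightarrow> real) \<Rightarrow> real measure \<Rightarrow> real measure" where
  "on_quantiles V \<mu> = law (V (quantile \<mu>))"

lemma on_quantiles_isometric:
  assumes V: "\<And>f. f \<in> mono_L2 \<Longrightarrow> V f \<in> mono_L2"
    and iso: "\<And>f g. f \<in> mono_L2 \<Longrightarrow> g \<in> mono_L2 \<Longrightarrow> dW2 (law (V f)) (law (V g)) = dW2 (law f) (law g)"
  shows "W2_isometric (on_quantiles V)"
  using assms unfolding W2_isometric_def by (auto simp: on_quantiles_def quantile law_mono_W2)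

lemma on_quantiles_law:
  assumes V: "\<And>f. f \<in> mono_L2 \<Longrightarrow> V f \<in> mono_L2"
    and iso: "\<And>f g. f \<in> mono_L2 \<Longrightarrow> g \<in> mono_L2 \<Longrightarrow> dW2 (law (V f)) (law (V g)) = dW2 (law f) (law g)"
    and f: "f \<in> mono_L2"
  shows "on_quantiles V (law f) = law (V f)"
proof -
  have W: "law f \<in> W2" using f by (rule law_mono_W2)
  have "dW2 (law (V (quantile (law f)))) (law (V f)) = dW2 (law f) (law f)"
    using iso[OF quantile(1)[OF W] f] quantile(2)[OF W] by simp
  also have "\<dots> = 0" using W by (simp add: dW2_eq_0_iff)
  finally show ?thesis
    using V f W quantile(1)[OF W] by (simp add: on_quantiles_def dW2_eq_0_iff law_mono_W2)
qed

abbreviation flow_W2 :: "real \<Rightarrow> real measure \<Rightarrow> real measure" where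
  "flow_W2 t \<equiv> on_quantiles (flow t)"

lemma flow_W2_isometric: "W2_isometric (flow_W2 t)"
  by (intro on_quantiles_isometric flow_mono_L2 flow_isometric)

lemma flow_W2_law: "f \<in> mono_L2 \<Longrightarrow> flow_W2 t (law f) = law (flow t f)"
  by (intro on_quantiles_law flow_mono_L2 flow_isometric)

lemma flow_W2_return: "flow_W2 t (return borel c) = return borel c"
  unfolding return_eq_law flow_W2_law[OF mono_L2_const]
  by (intro law_cong_AE AE_I2) (auto simp: flow_const flow_mono_L2[OF mono_L2_const] mono_L2_L2 L2_measurable)

lemma flow_W2_unit_step: "flow_W2 t (law (unit_step s)) = law (unit_step (s + t))"
  unfolding flow_W2_law[OF unit_step_mono_L2]
  by (intro law_cong_AE AE_I2) (auto simp: flow_unit_step flow_mono_L2[OF unit_step_mono_L2] unit_step_mono_L2 mono_L2_L2 L2_measurable)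

lemma W2_isometric_comp: "W2_isometric \<Phi> \<Longrightarrow> W2_isometric \<Psi> \<Longrightarrow> W2_isometric (\<lambda>\<mu>. \<Phi> (\<Psi> \<mu>))"
  unfolding W2_isometric_def by (simp add: Pi_iff)

lemma W2_isometric_id: "W2_isometric (\<lambda>\<mu>. \<mu>)"
  by (simp add: W2_isometric_def)

text \<open>The composite with the flow at time \<open>- t\<close> fixes the Dirac masses and the steps, so it is the identity.\<close>

lemma flow_W2_surj: "W2 \<subseteq> flow_W2 t ` W2"
proof
  fix \<mu> :: "real measure" assume \<mu>: "\<mu> \<in> W2"
  have "flow_W2 t (flow_W2 (- t) \<mu>) = \<mu>"
    by (rule isometric_eq_if_eq_on_steps[where \<rho> = "\<lambda>s. s" and \<Phi> = "\<lambda>\<mu>. flow_W2 t (flow_W2 (- t) \<mu>)" and \<Psi> = "\<lambda>\<mu>. \<mu>"])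
      (auto simp: flow_W2_return flow_W2_unit_step \<mu> intro: W2_isometric_comp flow_W2_isometric W2_isometric_id)
  moreover have "flow_W2 (- t) \<mu> \<in> W2" using flow_W2_isometric[of "- t"] \<mu> by (auto simp: W2_isometric_def)
  ultimately show "\<mu> \<in> flow_W2 t ` W2" by force
qed

section \<open>Reflection through the mean\<close>

definition mean :: "real measure \<Rightarrow> real" where
  "mean \<mu> = (\<integral>x. x \<partial>\<mu>)"

definition reflect_W2 :: "real measure \<Rightarrow> real measure" where
  "reflect_W2 \<mu> = push (affine_map (-1, 2 * mean \<mu>)) \<mu>"

lemma mean_law: "f \<in> mono_L2 \<Longrightarrow> mean (law f) = ip f (\<lambda>_. 1)"
  unfolding mean_def law_def by (subst integral_distr) (auto simp: ip_def mono_L2_def L2_def)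

lemma reflect_W2_law: "f \<in> mono_L2 \<Longrightarrow> reflect_W2 (law f) = law (affine_quantile (-1) (2 * ip f (\<lambda>_. 1)) f)"
  by (simp add: reflect_W2_def push_law mean_law)

lemma mean_affine_quantile: 
  assumes f: "f \<in> mono_L2" shows "ip (affine_quantile (-1) v f) (\<lambda>_. 1) = v - ip f (\<lambda>_. 1)"
proof -
  have f': "integrable U f" using f by (simp add: integrable_L2 mono_L2_L2)
  then have "(\<integral>x. - f (1 - x) + v \<partial>U) = - (\<integral>x. f (1 - x) \<partial>U) + v"
    using integrable_reflect[OF f'] U.prob_space by simp
  then show ?thesis using integral_reflect[of f] f' by (simp add: ip_def affine_quantile_def)
qed

lemma ip_reflect:
  assumes f: "f \<in> mono_L2" and g: "g \<in> mono_L2"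
  shows "ip (affine_quantile (-1) 0 f) (affine_quantile (-1) 0 g) = ip f g"
proof -
  have "(\<lambda>x. f x * g x) \<in> borel_measurable U" using f g by (auto simp: mono_L2_def L2_def)
  from integral_reflect[OF this] show ?thesis by (simp add: ip_def affine_quantile_def)
qed

lemma reflect_W2_isometric: "W2_isometric reflect_W2"
  unfolding W2_isometric_def
proof (intro conjI ballI Pi_I)
  show "reflect_W2 \<mu> \<in> W2" if "\<mu> \<in> W2" for \<mu>
    using that push_isometric[of "-1"] by (auto simp: reflect_W2_def W2_isometric_def)
next
  fix \<mu> \<nu> :: "real measure" assume \<mu>: "\<mu> \<in> W2" and \<nu>: "\<nu> \<in> W2"
  obtain f where f: "f \<in> mono_L2" "law f = \<mu>" using \<mu> by (rule W2_eq_law)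
  obtain g where g: "g \<in> mono_L2" "law g = \<nu>" using \<nu> by (rule W2_eq_law)
  let ?v = "2 * ip f (\<lambda>_. 1)" and ?w = "2 * ip g (\<lambda>_. 1)"
  let ?f = "affine_quantile (-1) 0 f" and ?g = "affine_quantile (-1) 0 g"
  have q0: "?f \<in> mono_L2" "?g \<in> mono_L2" using f g by (auto intro: affine_quantile_mono_L2)
  have q: "affine_quantile (-1) v h = (\<lambda>x. affine_quantile (-1) 0 h x + v * 1)" for v h by (simp add: affine_quantile_def)
  have qm: "affine_quantile (-1) ?v f \<in> mono_L2" "affine_quantile (-1) ?w g \<in> mono_L2" using f g by (auto intro: affine_quantile_mono_L2)
  have m: "ip ?f (\<lambda>_. 1) = - ip f (\<lambda>_. 1)" "ip ?g (\<lambda>_. 1) = - ip g (\<lambda>_. 1)"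
    using mean_affine_quantile[OF f(1), of 0] mean_affine_quantile[OF g(1), of 0] by simp_all
  have i: "ip (affine_quantile (-1) v h) (affine_quantile (-1) w k) = ip h k + w * ip (affine_quantile (-1) 0 h) (\<lambda>_. 1) + v * ip (affine_quantile (-1) 0 k) (\<lambda>_. 1) + v * w"
    if "h \<in> mono_L2" "k \<in> mono_L2" for v w h k
  proof -
    have L: "affine_quantile (-1) 0 h \<in> L2" "affine_quantile (-1) 0 k \<in> L2" using that by (auto intro!: mono_L2_L2 affine_quantile_mono_L2)
    then show ?thesis unfolding q[of v] q[of w]
      using ip_reflect[OF that] ip_scale_left[of v "\<lambda>_. 1"] ip_scale_right[of _ w "\<lambda>_. 1"]
      by (simp add: ip_add_left ip_add_right L2_const L2_add ip_const ip_commute[of "\<lambda>_. v"])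
         (simp add: ip_commute[of _ "affine_quantile (-1) 0 k"] ip_def algebra_simps)
  qed
  have "(dW2 (reflect_W2 \<mu>) (reflect_W2 \<nu>))\<^sup>2 = (dW2 \<mu> \<nu>)\<^sup>2"
    using f(1) g(1) qm q0 unfolding f(2)[symmetric] g(2)[symmetric]
    by (simp add: reflect_W2_law dW2_law_ip i m algebra_simps)
  then show "dW2 (reflect_W2 \<mu>) (reflect_W2 \<nu>) = dW2 \<mu> \<nu>"
    by (simp add: dW2_nonneg)
qed

lemma reflect_W2_involution: assumes "\<mu> \<in> W2" shows "reflect_W2 (reflect_W2 \<mu>) = \<mu>"
proof -
  obtain f where f: "f \<in> mono_L2" "law f = \<mu>" using assms by (rule W2_eq_law)
  let ?m = "ip f (\<lambda>_. 1)"
  have q: "affine_quantile (-1) (2 * ?m) f \<in> mono_L2" using f by (intro affine_quantile_mono_L2) auto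
  have "reflect_W2 (reflect_W2 \<mu>) = law (affine_quantile (-1) (2 * ?m) (affine_quantile (-1) (2 * ?m) f))"
    using f q unfolding f(2)[symmetric] by (simp add: reflect_W2_law mean_affine_quantile)
  also have "affine_quantile (-1) (2 * ?m) (affine_quantile (-1) (2 * ?m) f) = f" by (simp add: affine_quantile_def fun_eq_iff)
  finally show ?thesis using f by simp
qed

lemma reflect_W2_return: "reflect_W2 (return borel c) = return borel c"
  unfolding return_eq_law by (simp add: reflect_W2_law mono_L2_const ip_const affine_quantile_def)

lemma logistic_minus: "logistic (- s) = 1 - logistic s"
proof -
  have "logistic (- s) = exp (- s) / (1 + exp (- s))"
  proof -
    have "1 + exp s = exp s * (1 + exp (- s))" by (simp add: distrib_left exp_add[symmetric])
    moreover have "0 < 1 + exp (- s)" by (simp add: add_pos_pos)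
    ultimately show ?thesis by (simp add: logistic_def exp_minus divide_simps)
  qed
  moreover have "0 < 1 + exp (- s)" by (simp add: add_pos_pos)
  ultimately show ?thesis by (simp add: logistic_def field_simps)
qed

lemma law_affine_quantile_minus_unit_step: "law (affine_quantile (-1) v (unit_step s)) = law (\<lambda>x. unit_step (- s) x + v)"
proof (rule law_cong_AE)
  have "AE x in U. x \<notin> {logistic (- s)}" by (rule countable_AE_U) simp
  then show "AE x in U. affine_quantile (-1) v (unit_step s) x = unit_step (- s) x + v"
    by eventually_elim (auto simp: affine_quantile_def unit_step_def logistic_minus)
  show "affine_quantile (-1) v (unit_step s) \<in> borel_measurable U"
    using affine_quantile_mono_L2[OF unit_step_mono_L2] by (auto simp: mono_L2_def L2_def)
  show "(\<lambda>x. unit_step (- s) x + v) \<in> borel_measurable U"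
    using unit_step_mono_L2[of "- s"] by (auto simp: mono_L2_def L2_def)
qed

lemma reflect_W2_unit_step: "reflect_W2 (law (unit_step s)) = law (unit_step (- s))"
  using law_affine_quantile_minus_unit_step[of 0 s] by (simp add: reflect_W2_law unit_step_mono_L2 mean_unit_step)

section \<open>The group of isometries fixing the Dirac masses\<close>

definition acts_as :: "(real measure \<Rightarrow> real measure) \<Rightarrow> (real \<Rightarrow> real) \<Rightarrow> bool" where
  "acts_as \<Phi> \<rho> \<longleftrightarrow> \<Phi> \<in> dirac_fixing_isometries \<and> (\<forall>s. \<Phi> (law (unit_step s)) = law (unit_step (\<rho> s)))"

lemma dirac_fixingD:
  assumes "\<Phi> \<in> dirac_fixing_isometries"
  shows "\<Phi> \<in> carrier IW" "W2_isometric \<Phi>" "\<Phi> (return borel c) = return borel c" "W2 \<subseteq> \<Phi> ` W2"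
proof -
  show c: "\<Phi> \<in> carrier IW" and "\<Phi> (return borel c) = return borel c"
    using assms by (auto simp: dirac_fixing_isometries_def)
  show "W2_isometric \<Phi>" "W2 \<subseteq> \<Phi> ` W2" using c by (rule IW_isometric, rule IW_surj)
qed

lemma acts_as_unique:
  assumes "acts_as \<Phi> \<rho>" "acts_as \<Psi> \<rho>" "surj \<rho>" shows "\<Phi> = \<Psi>"
proof -
  have D: "\<Phi> \<in> dirac_fixing_isometries" "\<Psi> \<in> dirac_fixing_isometries"
    and act: "\<Phi> (law (unit_step s)) = law (unit_step (\<rho> s))" "\<Psi> (law (unit_step s)) = law (unit_step (\<rho> s))" for s
    using assms by (auto simp: acts_as_def)
  show ?thesis
  proof (rule IW_eqI[OF dirac_fixingD(1)[OF D(1)] dirac_fixingD(1)[OF D(2)]])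
    fix \<mu> :: "real measure" assume "\<mu> \<in> W2"
    then show "\<Phi> \<mu> = \<Psi> \<mu>"
      by (rule isometric_eq_if_eq_on_steps[OF dirac_fixingD(2,3)[OF D(1)] dirac_fixingD(2,3)[OF D(2)] act assms(3)])
  qed
qed

lemma acts_as_function_unique: "acts_as \<Phi> \<rho> \<Longrightarrow> acts_as \<Phi> \<sigma> \<Longrightarrow> \<rho> = \<sigma>"
proof
  fix s assume "acts_as \<Phi> \<rho>" "acts_as \<Phi> \<sigma>"
  then have "law (unit_step (\<rho> s)) = law (\<lambda>x. unit_step (\<sigma> s) x + 0)" by (simp add: acts_as_def)
  then show "\<rho> s = \<sigma> s" by (blast dest: law_unit_step_inj)
qed

text \<open>With \<open>acts_as_unique\<close> and \<open>acts_as_exists\<close> this identifies the isometries fixing the Dirac masses with the isometries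
  of the parameter line.\<close>

lemma dirac_fixing_acts:
  assumes "\<Phi> \<in> dirac_fixing_isometries"
  obtains \<rho> where "\<rho> \<in> carrier Isom" "acts_as \<Phi> \<rho>"
proof -
  obtain \<rho> :: "real \<Rightarrow> real" where \<rho>: "\<And>s. \<Phi> (law (unit_step s)) = law (unit_step (\<rho> s))" "\<And>s t. dist (\<rho> s) (\<rho> t) = dist s t"
    using dirac_fixing_acts_isometrically[OF dirac_fixingD(2-4)[OF assms]] by blast
  have "\<rho> \<in> carrier Isom" using \<rho>(2) by (rule real_isometry_affine) (auto intro: affine_map_Isom)
  then show thesis using that \<rho> assms by (auto simp: acts_as_def)
qed

lemma acts_as_mult:
  assumes "acts_as \<Phi> \<rho>" "acts_as \<Psi> \<sigma>" shows "acts_as (\<Phi> \<otimes>\<^bsub>IW\<^esub> \<Psi>) (\<rho> \<circ> \<sigma>)"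
proof -
  have D: "\<Phi> \<in> dirac_fixing_isometries" "\<Psi> \<in> dirac_fixing_isometries" using assms by (auto simp: acts_as_def)
  then have "\<Phi> \<otimes>\<^bsub>IW\<^esub> \<Psi> \<in> dirac_fixing_isometries"
    by (rule subgroup.m_closed[OF normal_imp_subgroup[OF dirac_fixing_normal]])
  then show ?thesis
    using assms IW_mult[OF dirac_fixingD(1)[OF D(1)] dirac_fixingD(1)[OF D(2)] law_mono_W2[OF unit_step_mono_L2]]
    by (simp add: acts_as_def)
qed

lemma acts_as_restrict:
  assumes "W2_isometric \<Phi>" "W2 \<subseteq> \<Phi> ` W2" "\<And>c. \<Phi> (return borel c) = return borel c"
    "\<And>s. \<Phi> (law (unit_step s)) = law (unit_step (\<rho> s))"
  shows "acts_as (restrict \<Phi> W2) \<rho>"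
  using restrict_IW[OF assms(1,2)] assms(3,4)
  by (simp add: acts_as_def dirac_fixing_isometries_def return_W2 law_mono_W2 unit_step_mono_L2)

lemma acts_as_flow: "acts_as (restrict (flow_W2 t) W2) (affine_map (1, t))"
  by (rule acts_as_restrict) (auto simp: flow_W2_return flow_W2_unit_step flow_W2_surj flow_W2_isometric)

lemma acts_as_reflect: "acts_as (restrict reflect_W2 W2) (affine_map (-1, 0))"
proof (rule acts_as_restrict)
  show "W2 \<subseteq> reflect_W2 ` W2"
    using reflect_W2_involution reflect_W2_isometric by (force simp: W2_isometric_def image_iff)
qed (auto simp: reflect_W2_return reflect_W2_unit_step reflect_W2_isometric)

text \<open>Every isometry of the line is a translation, realised by the flow, or a translation after \<open>s \<mapsto> - s\<close>, realised by
  the reflection.\<close>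

lemma acts_as_exists:
  assumes "\<rho> \<in> carrier Isom" obtains \<Phi> where "acts_as \<Phi> \<rho>"
proof -
  obtain e t where e: "e = 1 \<or> e = -1" and \<rho>: "\<rho> = affine_map (e, t)" using assms by (rule IsomE)
  show thesis
  proof (cases "e = 1")
    case True then show thesis using acts_as_flow that \<rho> by blast
  next
    case False
    then have "\<rho> = affine_map (1, t) \<circ> affine_map (-1, 0)" using e \<rho> by (auto simp: affine_map_comp)
    then show thesis using acts_as_mult[OF acts_as_flow[of t] acts_as_reflect] by (intro that) simp
  qed
qed

definition dirac_isometry :: "(real \<Rightarrow> real) \<Rightarrow> real measure \<Rightarrow> real measure" where
  "dirac_isometry \<rho> = (THE \<Phi>. acts_as \<Phi> \<rho>)"

lemma Isom_surj: "\<rho> \<in> carrier (Isom :: (real \<Rightarrow> real) monoid) \<Longrightarrow> surj \<rho>"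
  by (simp add: isom_carrier_iff bij_betw_def)

lemma dirac_isometry_eq:
  assumes "\<rho> \<in> carrier Isom" and act: "acts_as \<Phi> \<rho>" shows "dirac_isometry \<rho> = \<Phi>"
  unfolding dirac_isometry_def
proof (rule the_equality)
  show "acts_as \<Phi> \<rho>" by (rule act)
next
  fix \<Psi> assume "acts_as \<Psi> \<rho>"
  then show "\<Psi> = \<Phi>" using act Isom_surj[OF assms(1)] by (rule acts_as_unique)
qed

lemma acts_as_dirac_isometry:
  assumes "\<rho> \<in> carrier Isom" shows "acts_as (dirac_isometry \<rho>) \<rho>"
proof -
  obtain \<Phi> where "acts_as \<Phi> \<rho>" using assms by (rule acts_as_exists)
  then show ?thesis using dirac_isometry_eq[OF assms] by simp
qed

lemma dirac_isometry_IW: "\<rho> \<in> carrier Isom \<Longrightarrow> dirac_isometry \<rho> \<in> carrier IW"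
  using acts_as_dirac_isometry by (auto simp: acts_as_def dirac_fixingD)

lemma dirac_isometry_mult:
  assumes "\<rho> \<in> carrier Isom" "\<sigma> \<in> carrier Isom"
  shows "dirac_isometry (\<rho> \<otimes>\<^bsub>Isom\<^esub> \<sigma>) = dirac_isometry \<rho> \<otimes>\<^bsub>IW\<^esub> dirac_isometry \<sigma>"
  using assms acts_as_mult[OF acts_as_dirac_isometry acts_as_dirac_isometry, of \<rho> \<sigma>] IR.m_closed[of \<rho> \<sigma>]
  by (intro dirac_isometry_eq) (simp_all add: Isom_mult)

lemma dirac_isometry_iso: "dirac_isometry \<in> iso Isom (IW\<lparr>carrier := dirac_fixing_isometries\<rparr>)"
proof -
  have cl: "dirac_isometry \<rho> \<in> dirac_fixing_isometries" if "\<rho> \<in> carrier Isom" for \<rho>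
    using acts_as_dirac_isometry[OF that] by (simp add: acts_as_def)
  have "inj_on dirac_isometry (carrier Isom)"
  proof (rule inj_onI)
    fix \<rho> \<sigma> :: "real \<Rightarrow> real"
    assume "\<rho> \<in> carrier Isom" "\<sigma> \<in> carrier Isom" "dirac_isometry \<rho> = dirac_isometry \<sigma>"
    then show "\<rho> = \<sigma>"
      using acts_as_dirac_isometry[of \<rho>] acts_as_dirac_isometry[of \<sigma>]
      by (intro acts_as_function_unique[of "dirac_isometry \<rho>"]) simp_all
  qed
  moreover have "dirac_isometry ` carrier Isom = dirac_fixing_isometries"
  proof
    show "dirac_fixing_isometries \<subseteq> dirac_isometry ` carrier Isom"
    proof
      fix \<Phi> :: "real measure \<Rightarrow> real measure" assume "\<Phi> \<in> dirac_fixing_isometries"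
      then obtain \<rho> where "\<rho> \<in> carrier Isom" "acts_as \<Phi> \<rho>" by (rule dirac_fixing_acts)
      then show "\<Phi> \<in> dirac_isometry ` carrier Isom" using dirac_isometry_eq by blast
    qed
  qed (use cl in blast)
  ultimately show ?thesis using cl dirac_isometry_mult by (auto simp: iso_def hom_def bij_betw_def)
qed

text \<open>Adding a constant is a linear relation with the constant function 1, which the isometry fixes.\<close>

lemma law_add_const:
  assumes \<Phi>: "W2_isometric \<Phi>" "\<And>c. \<Phi> (return borel c) = return borel c"
    and f: "f \<in> mono_L2" "g \<in> mono_L2" "\<Phi> (law f) = law g"
  shows "\<Phi> (law (\<lambda>x. f x + c)) = law (\<lambda>x. g x + c)"
proof -
  let ?k0 = "\<lambda>x. f x + c"
  have k0: "?k0 \<in> mono_L2" and gc: "(\<lambda>x. g x + c) \<in> mono_L2" using f by (auto intro: mono_L2_add mono_L2_const)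
  have "\<Phi> (law ?k0) \<in> W2" using \<Phi>(1) law_mono_W2[OF k0] by (auto simp: W2_isometric_def)
  then obtain k where k: "k \<in> mono_L2" "law k = \<Phi> (law ?k0)" by (rule W2_eq_law)
  note pres = ip_preserved[OF \<Phi>] and pres1 = ip_one_preserved[OF \<Phi>]
  have "AE x in U. 1 * k x + (-1) * g x + (- c) * 1 = 0"
    by (rule AE_relation_transfer[of ?k0 f "\<lambda>_. 1" k g "\<lambda>_. 1"])
      (use f k k0 in \<open>auto intro!: pres pres1 mono_L2_L2 mono_L2_const\<close>)
  then have "AE x in U. k x = g x + c" by eventually_elim simp
  then have "law k = law (\<lambda>x. g x + c)" using law_eq_iff[OF k(1) gc] by blast
  then show ?thesis using k by simp
qed

section \<open>The semidirect product\<close>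

lemma push_unit_step:
  assumes e: "e = 1 \<or> e = -1"
  shows "push (affine_map (e, v)) (law (\<lambda>x. unit_step s x + c)) = law (\<lambda>x. unit_step (e * s) x + (e * c + v))"
proof -
  have m: "(\<lambda>x. unit_step s x + c) \<in> mono_L2" by (intro mono_L2_add unit_step_mono_L2 mono_L2_const)
  have "affine_quantile 1 v (\<lambda>x. unit_step s x + c) = (\<lambda>x. unit_step s x + (c + v))" by (auto simp: affine_quantile_def)
  moreover have "affine_quantile (-1) v (\<lambda>x. unit_step s x + c) = affine_quantile (-1) (- c + v) (unit_step s)" by (auto simp: affine_quantile_def)
  ultimately show ?thesis using e law_affine_quantile_minus_unit_step[of "- c + v" s] by (auto simp: push_law[OF m])
qed

text \<open>The conjugate fixes the Dirac masses, so it suffices to follow a step. The inverse push-forward turns the step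
  with parameter \<open>s\<close> into one with parameter \<open>e * s\<close>, shifted by a constant; the middle isometry moves the parameter and
  carries the constant along; the push-forward multiplies the parameter by \<open>e\<close> again and removes the constant. The translation part
  \<open>v\<close> cancels, which is why only the sign of \<open>\<phi>\<close> acts.\<close>

lemma push_conj_dirac_isometry:
  assumes \<phi>: "\<phi> \<in> carrier Isom" and \<psi>: "\<psi> \<in> carrier Isom"
  shows "push \<phi> \<otimes>\<^bsub>IW\<^esub> dirac_isometry \<psi> \<otimes>\<^bsub>IW\<^esub> inv\<^bsub>IW\<^esub> (push \<phi>) = dirac_isometry (isom_action \<phi> \<psi>)"
proof -
  let ?X = "push \<phi> \<otimes>\<^bsub>IW\<^esub> dirac_isometry \<psi> \<otimes>\<^bsub>IW\<^esub> inv\<^bsub>IW\<^esub> (push \<phi>)"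
  obtain e v where e: "e = 1 \<or> e = -1" and \<phi>_eq: "\<phi> = affine_map (e, v)" using \<phi> by (rule IsomE)
  obtain n t where n: "n = 1 \<or> n = -1" and \<psi>_eq: "\<psi> = affine_map (n, t)" using \<psi> by (rule IsomE)
  note P = push_IW[OF \<phi>] and Q = dirac_isometry_IW[OF \<psi>]
  have D: "dirac_isometry \<psi> \<in> dirac_fixing_isometries"
    and act: "dirac_isometry \<psi> (law (unit_step s)) = law (unit_step (n * s + t))" for s
    using acts_as_dirac_isometry[OF \<psi>] by (auto simp: acts_as_def \<psi>_eq)
  have XD: "?X \<in> dirac_fixing_isometries" using dirac_fixing_normal D P by (simp add: IW.normal_inv_iff)
  have "?X (law (unit_step s)) = law (unit_step (isom_action \<phi> \<psi> s))" for s
  proof -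
    \<comment> \<open>the image of the step under the inverse push-forward\<close>
    let ?\<nu> = "law (\<lambda>x. unit_step (e * s) x + (- e * v))"
    have \<nu>: "?\<nu> \<in> W2" by (intro law_mono_W2 mono_L2_add unit_step_mono_L2 mono_L2_const)
    have "push \<phi> ?\<nu> = law (unit_step s)"
      using push_unit_step[OF e, of v "e * s" "- e * v"] e by (auto simp: \<phi>_eq)
    then have inv: "(inv\<^bsub>IW\<^esub> (push \<phi>)) (law (unit_step s)) = ?\<nu>"
      using isom_inv_apply(2)[OF P \<nu>] by simp
    have "?X (law (unit_step s)) = (push \<phi> \<otimes>\<^bsub>IW\<^esub> dirac_isometry \<psi>) ((inv\<^bsub>IW\<^esub> (push \<phi>)) (law (unit_step s)))"
      using P Q by (intro IW_mult IW.m_closed IW.inv_closed law_mono_W2 unit_step_mono_L2)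
    also have "\<dots> = push \<phi> (dirac_isometry \<psi> ?\<nu>)"
      unfolding inv by (rule IW_mult[OF P Q \<nu>])
    also have "dirac_isometry \<psi> ?\<nu> = law (\<lambda>x. unit_step (n * (e * s) + t) x + (- e * v))"
      by (intro law_add_const dirac_fixingD[OF D] unit_step_mono_L2 act)
    also have "push \<phi> \<dots> = law (\<lambda>x. unit_step (e * (n * (e * s) + t)) x + (e * (- e * v) + v))"
      unfolding \<phi>_eq by (rule push_unit_step[OF e])
    also have "(e * (- e * v) + v) = 0" using e by auto
    also have "e * (n * (e * s) + t) = isom_action \<phi> \<psi> s"
      using e n by (auto simp: \<phi>_eq \<psi>_eq isom_action_affine_map algebra_simps)
    finally show ?thesis by simp
  qed
  then have "acts_as ?X (isom_action \<phi> \<psi>)" using XD by (simp add: acts_as_def)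
  then show ?thesis using dirac_isometry_eq[OF isom_action_closed[OF \<phi> \<psi>]] by simp
qed

text \<open>An isometry of the Wasserstein space is determined by what it does to the Dirac masses, which a
  push-forward imitates, up to an isometry fixing them.\<close>

lemma semidirect_iso:
  "(\<lambda>(\<phi>, \<psi>). dirac_isometry \<psi> \<otimes>\<^bsub>IW\<^esub> push \<phi>) \<in> iso (semidirect_product Isom Isom isom_action) IW"
    (is "?h \<in> _")
proof -
  let ?S = "semidirect_product Isom Isom isom_action"
  have c: "carrier ?S = carrier Isom \<times> carrier Isom" by (simp add: semidirect_product_def)
  have m: "(\<phi>, \<psi>) \<otimes>\<^bsub>?S\<^esub> (\<phi>', \<psi>') = (\<phi> \<otimes>\<^bsub>Isom\<^esub> \<phi>', \<psi> \<otimes>\<^bsub>Isom\<^esub> isom_action \<phi> \<psi>')" for \<phi> \<psi> \<phi>' \<psi>'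
    by (simp add: semidirect_product_def)
  have hom: "?h \<in> hom ?S IW"
  proof (rule homI)
    fix x assume "x \<in> carrier ?S"
    then show "?h x \<in> carrier IW" by (auto simp: c intro!: IW.m_closed dirac_isometry_IW push_IW)
  next
    fix x y assume "x \<in> carrier ?S" "y \<in> carrier ?S"
    then obtain \<phi> \<psi> \<phi>' \<psi>' where xy: "x = (\<phi>, \<psi>)" "y = (\<phi>', \<psi>')"
      and C: "\<phi> \<in> carrier Isom" "\<psi> \<in> carrier Isom" "\<phi>' \<in> carrier Isom" "\<psi>' \<in> carrier Isom" by (auto simp: c)
    note G = push_IW[OF C(1)] push_IW[OF C(3)] dirac_isometry_IW[OF C(2)] dirac_isometry_IW[OF C(4)]
    have "?h (x \<otimes>\<^bsub>?S\<^esub> y) = dirac_isometry \<psi> \<otimes>\<^bsub>IW\<^esub> dirac_isometry (isom_action \<phi> \<psi>') \<otimes>\<^bsub>IW\<^esub> (push \<phi> \<otimes>\<^bsub>IW\<^esub> push \<phi>')"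
      using C hom_mult[OF push_hom, of \<phi> \<phi>'] by (simp add: xy m dirac_isometry_mult isom_action_closed)
    also have "\<dots> = dirac_isometry \<psi> \<otimes>\<^bsub>IW\<^esub> push \<phi> \<otimes>\<^bsub>IW\<^esub> (dirac_isometry \<psi>' \<otimes>\<^bsub>IW\<^esub> push \<phi>')"
      unfolding push_conj_dirac_isometry[OF C(1,4), symmetric]
      using G by (simp add: IW.m_assoc IW.inv_solve_left' IW.m_closed)
    finally show "?h (x \<otimes>\<^bsub>?S\<^esub> y) = ?h x \<otimes>\<^bsub>IW\<^esub> ?h y" by (simp add: xy)
  qed
  have inj: "inj_on ?h (carrier ?S)"
  proof (rule inj_onI)
    fix x y assume x: "x \<in> carrier ?S" and y: "y \<in> carrier ?S" and eq: "?h x = ?h y"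
    obtain \<phi> \<psi> where x': "x = (\<phi>, \<psi>)" "\<phi> \<in> carrier Isom" "\<psi> \<in> carrier Isom" using x by (auto simp: c)
    obtain \<phi>' \<psi>' where y': "y = (\<phi>', \<psi>')" "\<phi>' \<in> carrier Isom" "\<psi>' \<in> carrier Isom" using y by (auto simp: c)
    have h_return: "(dirac_isometry \<sigma> \<otimes>\<^bsub>IW\<^esub> push \<rho>) (return borel z) = return borel (\<rho> z)"
      if "\<rho> \<in> carrier Isom" "\<sigma> \<in> carrier Isom" for \<rho> \<sigma> z
      using that acts_as_dirac_isometry[OF that(2)]
      by (simp add: IW_mult push_IW dirac_isometry_IW return_W2 push_return acts_as_def dirac_fixingD)
    have "return borel (\<phi> z) = return borel (\<phi>' z)" for z
      using eq h_return[OF x'(2,3), of z] h_return[OF y'(2,3), of z] by (simp add: x' y')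
    then have "\<phi> = \<phi>'" by (auto simp: return_inj)
    moreover have "dirac_isometry \<psi> = dirac_isometry \<psi>'"
      using eq \<open>\<phi> = \<phi>'\<close> x' y' IW.right_cancel[OF push_IW dirac_isometry_IW dirac_isometry_IW] by simp
    then have "\<psi> = \<psi>'" using dirac_isometry_iso x' y' by (auto simp: iso_def bij_betw_def dest: inj_onD)
    ultimately show "x = y" by (simp add: x' y')
  qed
  have "carrier IW \<subseteq> ?h ` carrier ?S"
  proof
    fix \<Phi> assume \<Phi>: "\<Phi> \<in> carrier IW"
    obtain \<phi> where \<phi>: "\<phi> \<in> carrier Isom" "\<And>x. \<Phi> (return borel x) = return borel (\<phi> x)"
      using isometry_preserves_diracs[OF \<Phi>] by blast
    note P = push_IW[OF \<phi>(1)]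
    let ?X = "\<Phi> \<otimes>\<^bsub>IW\<^esub> inv\<^bsub>IW\<^esub> (push \<phi>)"
    have "?X (return borel x) = return borel x" for x
    proof -
      obtain y where y: "\<phi> y = x" using Isom_surj[OF \<phi>(1)] by (metis surjD)
      then have "(inv\<^bsub>IW\<^esub> (push \<phi>)) (return borel x) = return borel y"
        using isom_inv_apply(2)[OF P return_W2[of y]] by (simp add: push_return[OF \<phi>(1)])
      then show ?thesis using \<Phi> P y by (simp add: IW_mult return_W2 \<phi>)
    qed
    then have "?X \<in> dirac_fixing_isometries" using \<Phi> P by (simp add: dirac_fixing_isometries_def)
    then obtain \<psi> where \<psi>': "\<psi> \<in> carrier Isom" "acts_as ?X \<psi>" by (rule dirac_fixing_acts)
    then have \<psi>: "\<psi> \<in> carrier Isom" "dirac_isometry \<psi> = ?X" by (auto intro: dirac_isometry_eq)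
    have "\<Phi> = ?h (\<phi>, \<psi>)" using \<Phi> P \<psi> by (simp add: IW.m_assoc)
    moreover have "(\<phi>, \<psi>) \<in> carrier ?S" using \<phi>(1) \<psi>(1) by (simp add: c)
    ultimately show "\<Phi> \<in> ?h ` carrier ?S" by (rule image_eqI)
  qed
  moreover have "?h ` carrier ?S \<subseteq> carrier IW" using hom by (rule hom_carrier)
  ultimately show ?thesis using hom inj by (auto simp: iso_def bij_betw_def)
qed

text \<open>Stated for structures not known to be groups, such as the semidirect product before the isomorphism is used.\<close>

lemma iso_inv_into:
  assumes h: "h \<in> iso G H" and closed: "\<And>x y. x \<in> carrier G \<Longrightarrow> y \<in> carrier G \<Longrightarrow> x \<otimes>\<^bsub>G\<^esub> y \<in> carrier G"
  shows "inv_into (carrier G) h \<in> iso H G"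
proof -
  let ?g = "inv_into (carrier G) h"
  have hom: "h \<in> hom G H" and bij: "bij_betw h (carrier G) (carrier H)" using h by (auto simp: iso_def)
  have gb: "bij_betw ?g (carrier H) (carrier G)" using bij by (rule bij_betw_inv_into)
  have g: "?g y \<in> carrier G" "h (?g y) = y" if "y \<in> carrier H" for y
    using that bij gb by (auto simp: bij_betw_def f_inv_into_f)
  have "?g (x \<otimes>\<^bsub>H\<^esub> y) = ?g x \<otimes>\<^bsub>G\<^esub> ?g y" if "x \<in> carrier H" "y \<in> carrier H" for x y
  proof -
    have "h (?g x \<otimes>\<^bsub>G\<^esub> ?g y) = x \<otimes>\<^bsub>H\<^esub> y" using that g hom by (simp add: hom_def)
    then show ?thesis using closed g that bij by (metis bij_betw_def inv_into_f_f)
  qed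
  then show ?thesis using gb g by (auto simp: iso_def hom_def)
qed

section \<open>The shape-preserving involution and the exotic flow\<close>

lemma affine_Isom: "affine_map (1, t) \<in> carrier Isom" "affine_map (-1, t) \<in> carrier Isom"
  by (auto intro: affine_map_Isom)

lemma dirac_isometry_reflection: "dirac_isometry (affine_map (-1, 0)) = restrict reflect_W2 W2"
  using affine_Isom(2) acts_as_reflect by (rule dirac_isometry_eq)

lemma dirac_isometry_flow: "dirac_isometry (affine_map (1, t)) = restrict (flow_W2 t) W2"
  using affine_Isom(1) acts_as_flow by (rule dirac_isometry_eq)

lemma dirac_isometry_one: "dirac_isometry (affine_map (1, 0)) = \<one>\<^bsub>IW\<^esub>"
proof (rule dirac_isometry_eq[OF affine_Isom(1)])
  show "acts_as \<one>\<^bsub>IW\<^esub> (affine_map (1, 0))"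
    by (simp add: acts_as_def dirac_fixing_isometries_def IW_one return_W2 law_mono_W2 unit_step_mono_L2)
qed

lemma generate_involution:
  assumes "group G" "j \<in> carrier G" "j \<otimes>\<^bsub>G\<^esub> j = \<one>\<^bsub>G\<^esub>"
  shows "generate G {j} = {\<one>\<^bsub>G\<^esub>, j}"
proof -
  interpret group G by fact
  have inv: "inv\<^bsub>G\<^esub> j = j" using assms by (metis inv_equality)
  have "x \<in> {\<one>\<^bsub>G\<^esub>, j}" if "x \<in> generate G {j}" for x
    using that by (induction rule: generate.induct) (use assms inv in auto)
  then show ?thesis using generate.one[of G "{j}"] generate.incl[of j "{j}" G] by auto
qed

lemma reflection_properties:
  fixes j defines "j \<equiv> dirac_isometry (affine_map (-1, 0))"
  shows "generate IW {j} = dirac_isometry ` affine_map ` (carrier sign_group \<times> {0})"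
    and "j \<notin> trivial_isometries" and "j \<otimes>\<^bsub>IW\<^esub> j = \<one>\<^bsub>IW\<^esub>" and "preserves_shapes j"
proof -
  have jC: "j \<in> carrier IW" unfolding j_def by (intro dirac_isometry_IW affine_Isom)
  have "j \<otimes>\<^bsub>IW\<^esub> j = dirac_isometry (affine_map (-1, 0) \<otimes>\<^bsub>Isom\<^esub> affine_map (-1, 0))"
    by (simp add: j_def dirac_isometry_mult affine_Isom)
  also have "\<dots> = \<one>\<^bsub>IW\<^esub>" by (simp add: affine_map_mult dirac_isometry_one)
  finally show jj: "j \<otimes>\<^bsub>IW\<^esub> j = \<one>\<^bsub>IW\<^esub>" .
  show "generate IW {j} = dirac_isometry ` affine_map ` (carrier sign_group \<times> {0})"
    unfolding generate_involution[OF IW.is_group jC jj]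
    by (simp add: sign_group_def j_def dirac_isometry_one insert_commute)
  have act: "acts_as j (affine_map (-1, 0))" unfolding j_def by (intro acts_as_dirac_isometry affine_Isom)
  show "j \<notin> trivial_isometries"
  proof
    assume "j \<in> trivial_isometries"
    then obtain \<phi> where \<phi>: "\<phi> \<in> carrier Isom" "j = push \<phi>" by (auto simp: trivial_isometries_def)
    have "return borel (\<phi> x) = return borel x" for x
      using act push_return[OF \<phi>(1), of x] by (simp add: \<phi> acts_as_def dirac_fixingD)
    then have "\<phi> = (\<lambda>x. x)" by (auto simp: return_inj)
    then have "j (law (unit_step 1)) = law (unit_step 1)" using \<phi> by (simp add: push_id law_mono_W2 unit_step_mono_L2)
    then have "law (unit_step 1) = law (unit_step (- 1))" using act by (simp add: acts_as_def)
    then show False using law_unit_step_inj[of 1 "-1" 0] by simp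
  qed
  show "preserves_shapes j"
    unfolding preserves_shapes_def j_def dirac_isometry_reflection
    using affine_Isom(2) by (auto simp: reflect_W2_def)
qed

lemma dirac_isometry_flow_isometric_flow: "isometric_flow W2 dW2 (\<lambda>t. dirac_isometry (affine_map (1, t)))"
  unfolding isometric_flow_def
proof (intro conjI ballI allI)
  let ?F = "\<lambda>t. dirac_isometry (affine_map (1, t))"
  have mult: "?F (s + t) = ?F s \<otimes>\<^bsub>IW\<^esub> ?F t" for s t
    using dirac_isometry_mult[OF affine_Isom(1) affine_Isom(1), of s t] by (simp add: affine_map_mult)
  then show "?F \<in> hom real_additive_group IW"
    by (auto simp: hom_def real_additive_group_def dirac_isometry_IW affine_Isom)
  fix \<mu> :: "real measure" and s :: real assume \<mu>: "\<mu> \<in> W2"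
  have F: "?F t \<in> carrier IW" for t by (intro dirac_isometry_IW affine_Isom)
  obtain f where f: "f \<in> mono_L2" "law f = \<mu>" using \<mu> by (rule W2_eq_law)
  have "dW2 (?F t \<mu>) (?F s \<mu>) = dW2 (law (flow (t - s) f)) (law f)" for t
  proof -
    have "?F t \<mu> = ?F s (?F (t - s) \<mu>)" using mult[of s "t - s"] F \<mu> by (simp add: IW_mult)
    then have "dW2 (?F t \<mu>) (?F s \<mu>) = dW2 (?F (t - s) \<mu>) \<mu>"
      using F[of s] isom_closed[OF F \<mu>, of "t - s"] \<mu> by (simp add: isom_carrier_iff)
    also have "?F (t - s) \<mu> = law (flow (t - s) f)"
      using \<mu> flow_W2_law[OF f(1), of "t - s"] f(2) by (simp add: dirac_isometry_flow)
    finally show ?thesis unfolding f(2) .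
  qed
  moreover have "((\<lambda>t. dW2 (law (flow (t - s) f)) (law f)) \<longlongrightarrow> 0) (at s)"
    using flow_strongly_continuous[OF f(1)] by (subst filterlim_at_to_0) simp
  ultimately show "((\<lambda>t. dW2 (?F t \<mu>) (?F s \<mu>)) \<longlongrightarrow> 0) (at s)" by simp
qed

text \<open>The flow moves \<open>unit_step 0\<close>, two atoms of equal mass, to \<open>unit_step t\<close>. An isometry of the line can only change its
  sign, which leaves it fixed in law, and shift it.\<close>

lemma dirac_isometry_flow_exotic:
  assumes "t \<noteq> 0" shows "exotic (dirac_isometry (affine_map (1, t)))"
proof -
  have "\<not> preserves_shapes (dirac_isometry (affine_map (1, t)))"
  proof
    assume "preserves_shapes (dirac_isometry (affine_map (1, t)))"
    moreover have "law (unit_step 0) \<in> W2" by (intro law_mono_W2 unit_step_mono_L2)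
    ultimately obtain \<phi> where \<phi>: "\<phi> \<in> carrier Isom"
      "dirac_isometry (affine_map (1, t)) (law (unit_step 0)) = push \<phi> (law (unit_step 0))"
      by (auto simp: preserves_shapes_def)
    obtain e v where e: "e = 1 \<or> e = -1" "\<phi> = affine_map (e, v)" using \<phi>(1) by (rule IsomE)
    have "dirac_isometry (affine_map (1, t)) (law (unit_step 0)) = law (unit_step t)"
      using acts_as_dirac_isometry[OF affine_Isom(1), of t] by (simp add: acts_as_def)
    moreover have "push \<phi> (law (unit_step 0)) = law (\<lambda>x. unit_step 0 x + v)"
      using push_unit_step[OF e(1), of v 0 0] by (simp add: e(2))
    ultimately show False using \<phi>(2) law_unit_step_inj[of t 0 v] assms by simp
  qed
  then show ?thesis by (simp add: exotic_def dirac_isometry_IW affine_Isom)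
qed

theorem theorem1p1:
  shows
    "affine_map \<in> iso (semidirect_product sign_group real_additive_group (\<lambda>\<epsilon> v. \<epsilon> * v))
                       (Isom :: (real \<Rightarrow> real) monoid)
     \<and> isom_action \<in> hom Isom (AutoGroup Isom)
     \<and> (IsomW2 :: (real measure \<Rightarrow> real measure) monoid) \<cong> semidirect_product Isom Isom isom_action
     \<and> (push :: (real \<Rightarrow> real) \<Rightarrow> _) \<in> iso Isom (IsomW2\<lparr>carrier := trivial_isometries\<rparr>)
     \<and> subgroup (trivial_isometries :: (real measure \<Rightarrow> real measure) set) IsomW2
     \<and> (dirac_fixing_isometries :: (real measure \<Rightarrow> real measure) set) \<lhd> IsomW2
     \<and> (\<exists>\<Psi> :: (real \<Rightarrow> real) \<Rightarrow> real measure \<Rightarrow> real measure.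
          \<Psi> \<in> iso Isom (IsomW2\<lparr>carrier := dirac_fixing_isometries\<rparr>)
          \<and> (\<lambda>(\<phi>, \<psi>). \<Psi> \<psi> \<otimes>\<^bsub>IsomW2\<^esub> push \<phi>) \<in> iso (semidirect_product Isom Isom isom_action) IsomW2
          \<and> (let j = \<Psi> (affine_map (-1, 0)) in
               generate IsomW2 {j} = \<Psi> ` affine_map ` (carrier sign_group \<times> {0})
               \<and> j \<notin> trivial_isometries
               \<and> j \<otimes>\<^bsub>IsomW2\<^esub> j = \<one>\<^bsub>IsomW2\<^esub>
               \<and> preserves_shapes j)
          \<and> isometric_flow W2 dW2 (\<lambda>t. \<Psi> (affine_map (1, t)))
          \<and> (\<forall>t. t \<noteq> 0 \<longrightarrow> exotic (\<Psi> (affine_map (1, t)))))"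
proof (intro conjI exI[of _ dirac_isometry])
  show "IW \<cong> semidirect_product Isom Isom isom_action"
  proof (rule is_isoI, rule iso_inv_into[OF semidirect_iso])
    fix x y assume "x \<in> carrier (semidirect_product Isom Isom isom_action)" "y \<in> carrier (semidirect_product Isom Isom isom_action)"
    then show "x \<otimes>\<^bsub>semidirect_product Isom Isom isom_action\<^esub> y \<in> carrier (semidirect_product Isom Isom isom_action)"
      by (auto simp: semidirect_product_def isom_action_closed)
  qed
  show "let j = dirac_isometry (affine_map (-1, 0)) in
      generate IsomW2 {j} = dirac_isometry ` affine_map ` (carrier sign_group \<times> {0})
      \<and> j \<notin> trivial_isometries \<and> j \<otimes>\<^bsub>IsomW2\<^esub> j = \<one>\<^bsub>IsomW2\<^esub> \<and> preserves_shapes j"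
    unfolding Let_def using reflection_properties by blast
  show "\<forall>t. t \<noteq> 0 \<longrightarrow> exotic (dirac_isometry (affine_map (1, t)))"
    using dirac_isometry_flow_exotic by blast
qed (fact affine_map_iso isom_action_hom push_iso trivial_isometries_subgroup dirac_fixing_normal
    dirac_isometry_iso semidirect_iso dirac_isometry_flow_isometric_flow)+

end
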